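(* Let $\alpha\in[0,1)$ and let $K_\alpha(x,y)=\dfrac{1}{x^2+2\cos(\pi\alpha)xy+y^2}$ on $(0,+\infty)\times(0,+\infty)$. Then: (a) $K_\alpha\in \mathrm{STP}_\infty \iff K_\alpha\in\mathrm{SR}_\infty \iff \alpha\in\{1/2,1/3,\ldots,1/n,\ldots\}\cup\{0\}$. (b) For every integer $n\ge 2$: $K_\alpha\in\mathrm{TP}_n\iff K_\alpha\in\mathrm{SR}_n$, and $K_\alpha\in\mathrm{SR}_n \Rightarrow \big(\alpha\in\{1/2,1/3,\ldots,1/n\}$ or $\alpha<1/n\big)$. (c) For every integer $n\ge 2$: if $\alpha\le 1/n$ and $\alpha\le 1/(n^2-n-6)_+$ (with the convention $1/0=+\infty$), then $K_\alpha\in\mathrm{STP}_n$.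
   Context: For a real kernel $K$ on $I\times I$ ($I$ a real interval) and $n\in\{1,2,\ldots\}\cup\{\infty\}$: $K$ is $\mathrm{TP}_n$ (totally positive of order $n$) if $\det[K(x_i,y_j)]_{1\le i,j\le m}\ge 0$ for every finite $m\le n$ and all $x_1<\cdots<x_m$, $y_1<\cdots<y_m$ in $I$; $K$ is $\mathrm{SR}_n$ (sign-regular of order $n$) if there exist signs $\varepsilon_m\in\{-1,1\}$ ($m\le n$) such that $\varepsilon_m\det[K(x_i,y_j)]_{1\le i,j\le m}\ge0$ for all such $m$ and points. $\mathrm{STP}_n$ (resp. $\mathrm{SSR}_n$) means the same with all inequalities strict. $(a)_+=\max(a,0)$. *)

theory Defs
  imports Complex_Main "HOL-Library.Extended_Nat" "Jordan_Normal_Form.Determinant"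
begin

definition incr_pts :: "real set \<Rightarrow> nat \<Rightarrow> (nat \<Rightarrow> real) \<Rightarrow> bool" where
  "incr_pts I m x \<longleftrightarrow> (\<forall>i<m. x i \<in> I) \<and> (\<forall>i j. i < j \<and> j < m \<longrightarrow> x i < x j)"

definition kminor :: "(real \<Rightarrow> real \<Rightarrow> real) \<Rightarrow> nat \<Rightarrow> (nat \<Rightarrow> real) \<Rightarrow> (nat \<Rightarrow> real) \<Rightarrow> real" where
  "kminor K m x y = det (mat m m (\<lambda>(i,j). K (x i) (y j)))"

definition TP :: "real set \<Rightarrow> enat \<Rightarrow> (real \<Rightarrow> real \<Rightarrow> real) \<Rightarrow> bool" where
  "TP I n K \<longleftrightarrow> (\<forall>m x y. 1 \<le> m \<and> enat m \<le> n \<and> incr_pts I m x \<and> incr_pts I m y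
      \<longrightarrow> kminor K m x y \<ge> 0)"

definition STP :: "real set \<Rightarrow> enat \<Rightarrow> (real \<Rightarrow> real \<Rightarrow> real) \<Rightarrow> bool" where
  "STP I n K \<longleftrightarrow> (\<forall>m x y. 1 \<le> m \<and> enat m \<le> n \<and> incr_pts I m x \<and> incr_pts I m y
      \<longrightarrow> kminor K m x y > 0)"

definition SR :: "real set \<Rightarrow> enat \<Rightarrow> (real \<Rightarrow> real \<Rightarrow> real) \<Rightarrow> bool" where
  "SR I n K \<longleftrightarrow> (\<exists>\<epsilon>::nat \<Rightarrow> real. (\<forall>m. \<epsilon> m \<in> {-1, 1}) \<and>
      (\<forall>m x y. 1 \<le> m \<and> enat m \<le> n \<and> incr_pts I m x \<and> incr_pts I m y
         \<longrightarrow> \<epsilon> m * kminor K m x y \<ge> 0))"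

definition SSR :: "real set \<Rightarrow> enat \<Rightarrow> (real \<Rightarrow> real \<Rightarrow> real) \<Rightarrow> bool" where
  "SSR I n K \<longleftrightarrow> (\<exists>\<epsilon>::nat \<Rightarrow> real. (\<forall>m. \<epsilon> m \<in> {-1, 1}) \<and>
      (\<forall>m x y. 1 \<le> m \<and> enat m \<le> n \<and> incr_pts I m x \<and> incr_pts I m y
         \<longrightarrow> \<epsilon> m * kminor K m x y > 0))"

definition Kalpha :: "real \<Rightarrow> real \<Rightarrow> real \<Rightarrow> real" where
  "Kalpha \<alpha> x y = 1 / (x^2 + 2 * cos (pi * \<alpha>) * x * y + y^2)"

end

theory Submission
  imports "HOL-Analysis.Analysis" "HOL-Real_Asymp.Real_Asymp" Defs
begin

text \<open>
  With \<open>\<theta> = \<pi>\<alpha>\<close>, \<open>x = e\<^sup>u\<close> and \<open>y = e\<^sup>v\<close>, the kernel \<open>sin \<theta> \<cdot> x y K\<^sub>\<alpha>(x, y)\<close> is a function of \<open>u - v\<close> whose Fourier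
  transform is proportional to \<open>sinh (\<alpha>s) / sinh s\<close> (suitably scaled), that is to
  \<open>\<Prod>\<^sub>k (1 + \<alpha>\<^sup>2s\<^sup>2/k\<^sup>2) / (1 + s\<^sup>2/k\<^sup>2)\<close>, with zeros \<open>k/\<alpha>\<close> and poles \<open>k\<close>. If \<open>n\<alpha> < 1\<close>, each zero \<open>k/\<alpha>\<close> can be
  grouped with the \<open>n\<close> smaller poles \<open>(k-1)n + 1, \<dots>, kn\<close>. On a lattice such a group is the one-sided
  Toeplitz kernel with generating function \<open>(1 - az) / \<Prod>\<^sub>j (1 - b\<^sub>jz)\<close>, \<open>a < b\<^sub>j\<close>, whose consecutive minors of
  order \<open>n\<close> reduce to the single product \<open>\<Prod>\<^sub>j (b\<^sub>j - a) b\<^sub>j\<^sup>d\<^sup>-\<^sup>1\<close>; hence it is totally positive of order \<open>n\<close>, and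
  so are all compositions and their limit \<open>K\<^sub>\<alpha>\<close>. If \<open>n\<alpha> = 1\<close> the zeros cancel against poles and the
  order is unrestricted. So \<open>K\<^sub>\<alpha>\<close> is strictly totally positive of order \<open>n\<close> whenever \<open>\<alpha> \<le> 1/n\<close>.

  Conversely, if \<open>1/r < \<alpha> < 1/(r-1)\<close>, then the minors of order \<open>r\<close> are positive for \<open>x = y\<close> widely spread, while
  for small \<open>x\<close> they have the sign of \<open>\<Prod>\<^sub>k\<^sub>\<le>\<^sub>r sin (k\<theta>)\<close>, which is negative.
\<close>

section \<open>Determinants of kernel matrices\<close>

text \<open>Each passage to a limit (infinite lattice sum, mesh to 0, more zeros and poles,
  coinciding points, \<alpha> to 0) keeps only weak inequalities. Strictness is therefore carried
  only where a finite argument consumes it: on the lattice, where filling gaps by the three-term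
  relation divides by minors of lower order. For the kernel itself it is recovered at the end from
  linear independence. One zero per group has a concrete source: the Toeplitz entries are sums of
  \<open>n\<close> exponentials, and with a numerator of degree 1 this formula stays correct far
  enough above the diagonal to cover every consecutive block of order \<open>n\<close> whose corner
  lies strictly below the diagonal; such a block factors through two Vandermonde matrices. The
  two-sided kernel arises as a one-sided Toeplitz matrix times its transpose, so Cauchy-Binet
  transfers positivity. For necessity, the signs of the Vandermonde determinants are never computed:
  they are fixed by comparison with the parameter \<open>1 / (r + 1)\<close>, where sufficiency is
  already known.\<close>

definition fdet :: "nat \<Rightarrow> (nat \<Rightarrow> nat \<Rightarrow> real) \<Rightarrow> real" where
  "fdet m f = det (mat m m (\<lambda>(i,j). f i j))"

lemma fdet_cong:
  assumes "\<And>i j. i < m \<Longrightarrow> j < m \<Longrightarrow> f i j = g i j"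
  shows "fdet m f = fdet m g"
proof -
  have "mat m m (\<lambda>(i,j). f i j) = mat m m (\<lambda>(i,j). g i j)"
    using assms by (intro eq_matI) auto
  then show ?thesis by (simp add: fdet_def)
qed

lemma fdet_0 [simp]: "fdet 0 f = 1"
  by (simp add: fdet_def)

lemma fdet_1 [simp]: "fdet (Suc 0) f = f 0 0"
  unfolding fdet_def by (subst det_single) auto

lemma fdet_expand:
  "fdet m f = (\<Sum>p | p permutes {0..<m}. signof p * (\<Prod>i<m. f i (p i)))"
proof -
  have "fdet m f = (\<Sum>p | p permutes {0..<m}. signof p *
     (\<Prod>i = 0..<m. mat m m (\<lambda>(i,j). f i j) $$ (i, p i)))"
    unfolding fdet_def by (rule det_def') auto
  also have "\<dots> = (\<Sum>p | p permutes {0..<m}. signof p * (\<Prod>i<m. f i (p i)))"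
  proof (intro sum.cong refl arg_cong2[where f = "(*)"])
    fix p assume "p \<in> {p. p permutes {0..<m}}"
    then have "\<And>i. i < m \<Longrightarrow> p i < m" using permutes_in_image by fastforce
    then show "(\<Prod>i = 0..<m. mat m m (\<lambda>(i,j). f i j) $$ (i, p i)) = (\<Prod>i<m. f i (p i))"
      by (intro prod.cong) auto
  qed
  finally show ?thesis .
qed

lemma fdet_transpose: "fdet m (\<lambda>i j. f j i) = fdet m f"
proof -
  have "transpose_mat (mat m m (\<lambda>(i,j). f i j)) = mat m m (\<lambda>(i,j). f j i)"
    by (intro eq_matI) auto
  then show ?thesis
    unfolding fdet_def using det_transpose[of "mat m m (\<lambda>(i,j). f i j)" m] by simp
qed

lemma fdet_laplace_row:
  assumes "i \<le> m"
  shows "fdet (Suc m) f = (\<Sum>j\<le>m. (-1) ^ (i + j) * f i j *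
           fdet m (\<lambda>i' j'. f (insert_index i i') (insert_index j j')))"
proof -
  let ?A = "mat (Suc m) (Suc m) (\<lambda>(i,j). f i j)"
  have *: "det (mat_delete ?A i j) = fdet m (\<lambda>i' j'. f (insert_index i i') (insert_index j j'))"
    if "j \<le> m" for j
    unfolding fdet_def mat_delete_def using that assms
    by (intro arg_cong[where f = det] eq_matI) (auto simp: insert_index_def)
  have "fdet (Suc m) f = (\<Sum>j<Suc m. ?A $$ (i,j) * cofactor ?A i j)"
    unfolding fdet_def by (rule laplace_expansion_row) (use assms in auto)
  also have "\<dots> = (\<Sum>j\<le>m. (-1) ^ (i + j) * f i j *
           fdet m (\<lambda>i' j'. f (insert_index i i') (insert_index j j')))"
    using assms by (intro sum.cong) (auto simp: cofactor_def * )
  finally show ?thesis .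
qed

lemma fdet_laplace_col:
  assumes "j \<le> m"
  shows "fdet (Suc m) f = (\<Sum>i\<le>m. (-1) ^ (i + j) * f i j *
           fdet m (\<lambda>i' j'. f (insert_index i i') (insert_index j j')))"
proof -
  have "fdet (Suc m) f = fdet (Suc m) (\<lambda>i j. f j i)"
    by (rule fdet_transpose[symmetric])
  also have "\<dots> = (\<Sum>i\<le>m. (-1) ^ (j + i) * f i j *
           fdet m (\<lambda>i' j'. f (insert_index i j') (insert_index j i')))"
    by (rule fdet_laplace_row[OF assms])
  also have "\<dots> = (\<Sum>i\<le>m. (-1) ^ (i + j) * f i j *
           fdet m (\<lambda>i' j'. f (insert_index i i') (insert_index j j')))"
  proof (intro sum.cong refl)
    fix i
    have "fdet m (\<lambda>i' j'. f (insert_index i j') (insert_index j i')) =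
          fdet m (\<lambda>i' j'. f (insert_index i i') (insert_index j j'))"
      by (rule fdet_transpose)
    then show "(-1) ^ (j + i) * f i j * fdet m (\<lambda>i' j'. f (insert_index i j') (insert_index j i')) =
          (-1) ^ (i + j) * f i j * fdet m (\<lambda>i' j'. f (insert_index i i') (insert_index j j'))"
      by (simp add: add.commute)
  qed
  finally show ?thesis .
qed

lemma fdet_same_rows:
  assumes "i < m" "j < m" "i \<noteq> j" "\<And>k. k < m \<Longrightarrow> f i k = f j k"
  shows "fdet m f = 0"
  unfolding fdet_def
  by (rule det_identical_rows[of _ m i j]) (use assms in \<open>auto intro!: eq_vecI\<close>)

lemma fdet_same_cols:
  assumes "i < m" "j < m" "i \<noteq> j" "\<And>k. k < m \<Longrightarrow> f k i = f k j"
  shows "fdet m f = 0"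
  by (subst fdet_transpose[symmetric], rule fdet_same_rows[of i m j]) (use assms in auto)

lemma fdet_permute_rows:
  assumes "p permutes {0..<m}"
  shows "fdet m (\<lambda>i. f (p i)) = signof p * fdet m f"
proof -
  have "mat m m (\<lambda>(i,j). f (p i) j) = mat m m (\<lambda>(i,j). mat m m (\<lambda>(i,j). f i j) $$ (p i, j))"
    using permutes_in_image[OF assms] by (intro eq_matI) (auto simp: atLeast0LessThan)
  then show ?thesis
    unfolding fdet_def using det_permute_rows[of "mat m m (\<lambda>(i,j). f i j)" m p] assms by simp
qed

lemma fdet_permute_cols:
  assumes "p permutes {0..<m}"
  shows "fdet m (\<lambda>i j. f i (p j)) = signof p * fdet m f"
proof -
  have "fdet m (\<lambda>i j. f i (p j)) = fdet m (\<lambda>j i. f i (p j))"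
    by (rule fdet_transpose)
  also have "\<dots> = signof p * fdet m (\<lambda>j i. f i j)"
    by (rule fdet_permute_rows[OF assms])
  also have "fdet m (\<lambda>j i. f i j) = fdet m f"
    by (rule fdet_transpose)
  finally show ?thesis .
qed

lemma fdet_scale: "fdet m (\<lambda>i j. a i * b j * f i j) = (\<Prod>i<m. a i) * (\<Prod>j<m. b j) * fdet m f"
  unfolding fdet_expand sum_distrib_left
proof (intro sum.cong refl)
  fix p assume "p \<in> {p. p permutes {0..<m}}"
  then have "p permutes {..<m}" by (simp add: lessThan_atLeast0)
  then have "(\<Prod>i<m. b (p i)) = (\<Prod>i<m. b i)"
    using prod.permute[of p "{..<m}" b] by (simp add: comp_def)
  then show "signof p * (\<Prod>i<m. a i * b (p i) * f i (p i)) =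
    (\<Prod>i<m. a i) * (\<Prod>j<m. b j) * (signof p * (\<Prod>i<m. f i (p i)))"
    by (simp add: prod.distrib)
qed

lemma fdet_mult:
  "fdet m (\<lambda>i j. \<Sum>k<m. f i k * g k j) = fdet m f * fdet m g"
proof -
  have "mat m m (\<lambda>(i,j). \<Sum>k<m. f i k * g k j) = mat m m (\<lambda>(i,j). f i j) * mat m m (\<lambda>(i,j). g i j)"
    by (intro eq_matI) (auto simp: scalar_prod_def lessThan_atLeast0)
  then show ?thesis
    unfolding fdet_def by (simp add: det_mult[of _ m])
qed

lemma tendsto_fdet:
  assumes "\<And>i j. i < m \<Longrightarrow> j < m \<Longrightarrow> ((\<lambda>s. f s i j) \<longlongrightarrow> g i j) F"
  shows "((\<lambda>s. fdet m (f s)) \<longlongrightarrow> fdet m g) F"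
  unfolding fdet_expand
proof (intro tendsto_sum tendsto_mult tendsto_const tendsto_prod)
  fix p i assume "p \<in> {p. p permutes {0..<m}}" "i \<in> {..<m}"
  then show "((\<lambda>s. f s i (p i)) \<longlongrightarrow> g i (p i)) F"
    using assms[of i "p i"] permutes_in_image[of p "{0..<m}" i] by auto
qed

lemma fdet_lower_triangular:
  assumes "\<And>i j. i < j \<Longrightarrow> j < m \<Longrightarrow> f i j = 0"
  shows "fdet m f = (\<Prod>i<m. f i i)"
proof -
  have "det (mat m m (\<lambda>(i,j). f i j)) = prod_list (diag_mat (mat m m (\<lambda>(i,j). f i j)))"
    by (rule det_lower_triangular[of m]) (use assms in auto)
  then show ?thesis
    by (simp add: fdet_def prod_list_diag_prod lessThan_atLeast0)
qed

text \<open>Pigeonhole: the first \<open>k + 1\<close> rows are supported on only \<open>k\<close>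
  columns, so every term of the permutation expansion contains a zero entry.\<close>

lemma fdet_zero_block:
  assumes "k < m" "\<And>i j. i \<le> k \<Longrightarrow> k \<le> j \<Longrightarrow> j < m \<Longrightarrow> f i j = 0"
  shows "fdet m f = 0"
  unfolding fdet_expand
proof (intro sum.neutral ballI)
  fix p assume "p \<in> {p. p permutes {0..<m}}"
  then have p: "p permutes {0..<m}" by simp
  have "\<exists>i\<le>k. k \<le> p i"
  proof (rule ccontr)
    assume "\<not> ?thesis"
    then have "p ` {..k} \<subseteq> {..<k}" by auto
    then have "card (p ` {..k}) \<le> k"
      using card_mono[of "{..<k}" "p ` {..k}"] by simp
    moreover have "card (p ` {..k}) = Suc k"
      using permutes_inj[OF p] by (simp add: card_image inj_on_def)
    ultimately show False by simp
  qed
  then obtain i where i: "i \<le> k" "k \<le> p i" by auto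
  with assms(1) permutes_in_image[OF p, of i] have "p i < m" by auto
  then have "f i (p i) = 0" using i assms(2) by auto
  then have "(\<Prod>i<m. f i (p i)) = 0"
    using i assms(1) by (intro prod_zero) auto
  then show "signof p * (\<Prod>i<m. f i (p i)) = 0" by simp
qed

text \<open>Cauchy-Binet in symmetrised form: the sum runs over all index functions instead of the
  increasing ones, which counts every index set \<open>m!\<close> times and accounts for the factor
  \<open>fact m\<close>. Only signs are read off later, so this form is enough.\<close>

lemma fdet_sum_product:
  assumes "finite S"
  shows "fact m * fdet m (\<lambda>i j. \<Sum>z\<in>S. A i z * B z j) =
     (\<Sum>z\<in>{0..<m} \<rightarrow>\<^sub>E S. fdet m (\<lambda>i k. A i (z k)) * fdet m (\<lambda>k j. B (z k) j))"
proof -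
  let ?Z = "{0..<m} \<rightarrow>\<^sub>E S" and ?P = "{p. p permutes {0..<m}}"
  let ?D = "\<lambda>z. fdet m (\<lambda>k j. B (z k) j)"
  have "fdet m (\<lambda>i j. \<Sum>z\<in>S. A i z * B z j) =
      (\<Sum>p\<in>?P. signof p * (\<Sum>z\<in>?Z. \<Prod>i<m. A i (z i) * B (z i) (p i)))"
    unfolding fdet_expand lessThan_atLeast0
  proof (rule sum.cong[OF refl])
    fix p
    show "signof p * (\<Prod>i = 0..<m. \<Sum>z\<in>S. A i z * B z (p i)) =
      signof p * (\<Sum>z\<in>?Z. \<Prod>i = 0..<m. A i (z i) * B (z i) (p i))"
      using prod_sum_PiE[of "{0..<m}" "\<lambda>_. S" "\<lambda>i z. A i z * B z (p i)"] assms by simp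
  qed
  also have "\<dots> = (\<Sum>z\<in>?Z. (\<Prod>i<m. A i (z i)) * ?D z)"
    unfolding fdet_expand sum_distrib_left prod.distrib
    by (subst sum.swap) (simp add: mult_ac)
  finally have 1: "fdet m (\<lambda>i j. \<Sum>z\<in>S. A i z * B z j) = (\<Sum>z\<in>?Z. (\<Prod>i<m. A i (z i)) * ?D z)" .
  \<comment> \<open>Reindexing \<open>z\<close> by a permutation \<open>p\<close> costs
    \<open>signof p\<close> through the second determinant; summing over all \<open>p\<close> then
    assembles the first determinant out of the bare product.\<close>
  have 2: "(\<Sum>z\<in>?Z. (\<Prod>i<m. A i (z i)) * ?D z) =
           (\<Sum>z\<in>?Z. signof p * (\<Prod>i<m. A i (z (p i))) * ?D z)" if p: "p \<in> ?P" for p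
  proof -
    have pp: "p permutes {0..<m}" using p by simp
    have bij: "bij_betw (\<lambda>z. z \<circ> p) ?Z ?Z"
    proof (rule bij_betw_byWitness[where f' = "\<lambda>z. z \<circ> Hilbert_Choice.inv p"])
      show "(\<lambda>z. z \<circ> p) ` ?Z \<subseteq> ?Z"
        using permutes_in_image[OF pp] permutes_not_in[OF pp]
        by (auto simp: PiE_def extensional_def Pi_def)
      show "(\<lambda>z. z \<circ> Hilbert_Choice.inv p) ` ?Z \<subseteq> ?Z"
        using permutes_in_image[OF permutes_inv[OF pp]] permutes_not_in[OF permutes_inv[OF pp]]
        by (auto simp: PiE_def extensional_def Pi_def)
    qed (use permutes_inv_o[OF pp] in \<open>auto simp: o_assoc[symmetric]\<close>)
    have "(\<Sum>z\<in>?Z. (\<Prod>i<m. A i (z i)) * ?D z) =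
          (\<Sum>z\<in>?Z. (\<Prod>i<m. A i ((z \<circ> p) i)) * ?D (z \<circ> p))"
      by (rule sum.reindex_bij_betw[OF bij, symmetric])
    also have "\<dots> = (\<Sum>z\<in>?Z. signof p * (\<Prod>i<m. A i (z (p i))) * ?D z)"
    proof (rule sum.cong[OF refl])
      fix z
      have "?D (z \<circ> p) = signof p * ?D z"
        unfolding comp_def by (rule fdet_permute_rows[OF pp])
      then show "(\<Prod>i<m. A i ((z \<circ> p) i)) * ?D (z \<circ> p) = signof p * (\<Prod>i<m. A i (z (p i))) * ?D z"
        by (simp only: comp_def mult_ac)
    qed
    finally show ?thesis .
  qed
  have "fact m * fdet m (\<lambda>i j. \<Sum>z\<in>S. A i z * B z j) =
        (\<Sum>p\<in>?P. \<Sum>z\<in>?Z. (\<Prod>i<m. A i (z i)) * ?D z)"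
    unfolding 1 by (simp add: card_permutations[of "{0..<m}" m])
  also have "\<dots> = (\<Sum>p\<in>?P. \<Sum>z\<in>?Z. signof p * (\<Prod>i<m. A i (z (p i))) * ?D z)"
    by (intro sum.cong refl 2)
  also have "\<dots> = (\<Sum>z\<in>?Z. fdet m (\<lambda>i k. A i (z k)) * ?D z)"
    unfolding fdet_expand sum_distrib_right by (rule sum.swap)
  finally show ?thesis .
qed

lemma obtain_sorting_permutation:
  fixes z :: "nat \<Rightarrow> 'a :: linorder"
  assumes "inj_on z {0..<m}"
  obtains p where "p permutes {0..<m}" "\<And>i j. i < j \<Longrightarrow> j < m \<Longrightarrow> z (p i) < z (p j)"
proof -
  let ?S = "z ` {0..<m}"
  define w where "w i = sorted_list_of_set ?S ! i" for i
  have len: "length (sorted_list_of_set ?S) = m"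
    using assms by (simp add: card_image)
  have w_bij: "bij_betw w {0..<m} ?S"
    unfolding w_def using bij_betw_nth[of "sorted_list_of_set ?S" "{0..<m}" ?S] len
    by (simp add: lessThan_atLeast0)
  have w_less: "w i < w j" if "i < j" "j < m" for i j
    unfolding w_def using that len
    by (simp add: sorted_wrt_nth_less[OF strict_sorted_list_of_set])
  have inv_bij: "bij_betw (inv_into {0..<m} z) ?S {0..<m}"
    using assms by (intro bij_betw_inv_into) (simp add: bij_betw_def)
  define p where "p i = (if i < m then inv_into {0..<m} z (w i) else i)" for i
  have "bij_betw p {0..<m} {0..<m}"
    using bij_betw_trans[OF w_bij inv_bij]
    by (rule bij_betw_cong[THEN iffD1, rotated]) (auto simp: p_def)
  then have 1: "p permutes {0..<m}"
    by (rule bij_imp_permutes) (auto simp: p_def)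
  have "z (p i) = w i" if "i < m" for i
    unfolding p_def using that bij_betwE[OF w_bij] by (auto intro!: f_inv_into_f)
  then have 2: "z (p i) < z (p j)" if "i < j" "j < m" for i j
    using w_less that by simp
  show thesis using that 1 2 by blast
qed

text \<open>Sorting the index function multiplies both determinants by the same sign, which cancels
  in the product; if an index repeats, two rows of the second determinant agree. Hence increasing
  index functions decide everything.\<close>

lemma fdet_product_nonneg:
  fixes z :: "nat \<Rightarrow> 'a :: linorder"
  assumes "\<And>w. (\<And>i j. i < j \<Longrightarrow> j < m \<Longrightarrow> w i < w j) \<Longrightarrow>
             0 \<le> fdet m (\<lambda>i k. A i (w k)) * fdet m (\<lambda>k j. B (w k) j)"
  shows "0 \<le> fdet m (\<lambda>i k. A i (z k)) * fdet m (\<lambda>k j. B (z k) j)"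
proof (cases "inj_on z {0..<m}")
  case True
  then obtain p where p: "p permutes {0..<m}" "\<And>i j. i < j \<Longrightarrow> j < m \<Longrightarrow> z (p i) < z (p j)"
    using obtain_sorting_permutation by blast
  have "0 \<le> fdet m (\<lambda>i k. A i (z (p k))) * fdet m (\<lambda>k j. B (z (p k)) j)"
    using assms[of "z \<circ> p"] p(2) by simp
  also have "\<dots> = (signof p * signof p) * (fdet m (\<lambda>i k. A i (z k)) * fdet m (\<lambda>k j. B (z k) j))"
    using fdet_permute_rows[OF p(1), of "\<lambda>k. B (z k)"] fdet_permute_cols[OF p(1), of "\<lambda>i k. A i (z k)"]
    by simp
  also have "signof p * signof p = (1::real)"
    by (simp add: sign_def)
  finally show ?thesis by simp
next
  case False
  then obtain i j where "i < m" "j < m" "i \<noteq> j" "z i = z j"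
    by (auto simp: inj_on_def)
  then have "fdet m (\<lambda>k j. B (z k) j) = 0"
    by (intro fdet_same_rows[of i m j]) auto
  then show ?thesis by simp
qed

lemma fdet_sum_product_nonneg:
  fixes A :: "nat \<Rightarrow> 'a :: linorder \<Rightarrow> real"
  assumes "finite S"
    and "\<And>w. (\<And>i j. i < j \<Longrightarrow> j < m \<Longrightarrow> w i < w j) \<Longrightarrow> 0 \<le> fdet m (\<lambda>i k. A i (w k))"
    and "\<And>w. (\<And>i j. i < j \<Longrightarrow> j < m \<Longrightarrow> w i < w j) \<Longrightarrow> 0 \<le> fdet m (\<lambda>k j. B (w k) j)"
  shows "0 \<le> fdet m (\<lambda>i j. \<Sum>z\<in>S. A i z * B z j)"
proof -
  have "0 \<le> fact m * fdet m (\<lambda>i j. \<Sum>z\<in>S. A i z * B z j)"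
    unfolding fdet_sum_product[OF assms(1)]
    by (rule sum_nonneg, rule fdet_product_nonneg, rule mult_nonneg_nonneg; rule assms(2,3))
  moreover have "(0::real) < fact m" by simp
  ultimately show ?thesis by (simp only: zero_le_mult_iff) linarith
qed

lemma fdet_sum_product_pos:
  fixes A :: "nat \<Rightarrow> 'a :: linorder \<Rightarrow> real"
  assumes "finite S"
    and "\<And>w. (\<And>i j. i < j \<Longrightarrow> j < m \<Longrightarrow> w i < w j) \<Longrightarrow> 0 \<le> fdet m (\<lambda>i k. A i (w k))"
    and "\<And>w. (\<And>i j. i < j \<Longrightarrow> j < m \<Longrightarrow> w i < w j) \<Longrightarrow> 0 \<le> fdet m (\<lambda>k j. B (w k) j)"
    and w: "\<And>i. i < m \<Longrightarrow> w i \<in> S"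
    and pos: "0 < fdet m (\<lambda>i k. A i (w k)) * fdet m (\<lambda>k j. B (w k) j)"
  shows "0 < fdet m (\<lambda>i j. \<Sum>z\<in>S. A i z * B z j)"
proof -
  let ?w = "restrict w {0..<m}"
  have eq: "fdet m (\<lambda>i k. A i (?w k)) = fdet m (\<lambda>i k. A i (w k))"
    "fdet m (\<lambda>k j. B (?w k) j) = fdet m (\<lambda>k j. B (w k) j)"
    by (auto intro!: fdet_cong)
  have "0 < fact m * fdet m (\<lambda>i j. \<Sum>z\<in>S. A i z * B z j)"
    unfolding fdet_sum_product[OF assms(1)]
  proof (rule sum_pos2[of _ ?w])
    show "?w \<in> {0..<m} \<rightarrow>\<^sub>E S" using w by auto
    show "0 < fdet m (\<lambda>i k. A i (?w k)) * fdet m (\<lambda>k j. B (?w k) j)"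
      unfolding eq by (rule pos)
    show "0 \<le> fdet m (\<lambda>i k. A i (z k)) * fdet m (\<lambda>k j. B (z k) j)" for z :: "nat \<Rightarrow> 'a"
      by (rule fdet_product_nonneg, rule mult_nonneg_nonneg; rule assms(2,3))
  qed (use assms(1) in \<open>auto intro!: finite_PiE\<close>)
  moreover have "(0::real) < fact m" by simp
  ultimately show ?thesis by (simp only: zero_less_mult_iff) linarith
qed

section \<open>From consecutive minors to all minors\<close>

text \<open>Put a second copy of row \<open>i\<close> on top of the array: the determinant vanishes,
  and its expansion along the new row is a linear relation among the maximal minors.\<close>

lemma fdet_row_relation:
  fixes f :: "nat \<Rightarrow> nat \<Rightarrow> real"
  assumes "i < m"
  shows "(\<Sum>j\<le>m. (-1) ^ j * fdet m (\<lambda>i k. f i (insert_index j k)) * f i j) = 0"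
proof -
  let ?g = "\<lambda>i' j. f (if i' = 0 then i else i' - 1) j"
  have "0 = fdet (Suc m) ?g"
    by (rule fdet_same_rows[of 0 _ "Suc i", symmetric]) (use assms in auto)
  also have "\<dots> = (\<Sum>j\<le>m. (-1) ^ j * f i j * fdet m (\<lambda>i k. f i (insert_index j k)))"
    by (subst fdet_laplace_row[of 0]) (auto simp: insert_index_def)
  finally show ?thesis by (simp add: mult_ac)
qed

definition ins :: "nat \<Rightarrow> 'a \<Rightarrow> (nat \<Rightarrow> 'a) \<Rightarrow> nat \<Rightarrow> 'a" where
  "ins p b Y k = (if k < p then Y k else if k = p then b else Y (k - 1))"

lemma ins_insert_index [simp]: "ins p b Y (insert_index p k) = Y k"
  by (auto simp: ins_def insert_index_def)

lemma ins_same [simp]: "ins p b Y p = b"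
  by (simp add: ins_def)

lemma fdet_ins:
  assumes "p \<le> m"
  shows "fdet (Suc m) (\<lambda>i k. f i (ins p b Y k)) =
         (-1) ^ p * (\<Sum>i\<le>m. (-1) ^ i * f i b * fdet m (\<lambda>i' k. f (insert_index i i') (Y k)))"
  by (subst fdet_laplace_col[OF assms]) (simp add: sum_distrib_left power_add mult_ac)

text \<open>A Pluecker relation for an array of \<open>m\<close> rows and \<open>m + 1\<close>
  columns: the linear relation among the maximal minors is tested against a functional that
  annihilates all columns except \<open>0\<close>, \<open>p\<close> and \<open>m\<close>, so only
  three terms survive.\<close>

lemma fdet_three_term:
  fixes f :: "nat \<Rightarrow> nat \<Rightarrow> real"
  assumes "0 < p" "p < m" "s < m"
  shows "fdet m (\<lambda>i k. f i (insert_index p k)) * fdet (m - 1) (\<lambda>i k. f (insert_index s i) (Suc k)) =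
         fdet m (\<lambda>i k. f i (Suc k)) * fdet (m - 1) (\<lambda>i k. f (insert_index s i) (insert_index p k)) +
         fdet m (\<lambda>i k. f i k) * fdet (m - 1) (\<lambda>i k. f (insert_index s i) (insert_index p (Suc k)))"
proof -
  obtain q where q: "m = Suc (Suc q)" using assms by (metis Suc_pred gr_implies_not0 not_gr_zero less_Suc0 old.nat.exhaust)
  let ?Y = "\<lambda>k. insert_index p (Suc k)"
  define g where "g i j = f (insert_index s i) j" for i j
  \<comment> \<open>Up to sign, \<open>\<phi> j\<close> is the minor, with row \<open>s\<close>
    removed, on the columns \<open>?Y\<close> together with \<open>j\<close>. As \<open>?Y\<close>
    lists all columns but \<open>0\<close>, \<open>p\<close> and \<open>m\<close>, it vanishes for
    every \<open>j\<close> among them.\<close>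
  define \<phi> where "\<phi> j = (\<Sum>i\<le>q. (-1) ^ i * g i j * fdet q (\<lambda>i' k. g (insert_index i i') (?Y k)))" for j
  define M where "M j = fdet m (\<lambda>i k. f i (insert_index j k))" for j
  have ins: "fdet (Suc q) (\<lambda>i k. g i (ins t j ?Y k)) = (-1) ^ t * \<phi> j" if "t \<le> q" for t j
    unfolding \<phi>_def by (rule fdet_ins[OF that])
  have \<phi>_0: "\<phi> j = 0" if "j \<le> m" "j \<noteq> 0" "j \<noteq> p" "j \<noteq> m" for j
  proof -
    note j = that
    obtain t where t: "t < q" "j = ?Y t"
    proof
      show "(if j < p then j - 1 else j - 2) < q" "j = ?Y (if j < p then j - 1 else j - 2)"
        using j assms q by (auto simp: insert_index_def)
    qed
    have "fdet (Suc q) (\<lambda>i k. g i (ins 0 j ?Y k)) = 0"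
      by (rule fdet_same_cols[of 0 _ "Suc t"]) (use t in \<open>auto simp: ins_def\<close>)
    then show ?thesis using ins[of 0 j] by simp
  qed
  have "(\<Sum>j\<le>m. (-1) ^ j * M j * \<phi> j) =
        (\<Sum>i\<le>q. (-1) ^ i * fdet q (\<lambda>i' k. g (insert_index i i') (?Y k)) * (\<Sum>j\<le>m. (-1) ^ j * M j * g i j))"
    unfolding \<phi>_def sum_distrib_left by (subst sum.swap) (simp add: mult_ac)
  also have "\<dots> = 0"
  proof (intro sum.neutral ballI)
    fix i assume "i \<in> {..q}"
    then have "insert_index s i < m" using q by (auto simp: insert_index_def)
    then have "(\<Sum>j\<le>m. (-1) ^ j * M j * g i j) = 0"
      unfolding M_def g_def by (rule fdet_row_relation)
    then show "(-1) ^ i * fdet q (\<lambda>i' k. g (insert_index i i') (?Y k)) * (\<Sum>j\<le>m. (-1) ^ j * M j * g i j) = 0"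
      by simp
  qed
  finally have "0 = (\<Sum>j\<in>{..m}. (-1) ^ j * M j * \<phi> j)" by simp
  also have "\<dots> = (\<Sum>j\<in>{0, p, m}. (-1) ^ j * M j * \<phi> j)"
    by (rule sum.mono_neutral_right) (use assms \<phi>_0 in auto)
  also have "\<dots> = M 0 * \<phi> 0 + (-1) ^ p * M p * \<phi> p + (-1) ^ q * M m * \<phi> m"
    using assms q by simp
  finally have rel: "0 = M 0 * \<phi> 0 + (-1) ^ p * M p * \<phi> p + (-1) ^ q * M m * \<phi> m" .
  have m1: "m - 1 = Suc q" using q by simp
  have "fdet (m - 1) (\<lambda>i k. g i (insert_index p k)) = fdet (Suc q) (\<lambda>i k. g i (ins 0 0 ?Y k))"
    unfolding m1 using assms by (intro fdet_cong arg_cong[where f = "g _"]) (auto simp: ins_def insert_index_def)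
  then have e0: "fdet (m - 1) (\<lambda>i k. g i (insert_index p k)) = \<phi> 0"
    using ins[of 0 0] by simp
  have "fdet (m - 1) (\<lambda>i k. g i (Suc k)) = fdet (Suc q) (\<lambda>i k. g i (ins (p - 1) p ?Y k))"
    unfolding m1 using assms by (intro fdet_cong arg_cong[where f = "g _"]) (auto simp: ins_def insert_index_def)
  then have ep: "fdet (m - 1) (\<lambda>i k. g i (Suc k)) = (-1) ^ (p - 1) * \<phi> p"
    using ins[of "p - 1" p] assms q by simp
  have "fdet (m - 1) (\<lambda>i k. g i (?Y k)) = fdet (Suc q) (\<lambda>i k. g i (ins q m ?Y k))"
    unfolding m1 using assms q by (intro fdet_cong arg_cong[where f = "g _"]) (auto simp: ins_def insert_index_def)
  then have em: "fdet (m - 1) (\<lambda>i k. g i (?Y k)) = (-1) ^ q * \<phi> m"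
    using ins[of q m] by simp
  have sgn: "(-1) ^ p * (-1) ^ (p - 1) = (-1 :: real)"
    using assms by (cases p) (auto simp: power_mult_distrib[symmetric])
  have M0: "fdet m (\<lambda>i k. f i (Suc k)) = M 0"
    unfolding M_def by (intro fdet_cong) (auto simp: insert_index_def)
  have Mm: "fdet m (\<lambda>i k. f i k) = M m"
    unfolding M_def by (intro fdet_cong) (auto simp: insert_index_def)
  have "M p * fdet (m - 1) (\<lambda>i k. g i (Suc k)) =
    - ((-1) ^ p * (-1) ^ (p - 1)) * (M p * fdet (m - 1) (\<lambda>i k. g i (Suc k)))"
    unfolding sgn by simp
  also have "\<dots> = - ((-1) ^ p * M p * \<phi> p) * ((-1) ^ (p - 1) * (-1) ^ (p - 1))"
    unfolding ep by (simp add: mult_ac)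
  also have "(-1) ^ (p - 1) * (-1) ^ (p - 1) = (1::real)"
    by (simp add: power_mult_distrib[symmetric])
  also have "- ((-1) ^ p * M p * \<phi> p) * 1 = M 0 * \<phi> 0 + M m * ((-1) ^ q * \<phi> m)"
    using rel by (simp add: mult_ac)
  finally have "M p * fdet (m - 1) (\<lambda>i k. g i (Suc k)) =
     M 0 * fdet (m - 1) (\<lambda>i k. g i (insert_index p k)) + M m * fdet (m - 1) (\<lambda>i k. g i (?Y k))"
    unfolding e0 em .
  then show ?thesis
    unfolding M0 Mm by (simp add: g_def M_def)
qed

definition incr :: "nat \<Rightarrow> (nat \<Rightarrow> 'a :: linorder) \<Rightarrow> bool" where
  "incr m x \<longleftrightarrow> (\<forall>i j. i < j \<longrightarrow> j < m \<longrightarrow> x i < x j)"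

lemma incr_ins:
  assumes "incr m y" "0 < p" "p < m" "y (p - 1) < b" "b < y p"
  shows "incr (Suc m) (ins p b y)"
  unfolding incr_def
proof (intro allI impI)
  fix i j :: nat assume ij: "i < j" "j < Suc m"
  have less: "y a < y c" if "a < c" "c < m" for a c
    using assms(1) that by (auto simp: incr_def)
  have le: "y a \<le> y c" if "a \<le> c" "c < m" for a c
    using less[of a c] that by (cases "a = c") auto
  consider "j < p" | "j = p" | "p < j" "i < p" | "p < j" "i = p" | "p < i" using ij by linarith
  then show "ins p b y i < ins p b y j"
  proof cases
    case 1
    then show ?thesis using ij less[of i j] assms by (simp add: ins_def)
  next
    case 2
    then have "y i \<le> y (p - 1)" using ij assms by (intro le) auto
    then show ?thesis using 2 ij assms by (simp add: ins_def)
  next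
    case 3
    then have "y i < y (j - 1)" using ij by (intro less) auto
    then show ?thesis using 3 by (simp add: ins_def)
  next
    case 4
    then have "y p \<le> y (j - 1)" using ij by (intro le) auto
    then show ?thesis using 4 assms by (simp add: ins_def)
  next
    case 5
    then have "y (i - 1) < y (j - 1)" using ij by (intro less) auto
    then show ?thesis using 5 ij by (simp add: ins_def)
  qed
qed

text \<open>For a lower triangular \<open>T\<close>, a minor with \<open>x i < y i\<close> for some
  \<open>i\<close> is forced to vanish by a zero block. Strict positivity is thus demanded on
  exactly the remaining pairs of index sets.\<close>

definition strict_stair :: "(nat \<Rightarrow> nat \<Rightarrow> real) \<Rightarrow> nat \<Rightarrow> bool" where
  "strict_stair T m \<longleftrightarrow> (\<forall>x y. incr m x \<longrightarrow> incr m y \<longrightarrow> (\<forall>i<m. y i \<le> x i) \<longrightarrow>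
     0 < fdet m (\<lambda>i j. T (x i) (y j)))"

lemma incr_insert_index:
  assumes "incr (Suc m) u"
  shows "incr m (\<lambda>k. u (insert_index p k))"
  using assms unfolding incr_def insert_index_def by auto

lemma fdet_stair_zero:
  assumes T: "\<And>a b. a < b \<Longrightarrow> T a b = 0"
    and "incr m (x :: nat \<Rightarrow> nat)" "incr m (y :: nat \<Rightarrow> nat)" "i < m" "x i < y i"
  shows "fdet m (\<lambda>i j. T (x i) (y j)) = 0"
proof (rule fdet_zero_block[OF \<open>i < m\<close>])
  fix a b assume ab: "a \<le> i" "i \<le> b" "b < m"
  have "x a \<le> x i" using assms(2,4) ab by (cases "a = i") (auto simp: incr_def less_imp_le)
  moreover have "y i \<le> y b" using assms(3,4) ab by (cases "b = i") (auto simp: incr_def less_imp_le)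
  ultimately show "T (x a) (y b) = 0" using assms(5) T by simp
qed

lemma fdet_stair_nonneg:
  assumes T: "\<And>a b. a < b \<Longrightarrow> T a b = 0" and "strict_stair T m" "incr m x" "incr m y"
  shows "0 \<le> fdet m (\<lambda>i j. T (x i) (y j))"
proof (cases "\<forall>i<m. y i \<le> x i")
  case True
  then show ?thesis using assms by (auto simp: strict_stair_def less_imp_le)
next
  case False
  then show ?thesis using fdet_stair_zero[of T m x y] assms by (metis not_le order_refl)
qed

lemma incr_nat_ge:
  assumes "incr m (y :: nat \<Rightarrow> nat)" "i < m"
  shows "y 0 + i \<le> y i"
  using assms(2)
proof (induction i)
  case (Suc i)
  then show ?case using assms(1) unfolding incr_def
    by (metis Suc_lessD add_Suc_right lessI less_eq_Suc_le order.strict_trans1)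
qed simp

lemma incr_gap:
  assumes "incr m (y :: nat \<Rightarrow> nat)" "\<not> (\<forall>i<m. y i = y 0 + i)"
  obtains p where "0 < p" "p < m" "y (p - 1) + 1 < y p"
proof -
  define p where "p = (LEAST i. i < m \<and> y i \<noteq> y 0 + i)"
  obtain i where i: "i < m \<and> y i \<noteq> y 0 + i" using assms(2) by auto
  have p: "p < m \<and> y p \<noteq> y 0 + p"
    unfolding p_def using LeastI[where P = "\<lambda>i. i < m \<and> y i \<noteq> y 0 + i", OF i] .
  have p0: "0 < p" using p by (cases p) auto
  have "y (p - 1) = y 0 + (p - 1)"
    using not_less_Least[of "p - 1" "\<lambda>i. i < m \<and> y i \<noteq> y 0 + i"] p p0 unfolding p_def[symmetric] by auto
  moreover have "y 0 + p \<le> y p" using incr_nat_ge[OF assms(1)] p by blast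
  ultimately have "y (p - 1) + 1 < y p" using p p0 by simp
  then show thesis using that p p0 by blast
qed

text \<open>The passage from consecutive minors to all minors (Fekete), adapted to lower triangular
  matrices: a gap in the row or column indices is filled by means of the three-term relation.\<close>

lemma strict_stair_from_consecutive:
  fixes T :: "nat \<Rightarrow> nat \<Rightarrow> real"
  assumes T: "\<And>a b. a < b \<Longrightarrow> T a b = 0"
    and lower: "strict_stair T m"
    and consec: "\<And>a b. b \<le> a \<Longrightarrow> 0 < fdet (Suc m) (\<lambda>i j. T (a + i) (b + j))"
  shows "strict_stair T (Suc m)"
proof -
  have "0 < fdet (Suc m) (\<lambda>i j. T (x i) (y j))"
    if "incr (Suc m) x" "incr (Suc m) y" "\<forall>i<Suc m. y i \<le> x i" for x y
    using that
  \<comment> \<open>The induction is on the total spread of rows and columns: inserting an index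
    into a gap and dropping an end index shrinks it.\<close>
  proof (induction "(x m - x 0) + (y m - y 0)" arbitrary: x y rule: less_induct)
    case less
    note incx = less.prems(1) and incy = less.prems(2) and stair = less.prems(3)
    consider (base) "\<forall>i<Suc m. x i = x 0 + i" "\<forall>i<Suc m. y i = y 0 + i"
      | (cols) "\<not> (\<forall>i<Suc m. y i = y 0 + i)" | (rows) "\<not> (\<forall>i<Suc m. x i = x 0 + i)"
      by blast
    then show ?case
    proof cases
      case base
      have "fdet (Suc m) (\<lambda>i j. T (x i) (y j)) = fdet (Suc m) (\<lambda>i j. T (x 0 + i) (y 0 + j))"
        using base by (intro fdet_cong) metis
      then show ?thesis using consec[of "y 0" "x 0"] stair by simp
    next
      case cols
      then obtain p where p: "0 < p" "p < Suc m" "y (p - 1) + 1 < y p"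
        using incr_gap[OF incy] by blast
      define u where "u = ins p (y (p - 1) + 1) y"
      have u_skip: "u (insert_index p k) = y k" for k
        by (simp add: u_def)
      have incu: "incr (Suc (Suc m)) u"
        unfolding u_def using p by (intro incr_ins incy) auto
      have u_le: "u k \<le> y k" if "k < Suc m" for k
        using incu that unfolding u_skip[of k, symmetric]
        by (cases "k < p") (auto simp: insert_index_def incr_def less_imp_le)
      have y_le_u: "y k \<le> u (Suc k)" if "k < Suc m" for k
        using incu that unfolding u_skip[of k, symmetric]
        by (cases "k < p") (auto simp: insert_index_def incr_def less_imp_le)
      have x_Suc: "x k < x (Suc k)" if "k < m" for k
        using incx that by (auto simp: incr_def)
      \<comment> \<open>Removing the smallest row makes \<open>x (Suc k)\<close> face the
        \<open>k\<close>-th remaining column, so all the minors of order \<open>m\<close> in the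
        relation stay within the staircase.\<close>
      have incx': "incr m (\<lambda>k. x (insert_index 0 k))"
        using incr_insert_index[OF incx] .
      have low: "0 < fdet m (\<lambda>i k. T (x (insert_index 0 i)) (v k))"
        if "incr m v" "\<And>k. k < m \<Longrightarrow> v k \<le> x (Suc k)" for v
        using lower incx' that unfolding strict_stair_def by (auto simp: insert_index_def)
      have "fdet (Suc m) (\<lambda>i k. T (x i) (u (insert_index p k))) *
            fdet m (\<lambda>i k. T (x (insert_index 0 i)) (u (Suc k))) =
         fdet (Suc m) (\<lambda>i k. T (x i) (u (Suc k))) *
           fdet m (\<lambda>i k. T (x (insert_index 0 i)) (u (insert_index p k))) +
         fdet (Suc m) (\<lambda>i k. T (x i) (u k)) *
           fdet m (\<lambda>i k. T (x (insert_index 0 i)) (u (insert_index p (Suc k))))"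
        using fdet_three_term[of p "Suc m" 0 "\<lambda>i k. T (x i) (u k)"] p by simp
      moreover have "0 < fdet m (\<lambda>i k. T (x (insert_index 0 i)) (u (Suc k)))"
      proof (rule low)
        show "u (Suc k) \<le> x (Suc k)" if "k < m" for k
          using u_le[of "Suc k"] stair that by (meson Suc_mono order_trans)
      qed (use incu in \<open>auto simp: incr_def\<close>)
      moreover have "0 < fdet m (\<lambda>i k. T (x (insert_index 0 i)) (u (insert_index p k)))"
        unfolding u_skip
      proof (rule low)
        show "y k \<le> x (Suc k)" if "k < m" for k
          using x_Suc[OF that] stair that by (meson less_SucI less_imp_le order_trans)
      qed (use incy in \<open>auto simp: incr_def\<close>)
      moreover have "0 < fdet m (\<lambda>i k. T (x (insert_index 0 i)) (u (insert_index p (Suc k))))"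
        unfolding u_skip using incy stair
        by (intro low) (auto simp: incr_def)
      \<comment> \<open>The shifted columns may leave the staircase. Then this minor is zero, which
        is harmless because the other product on the right is strictly positive.\<close>
      moreover have "0 \<le> fdet (Suc m) (\<lambda>i k. T (x i) (u (Suc k)))"
      proof (cases "\<forall>k<Suc m. u (Suc k) \<le> x k")
        case True
        have "0 < fdet (Suc m) (\<lambda>i k. T (x i) (u (Suc k)))"
        proof (rule less.hyps)
          have "y 0 < u (Suc 0)" "u (Suc m) = y m" "y 0 < y m"
            using p incy by (auto simp: u_def ins_def incr_def)
          moreover have "u (Suc 0) \<le> u (Suc m)"
            using incu p by (auto simp: incr_def less_imp_le Suc_le_eq)
          ultimately show "(x m - x 0) + (u (Suc m) - u (Suc 0)) < (x m - x 0) + (y m - y 0)"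
            by simp
        qed (use incx incu True in \<open>auto simp: incr_def\<close>)
        then show ?thesis by simp
      next
        case False
        then obtain k where "k < Suc m" "x k < u (Suc k)" by auto
        then show ?thesis
          using fdet_stair_zero[where T = T and m = "Suc m" and x = x and y = "\<lambda>k. u (Suc k)" and i = k] T incx incu by (simp add: incr_def)
      qed
      moreover have "0 < fdet (Suc m) (\<lambda>i k. T (x i) (u k))"
      proof (rule less.hyps)
        have "u 0 = y 0" "u m < y m" "y 0 < y m"
          using p incy incu unfolding u_def by (auto simp: ins_def incr_def)
        moreover have "u 0 \<le> u m" using incu p by (auto simp: incr_def less_imp_le)
        ultimately show "(x m - x 0) + (u m - u 0) < (x m - x 0) + (y m - y 0)"
          by simp
        show "\<forall>i<Suc m. u i \<le> x i" using u_le stair by (meson order_trans)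
      qed (use incx incu in \<open>auto simp: incr_def\<close>)
      ultimately have "0 < fdet (Suc m) (\<lambda>i k. T (x i) (u (insert_index p k)))"
        by (smt (verit) mult_nonneg_nonneg mult_pos_pos zero_less_mult_pos2)
      then show ?thesis unfolding u_skip .
    next
      case rows
      then obtain p where p: "0 < p" "p < Suc m" "x (p - 1) + 1 < x p"
        using incr_gap[OF incx] by blast
      define u where "u = ins p (x (p - 1) + 1) x"
      have u_skip: "u (insert_index p k) = x k" for k
        by (simp add: u_def)
      have incu: "incr (Suc (Suc m)) u"
        unfolding u_def using p by (intro incr_ins incx) auto
      have u_le: "u k \<le> x k" if "k < Suc m" for k
        using incu that unfolding u_skip[of k, symmetric]
        by (cases "k < p") (auto simp: insert_index_def incr_def less_imp_le)
      have x_le_u: "x k \<le> u (Suc k)" if "k < Suc m" for k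
        using incu that unfolding u_skip[of k, symmetric]
        by (cases "k < p") (auto simp: insert_index_def incr_def less_imp_le)
      \<comment> \<open>Dually, filling a gap in the rows goes with dropping the largest column. Now
        the unshifted block of rows is the one that may leave the staircase, and the shifted one
        supplies strictness.\<close>
      have incy': "incr m (\<lambda>k. y (insert_index m k))"
        using incr_insert_index[OF incy] .
      have low: "0 < fdet m (\<lambda>i k. T (v k) (y (insert_index m i)))"
        if "incr m v" "\<And>k. k < m \<Longrightarrow> y k \<le> v k" for v
      proof -
        have "0 < fdet m (\<lambda>i k. T (v i) (y (insert_index m k)))"
          using lower incy' that unfolding strict_stair_def by (auto simp: insert_index_def)
        then show ?thesis by (subst fdet_transpose)
      qed
      have "fdet (Suc m) (\<lambda>i k. T (u (insert_index p k)) (y i)) *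
            fdet m (\<lambda>i k. T (u (Suc k)) (y (insert_index m i))) =
         fdet (Suc m) (\<lambda>i k. T (u (Suc k)) (y i)) *
           fdet m (\<lambda>i k. T (u (insert_index p k)) (y (insert_index m i))) +
         fdet (Suc m) (\<lambda>i k. T (u k) (y i)) *
           fdet m (\<lambda>i k. T (u (insert_index p (Suc k))) (y (insert_index m i)))"
        using fdet_three_term[of p "Suc m" m "\<lambda>i k. T (u k) (y i)"] p by simp
      moreover have "0 < fdet m (\<lambda>i k. T (u (Suc k)) (y (insert_index m i)))"
      proof (rule low)
        show "y k \<le> u (Suc k)" if "k < m" for k
          using x_le_u[of k] stair that by (meson less_SucI order_trans)
      qed (use incu in \<open>auto simp: incr_def\<close>)
      moreover have "0 < fdet m (\<lambda>i k. T (u (insert_index p k)) (y (insert_index m i)))"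
        unfolding u_skip using incx stair
        by (intro low) (auto simp: incr_def)
      moreover have "0 < fdet m (\<lambda>i k. T (u (insert_index p (Suc k))) (y (insert_index m i)))"
      proof (unfold u_skip, intro low)
        fix k assume "k < m"
        then show "y k \<le> x (Suc k)"
          using stair incx unfolding incr_def by (meson lessI less_SucI less_imp_le order_trans Suc_mono)
      qed (use incx in \<open>auto simp: incr_def\<close>)
      moreover have "0 \<le> fdet (Suc m) (\<lambda>i k. T (u k) (y i))"
      proof (cases "\<forall>k<Suc m. y k \<le> u k")
        case True
        have "0 < fdet (Suc m) (\<lambda>i k. T (u i) (y k))"
        proof (rule less.hyps)
          have "u 0 = x 0" "u m < x m" "x 0 < x m"
            using p incx incu unfolding u_def by (auto simp: ins_def incr_def)
          moreover have "u 0 \<le> u m" using incu p by (auto simp: incr_def less_imp_le)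
          ultimately show "(u m - u 0) + (y m - y 0) < (x m - x 0) + (y m - y 0)"
            by simp
        qed (use incy incu True in \<open>auto simp: incr_def\<close>)
        then show ?thesis by (subst fdet_transpose) simp
      next
        case False
        then obtain k where "k < Suc m" "u k < y k" by auto
        then have "fdet (Suc m) (\<lambda>i k. T (u i) (y k)) = 0"
          using fdet_stair_zero[where T = T and m = "Suc m" and x = u and y = y and i = k] T incy incu by (simp add: incr_def)
        then show ?thesis by (subst fdet_transpose) simp
      qed
      moreover have "0 < fdet (Suc m) (\<lambda>i k. T (u (Suc k)) (y i))"
      proof -
        have "0 < fdet (Suc m) (\<lambda>i k. T (u (Suc i)) (y k))"
        proof (rule less.hyps)
          have "x 0 < u (Suc 0)" "u (Suc m) = x m" "x 0 < x m"
            using p incx by (auto simp: u_def ins_def incr_def)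
          moreover have "u (Suc 0) \<le> u (Suc m)"
            using incu p by (auto simp: incr_def less_imp_le Suc_le_eq)
          ultimately show "(u (Suc m) - u (Suc 0)) + (y m - y 0) < (x m - x 0) + (y m - y 0)"
            by simp
          show "\<forall>i<Suc m. y i \<le> u (Suc i)" using x_le_u stair by (meson order_trans)
        qed (use incy incu in \<open>auto simp: incr_def\<close>)
        then show ?thesis by (subst fdet_transpose)
      qed
      ultimately have "0 < fdet (Suc m) (\<lambda>i k. T (u (insert_index p k)) (y i))"
        by (smt (verit) mult_nonneg_nonneg mult_pos_pos zero_less_mult_pos2)
      then have "0 < fdet (Suc m) (\<lambda>i k. T (x k) (y i))" unfolding u_skip .
      then show ?thesis by (subst (asm) fdet_transpose)
    qed
  qed
  then show ?thesis unfolding strict_stair_def by blast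
qed

section \<open>One-sided Toeplitz kernels\<close>

definition toep :: "real fps \<Rightarrow> nat \<Rightarrow> nat \<Rightarrow> real" where
  "toep F x y = (if y \<le> x then fps_nth F (x - y) else 0)"

definition tp :: "nat \<Rightarrow> real fps \<Rightarrow> bool" where
  "tp m F \<longleftrightarrow> (\<forall>x y. incr m x \<longrightarrow> incr m y \<longrightarrow> 0 \<le> fdet m (\<lambda>i j. toep F (x i) (y j)))"

definition geom :: "real \<Rightarrow> real fps" where
  "geom b = Abs_fps (\<lambda>k. b ^ k)"

lemma toep_mult:
  assumes "x \<le> L"
  shows "toep (F * G) x y = (\<Sum>z\<le>L. toep F x z * toep G z y)"
proof (cases "y \<le> x")
  case True
  have "(\<Sum>z\<le>L. toep F x z * toep G z y) = (\<Sum>z\<in>{y..x}. fps_nth F (x - z) * fps_nth G (z - y))"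
    by (rule sum.mono_neutral_cong_right) (use assms in \<open>auto simp: toep_def\<close>)
  also have "\<dots> = (\<Sum>i=0..x - y. fps_nth F i * fps_nth G (x - y - i))"
    by (rule sum.reindex_bij_witness[of _ "\<lambda>i. x - i" "\<lambda>z. x - z"]) (use True in auto)
  finally show ?thesis using True by (simp add: toep_def fps_mult_nth)
next
  case False
  then have "(\<Sum>z\<le>L. toep F x z * toep G z y) = 0"
    by (intro sum.neutral) (auto simp: toep_def)
  then show ?thesis using False by (simp add: toep_def)
qed

text \<open>Cauchy-Binet needs one summation range valid for all entries; the sum of all points is a
  crude uniform bound.\<close>

lemma toep_mult_minor:
  "fdet m (\<lambda>i j. toep (F * G) (x i) (y j)) =
   fdet m (\<lambda>i j. \<Sum>z\<in>{..(\<Sum>i<m. x i + y i)}. toep F (x i) z * toep G z (y j))"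
proof (rule fdet_cong)
  fix i j assume "i < m" "j < m"
  have "x i + y i \<le> (\<Sum>i<m. x i + y i)"
    by (rule member_le_sum) (use \<open>i < m\<close> in auto)
  then show "toep (F * G) (x i) (y j) = (\<Sum>z\<in>{..(\<Sum>i<m. x i + y i)}. toep F (x i) z * toep G z (y j))"
    by (intro toep_mult) simp
qed

lemma tp_mult:
  assumes "tp m F" "tp m G"
  shows "tp m (F * G)"
  unfolding tp_def toep_mult_minor
  by (intro allI impI fdet_sum_product_nonneg) (use assms in \<open>auto simp: tp_def incr_def\<close>)

lemma toep_lower: "a < b \<Longrightarrow> toep F a b = 0"
  by (simp add: toep_def)

lemma tp_of_strict_stair: "strict_stair (toep F) m \<Longrightarrow> tp m F"
  unfolding tp_def using fdet_stair_nonneg[of "toep F" m] toep_lower by blast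

text \<open>In the Cauchy-Binet sum the term with intermediate indices \<open>y\<close> is already
  positive: the minor of \<open>G\<close> on rows and columns \<open>y\<close> is unitriangular, and
  the minor of \<open>F\<close> from \<open>x\<close> to \<open>y\<close> lies in the staircase.
  This lets a pole be added without losing strictness.\<close>

lemma strict_stair_mult:
  assumes F: "strict_stair (toep F) m" and G: "tp m G" "fps_nth G 0 = 1"
  shows "strict_stair (toep (F * G)) m"
  unfolding strict_stair_def
proof (intro allI impI)
  fix x y :: "nat \<Rightarrow> nat"
  assume x: "incr m x" and y: "incr m y" and yx: "\<forall>i<m. y i \<le> x i"
  have "0 < fdet m (\<lambda>i j. \<Sum>z\<in>{..(\<Sum>i<m. x i + y i)}. toep F (x i) z * toep G z (y j))"
  proof (rule fdet_sum_product_pos[where w = y])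
    have "fdet m (\<lambda>k j. toep G (y k) (y j)) = (\<Prod>i<m. toep G (y i) (y i))"
      by (rule fdet_lower_triangular, rule toep_lower) (use y in \<open>auto simp: incr_def\<close>)
    also have "\<dots> = 1" using G(2) by (simp add: toep_def)
    finally show "0 < fdet m (\<lambda>i k. toep F (x i) (y k)) * fdet m (\<lambda>k j. toep G (y k) (y j))"
      using F x y yx by (simp add: strict_stair_def)
    show "y i \<in> {..\<Sum>i<m. x i + y i}" if "i < m" for i
    proof -
      have "x i + y i \<le> (\<Sum>i<m. x i + y i)"
        by (rule member_le_sum) (use that in auto)
      then show ?thesis by simp
    qed
  qed (use tp_of_strict_stair[OF F] G x y in \<open>auto simp: tp_def incr_def\<close>)
  then show "0 < fdet m (\<lambda>i j. toep (F * G) (x i) (y j))"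
    unfolding toep_mult_minor .
qed

lemma fdet_proportional_cols:
  assumes "a < m" "b < m" "a \<noteq> b" "\<And>i. i < m \<Longrightarrow> f i a = c * f i b"
  shows "fdet m f = 0"
proof -
  let ?g = "\<lambda>i j. if j = a then f i b else f i j"
  have "fdet m f = fdet m (\<lambda>i j. 1 * (if j = a then c else 1) * ?g i j)"
    using assms by (intro fdet_cong) auto
  also have "\<dots> = (\<Prod>i<m. 1) * (\<Prod>j<m. if j = a then c else 1) * fdet m ?g"
    by (rule fdet_scale)
  also have "fdet m ?g = 0"
    by (rule fdet_same_cols[of a m b]) (use assms in auto)
  finally show ?thesis by simp
qed

text \<open>Induction on the order through the first row. Either that row is zero, or the first two
  columns are proportional because all row indices are at least \<open>y 1\<close>, or only its
  first entry can be nonzero and it splits off.\<close>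

lemma tp_geom:
  assumes "0 \<le> b"
  shows "tp m (geom b)"
  unfolding tp_def
proof (intro allI impI)
  fix x y :: "nat \<Rightarrow> nat"
  assume "incr m x" "incr m y"
  then show "0 \<le> fdet m (\<lambda>i j. toep (geom b) (x i) (y j))"
  proof (induction m arbitrary: x y)
    case 0
    then show ?case by simp
  next
    case (Suc m)
    let ?f = "\<lambda>i j. toep (geom b) (x i) (y j)"
    have x_ge: "x 0 \<le> x i" if "i < Suc m" for i
      using Suc.prems that by (cases "i = 0") (auto simp: incr_def less_imp_le)
    have y_gt: "y a < y j" if "a < j" "j < Suc m" for a j
      using Suc.prems that by (auto simp: incr_def)
    consider "m = 0" | "x 0 < y 0" | "0 < m" "y 0 \<le> x 0" "y 1 \<le> x 0" | "0 < m" "y 0 \<le> x 0" "x 0 < y 1"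
      by linarith
    then show ?case
    proof cases
      case 1
      then show ?thesis using assms by (simp add: toep_def geom_def)
    next
      case 2
      have "fdet (Suc m) ?f = 0"
      proof (rule fdet_zero_block[of 0])
        fix i j :: nat assume "i \<le> 0" "0 \<le> j" "j < Suc m"
        then show "?f i j = 0" using 2 y_gt[of 0 j] by (cases "j = 0") (auto simp: toep_def)
      qed simp
      then show ?thesis by simp
    next
      case 3
      have "fdet (Suc m) ?f = 0"
      proof (rule fdet_proportional_cols[of 0 _ 1 _ "b ^ (y 1 - y 0)"])
        fix i assume "i < Suc m"
        then have "y 1 \<le> x i" "y 0 \<le> y 1" using x_ge[of i] 3 y_gt[of 0 1] by auto
        then show "?f i 0 = b ^ (y 1 - y 0) * ?f i 1"
          by (simp add: toep_def geom_def flip: power_add)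
      qed (use 3 in auto)
      then show ?thesis by simp
    next
      case 4
      have "fdet (Suc m) ?f = (\<Sum>j\<le>m. (-1) ^ (0 + j) * ?f 0 j *
           fdet m (\<lambda>i' j'. ?f (insert_index 0 i') (insert_index j j')))"
        by (rule fdet_laplace_row) simp
      also have "\<dots> = (\<Sum>j\<in>{0}. (-1) ^ (0 + j) * ?f 0 j *
           fdet m (\<lambda>i' j'. ?f (insert_index 0 i') (insert_index j j')))"
      proof (rule sum.mono_neutral_right)
        show "\<forall>j\<in>{..m} - {0}. (-1) ^ (0 + j) * ?f 0 j *
            fdet m (\<lambda>i' j'. ?f (insert_index 0 i') (insert_index j j')) = 0"
        proof
          fix j assume j: "j \<in> {..m} - {0}"
          then have "y 1 \<le> y j" using y_gt[of 1 j] by (cases "j = 1") auto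
          then have "?f 0 j = 0" using 4 by (simp add: toep_def)
          then show "(-1) ^ (0 + j) * ?f 0 j *
            fdet m (\<lambda>i' j'. ?f (insert_index 0 i') (insert_index j j')) = 0" by simp
        qed
      qed auto
      also have "\<dots> = ?f 0 0 * fdet m (\<lambda>i j. toep (geom b) (x (insert_index 0 i)) (y (insert_index 0 j)))"
        by simp
      finally have eq: "fdet (Suc m) ?f = \<dots>" .
      have "0 \<le> fdet m (\<lambda>i j. toep (geom b) (x (insert_index 0 i)) (y (insert_index 0 j)))"
        by (rule Suc.IH) (rule incr_insert_index Suc.prems)+
      moreover have "0 \<le> ?f 0 0"
        using assms by (simp add: toep_def geom_def)
      ultimately show ?thesis
        unfolding eq by (rule mult_nonneg_nonneg[rotated])
    qed
  qed
qed

lemma tp_prod: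
  assumes "\<And>i. i \<in> I \<Longrightarrow> tp m (F i)"
  shows "tp m (\<Prod>i\<in>I. F i)"
proof -
  \<comment> \<open>With \<open>0 ^ 0 = 1\<close> the series \<open>geom 0\<close> is the unit
    series, so the empty product is covered by the geometric case.\<close>
  have "toep 1 = toep (geom 0)"
    by (auto simp: toep_def geom_def fun_eq_iff)
  then have "tp m 1"
    using tp_geom[of 0 m] by (simp add: tp_def)
  then show ?thesis
    using assms by (induction I rule: infinite_finite_induct) (auto intro: tp_mult)
qed

section \<open>Partial fractions of the generating functions\<close>

lemma fps_of_poly_linear_geom: "fps_of_poly [:1, - b:] * geom b = 1"
proof (rule fps_ext)
  fix n
  show "fps_nth (fps_of_poly [:1, - b:] * geom b) n = fps_nth 1 n"
    by (cases n) (auto simp: fps_of_poly_pCons geom_def ring_distribs mult.assoc)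
qed

text \<open>Partial fraction coefficient of \<open>p(z) / (\<Prod>i<n. 1 - b i * z)\<close> at the
  pole \<open>z = 1 / b l\<close>, normalised as the factor of
  \<open>1 / (1 - b l * z)\<close>.\<close>

definition pf_coeff :: "real poly \<Rightarrow> (nat \<Rightarrow> real) \<Rightarrow> nat \<Rightarrow> nat \<Rightarrow> real" where
  "pf_coeff p b n l = poly p (1 / b l) / (\<Prod>i\<in>{..<n} - {l}. 1 - b i / b l)"

context
  fixes b :: "nat \<Rightarrow> real" and n :: nat
  assumes inj: "inj_on b {..<n}" and nz: "\<And>l. l < n \<Longrightarrow> b l \<noteq> 0"
begin

text \<open>Lagrange interpolation at the \<open>n\<close> nodes \<open>1 / b l\<close>: both sides
  have degree below \<open>n\<close>, and at each node all but one of the products vanish.\<close>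

lemma pf_poly:
  assumes "degree p < n"
  shows "p = (\<Sum>l<n. Polynomial.smult (pf_coeff p b n l) (\<Prod>i\<in>{..<n} - {l}. [:1, - b i:]))" (is "_ = ?R")
proof (rule poly_eqI_degree)
  let ?A = "(\<lambda>l. 1 / b l) ` {..<n}"
  have "inj_on (\<lambda>l. 1 / b l) {..<n}"
    using inj by (auto simp: inj_on_def)
  then have card: "card ?A = n" by (simp add: card_image)
  then show "degree p < card ?A" using assms by simp
  have "degree (\<Prod>i\<in>{..<n} - {l}. [:1, - b i:]) \<le> n - 1" if "l < n" for l
  proof -
    have "degree (\<Prod>i\<in>{..<n} - {l}. [:1, - b i:]) \<le> (\<Sum>i\<in>{..<n} - {l}. degree [:1, - b i:])"
      using degree_prod_sum_le[of "{..<n} - {l}" "\<lambda>i. [:1, - b i:]"] unfolding comp_def by blast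
    also have "\<dots> \<le> (\<Sum>i\<in>{..<n} - {l}. 1)"
      by (rule sum_mono) auto
    finally show ?thesis using that by simp
  qed
  then have "degree ?R \<le> n - 1"
    by (intro degree_sum_le) (auto intro: order_trans[OF degree_smult_le])
  then show "degree ?R < card ?A" using assms card by simp
  fix x assume "x \<in> ?A"
  then obtain j where j: "j < n" "x = 1 / b j" by auto
  have "poly ?R x = (\<Sum>l<n. pf_coeff p b n l * (\<Prod>i\<in>{..<n} - {l}. 1 - b i / b j))"
    by (simp add: poly_sum poly_prod j)
  also have "\<dots> = (\<Sum>l\<in>{j}. pf_coeff p b n l * (\<Prod>i\<in>{..<n} - {l}. 1 - b i / b j))"
  proof (rule sum.mono_neutral_right)
    show "\<forall>l\<in>{..<n} - {j}. pf_coeff p b n l * (\<Prod>i\<in>{..<n} - {l}. 1 - b i / b j) = 0"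
    proof
      fix l assume "l \<in> {..<n} - {j}"
      then have "(\<Prod>i\<in>{..<n} - {l}. 1 - b i / b j) = 0"
        using j nz by (intro prod_zero bexI[of _ j]) auto
      then show "pf_coeff p b n l * (\<Prod>i\<in>{..<n} - {l}. 1 - b i / b j) = 0" by simp
    qed
  qed (use j in auto)
  also have "\<dots> = poly p x"
  proof -
    have "(\<Prod>i\<in>{..<n} - {j}. 1 - b i / b j) \<noteq> 0"
      using inj nz j by (auto simp: inj_on_def)
    then show ?thesis by (simp add: pf_coeff_def j)
  qed
  finally show "poly p x = poly ?R x" by simp
qed

lemma pf_fps:
  assumes "degree p < n"
  shows "fps_of_poly p * (\<Prod>l<n. geom (b l)) = Abs_fps (\<lambda>k. \<Sum>l<n. pf_coeff p b n l * b l ^ k)"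
proof -
  have cancel: "fps_of_poly (\<Prod>i\<in>{..<n} - {l}. [:1, - b i:]) * (\<Prod>l<n. geom (b l)) = geom (b l)"
    if "l < n" for l
  proof -
    have "(\<Prod>l<n. geom (b l)) = geom (b l) * (\<Prod>i\<in>{..<n} - {l}. geom (b i))"
      using that by (intro prod.remove) auto
    then have "fps_of_poly (\<Prod>i\<in>{..<n} - {l}. [:1, - b i:]) * (\<Prod>l<n. geom (b l)) =
          geom (b l) * (\<Prod>i\<in>{..<n} - {l}. fps_of_poly [:1, - b i:] * geom (b i))"
      by (simp add: fps_of_poly_prod prod.distrib mult_ac)
    then show ?thesis by (simp only: fps_of_poly_linear_geom prod.neutral_const mult_1_right)
  qed
  have "fps_of_poly p * (\<Prod>l<n. geom (b l)) =
        fps_of_poly (\<Sum>l<n. Polynomial.smult (pf_coeff p b n l) (\<Prod>i\<in>{..<n} - {l}. [:1, - b i:])) * (\<Prod>l<n. geom (b l))"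
    using pf_poly[OF assms] by simp
  also have "\<dots> = (\<Sum>l<n. fps_const (pf_coeff p b n l) *
      (fps_of_poly (\<Prod>i\<in>{..<n} - {l}. [:1, - b i:]) * (\<Prod>l<n. geom (b l))))"
    by (simp only: fps_of_poly_sum fps_of_poly_smult sum_distrib_right mult.assoc)
  also have "\<dots> = (\<Sum>l<n. fps_const (pf_coeff p b n l) * geom (b l))"
    by (intro sum.cong refl) (simp add: cancel)
  also have "\<dots> = Abs_fps (\<lambda>k. \<Sum>l<n. pf_coeff p b n l * b l ^ k)"
    by (rule fps_ext) (simp add: fps_sum_nth geom_def)
  finally show ?thesis .
qed

lemma pf_eval:
  assumes "degree p < n" "\<And>l. l < n \<Longrightarrow> 1 - b l * z \<noteq> 0"
  shows "(\<Sum>l<n. pf_coeff p b n l / (1 - b l * z)) = poly p z / (\<Prod>l<n. 1 - b l * z)"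
proof -
  have "poly p z = (\<Sum>l<n. pf_coeff p b n l * (\<Prod>i\<in>{..<n} - {l}. 1 - b i * z))"
    by (subst pf_poly[OF assms(1)]) (simp add: poly_sum poly_prod mult.commute)
  also have "\<dots> = (\<Sum>l<n. pf_coeff p b n l / (1 - b l * z)) * (\<Prod>l<n. 1 - b l * z)"
    unfolding sum_distrib_right
  proof (intro sum.cong refl)
    fix l assume "l \<in> {..<n}"
    then have "(\<Prod>l<n. 1 - b l * z) = (1 - b l * z) * (\<Prod>i\<in>{..<n} - {l}. 1 - b i * z)"
      by (intro prod.remove) auto
    then show "pf_coeff p b n l * (\<Prod>i\<in>{..<n} - {l}. 1 - b i * z) =
      pf_coeff p b n l / (1 - b l * z) * (\<Prod>l<n. 1 - b l * z)"
      using assms(2) \<open>l \<in> {..<n}\<close> by simp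
  qed
  finally show ?thesis
    using assms(2) by (simp add: nonzero_eq_divide_eq)
qed

text \<open>Multiplying \<open>p\<close> by the monomial of degree \<open>k\<close> multiplies the
  coefficient at \<open>1 / b l\<close> by \<open>(1 / b l) ^ k\<close>, so the sum is the constant
  term of a power series without constant term. The exponential formula for the Toeplitz entries
  therefore continues correctly, with value 0, to finitely many negative indices.\<close>

lemma pf_negative:
  assumes "k + degree p < n" "0 < k"
  shows "(\<Sum>l<n. pf_coeff p b n l * (1 / b l) ^ k) = 0"
proof -
  have "degree (monom 1 k * p) < n"
    using assms(1) degree_mult_le[of "monom 1 k" p] by (simp add: degree_monom_eq)
  from pf_fps[OF this]
  have "(\<Sum>l<n. pf_coeff (monom 1 k * p) b n l) =
        fps_nth (fps_of_poly (monom 1 k * p) * (\<Prod>l<n. geom (b l))) 0"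
    by simp
  also have "\<dots> = 0"
    using assms(2) by (simp add: coeff_monom_mult)
  finally show ?thesis
    by (simp add: pf_coeff_def poly_monom mult_ac)
qed

lemma toep_pf:
  assumes "degree p < n" "y + degree p < x + n"
  shows "toep (fps_of_poly p * (\<Prod>l<n. geom (b l))) x y =
     (\<Sum>l<n. pf_coeff p b n l * b l ^ x * (1 / b l) ^ y)"
proof (cases "y \<le> x")
  case True
  then show ?thesis
    unfolding pf_fps[OF assms(1)] using nz
    by (auto simp: toep_def power_diff field_simps intro!: sum.cong)
next
  case False
  have "(\<Sum>l<n. pf_coeff p b n l * b l ^ x * (1 / b l) ^ y) =
        (\<Sum>l<n. pf_coeff p b n l * (1 / b l) ^ (y - x))"
  proof (intro sum.cong refl)
    fix l assume "l \<in> {..<n}"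
    then have "b l ^ x * (1 / b l) ^ y = (1 / b l) ^ (y - x)"
      using nz False by (simp add: power_diff field_simps)
    then show "pf_coeff p b n l * b l ^ x * (1 / b l) ^ y = pf_coeff p b n l * (1 / b l) ^ (y - x)"
      by (simp add: mult.assoc)
  qed
  also have "\<dots> = 0"
    using False assms by (intro pf_negative) auto
  finally show ?thesis using False by (simp add: toep_def)
qed

text \<open>Entries above the diagonal obey the exponential formula as long as their distance from
  it plus \<open>degree p\<close> stays below \<open>n\<close>; for the corner entry of the block
  this is exactly \<open>degree p \<le> d\<close>. The block is then a Vandermonde matrix times a
  diagonal matrix times the Vandermonde matrix of the inverse nodes.\<close>

lemma toep_minor_vandermonde:
  assumes "degree p < n" "degree p \<le> d"
  shows "fdet n (\<lambda>i j. toep (fps_of_poly p * (\<Prod>l<n. geom (b l))) (c + d + i) (c + j)) =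
     (\<Prod>l<n. pf_coeff p b n l * b l ^ d) * (fdet n (\<lambda>i l. b l ^ i) * fdet n (\<lambda>l j. (1 / b l) ^ j))"
proof -
  have "fdet n (\<lambda>i j. toep (fps_of_poly p * (\<Prod>l<n. geom (b l))) (c + d + i) (c + j)) =
        fdet n (\<lambda>i j. \<Sum>l<n. (1 * (pf_coeff p b n l * b l ^ d) * b l ^ i) * (1 / b l) ^ j)"
  proof (intro fdet_cong)
    fix i j assume ij: "i < n" "j < n"
    have "toep (fps_of_poly p * (\<Prod>l<n. geom (b l))) (c + d + i) (c + j) =
       (\<Sum>l<n. pf_coeff p b n l * b l ^ (c + d + i) * (1 / b l) ^ (c + j))"
      by (rule toep_pf) (use assms ij in auto)
    also have "\<dots> = (\<Sum>l<n. (1 * (pf_coeff p b n l * b l ^ d) * b l ^ i) * (1 / b l) ^ j)"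
      using nz by (intro sum.cong refl) (simp add: power_add field_simps)
    finally show "toep (fps_of_poly p * (\<Prod>l<n. geom (b l))) (c + d + i) (c + j) = \<dots>" .
  qed
  also have "\<dots> = fdet n (\<lambda>i l. 1 * (pf_coeff p b n l * b l ^ d) * b l ^ i) * fdet n (\<lambda>l j. (1 / b l) ^ j)"
    by (rule fdet_mult)
  also have "fdet n (\<lambda>i l. 1 * (pf_coeff p b n l * b l ^ d) * b l ^ i) =
    (\<Prod>i<n. 1) * (\<Prod>l<n. pf_coeff p b n l * b l ^ d) * fdet n (\<lambda>i l. b l ^ i)"
    by (rule fdet_scale)
  finally show ?thesis by simp
qed

text \<open>The case of numerator 1 and offset 0 is a unitriangular minor, with value 1. This
  evaluates the product of the two Vandermonde determinants without computing either of
  them.\<close>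

lemma pf_vandermonde:
  assumes "0 < n"
  shows "(\<Prod>l<n. pf_coeff 1 b n l) * (fdet n (\<lambda>i l. b l ^ i) * fdet n (\<lambda>l j. (1 / b l) ^ j)) = 1"
proof -
  have "fps_nth (\<Prod>l<k. geom (b l)) 0 = 1" for k
    by (induction k) (auto simp: geom_def)
  then have "1 = fdet n (\<lambda>i j. toep (fps_of_poly 1 * (\<Prod>l<n. geom (b l))) (0 + 0 + i) (0 + j))"
    by (subst fdet_lower_triangular) (auto simp: toep_def)
  also have "\<dots> = (\<Prod>l<n. pf_coeff 1 b n l * b l ^ 0) *
      (fdet n (\<lambda>i l. b l ^ i) * fdet n (\<lambda>l j. (1 / b l) ^ j))"
    by (rule toep_minor_vandermonde) (use assms in auto)
  finally show ?thesis by simp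
qed

lemma vandermonde_nonzero: "fdet n (\<lambda>i l. b l ^ i) \<noteq> 0"
proof (cases "n = 0")
  case False
  then show ?thesis using pf_vandermonde by auto
qed simp

lemma toep_minor_pf:
  assumes "degree p < n" "degree p \<le> d"
  shows "fdet n (\<lambda>i j. toep (fps_of_poly p * (\<Prod>l<n. geom (b l))) (c + d + i) (c + j)) =
     (\<Prod>l<n. poly p (1 / b l) * b l ^ d)"
proof -
  have "0 < n" using assms by simp
  have "pf_coeff p b n l * b l ^ d = (poly p (1 / b l) * b l ^ d) * pf_coeff 1 b n l" for l
    by (simp add: pf_coeff_def)
  then show ?thesis
    unfolding toep_minor_vandermonde[OF assms] using pf_vandermonde[OF \<open>0 < n\<close>]
    by (simp only: prod.distrib mult.assoc mult_1_right)
qed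

end

text \<open>A single zero together with \<open>n\<close> larger poles: the consecutive minors of order \<open>n\<close>
  consist of a single product, and those of lower order are reduced to fewer poles by
  splitting off a geometric factor.\<close>

lemma strict_stair_group:
  fixes b :: "nat \<Rightarrow> real"
  assumes "0 \<le> a" "inj_on b {..<n}" "\<And>l. l < n \<Longrightarrow> a < b l" "m \<le> n"
  shows "strict_stair (toep (fps_of_poly [:1, - a:] * (\<Prod>l<n. geom (b l)))) m"
  using assms(2-4)
proof (induction n arbitrary: m)
  case 0
  then show ?case by (simp add: strict_stair_def)
next
  case (Suc n)
  let ?F = "\<lambda>n. fps_of_poly [:1, - a:] * (\<Prod>l<n. geom (b l))"
  have inj: "inj_on b {..<n}" using Suc.prems(1) by (auto simp: inj_on_def)
  have low: "strict_stair (toep (?F (Suc n))) m" if "m \<le> n" for m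
  proof -
    have "strict_stair (toep (?F n * geom (b n))) m"
    proof (rule strict_stair_mult)
      show "strict_stair (toep (?F n)) m"
        using Suc.IH[OF inj _ that] Suc.prems(2) by simp
      show "tp m (geom (b n))"
        using Suc.prems(2)[of n] assms(1) by (intro tp_geom) auto
    qed (simp add: geom_def)
    then show ?thesis by (simp add: mult.assoc)
  qed
  show ?case
  proof (cases "m = Suc n")
    case False
    then show ?thesis using low Suc.prems(3) by simp
  next
    case True
    have "strict_stair (toep (?F (Suc n))) (Suc n)"
    proof (rule strict_stair_from_consecutive)
      fix c e :: nat assume "c \<le> e"
      have nz: "b l \<noteq> 0" if "l < Suc n" for l
        using Suc.prems(2)[OF that] assms(1) by auto
      have one: "fps_nth (\<Prod>l<k. geom (b l)) 0 = 1" for k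
        by (induction k) (auto simp: geom_def)
      show "0 < fdet (Suc n) (\<lambda>i j. toep (?F (Suc n)) (e + i) (c + j))"
      \<comment> \<open>Two cases lie outside \<open>toep_minor_pf\<close>: at offset 0 the degree 1
        is too large, but the minor is unitriangular; for a single pole the degree is not below the
        number of poles, but the coefficients are visibly positive.\<close>
      proof (cases "e = c \<or> n = 0")
        case True
        then show ?thesis
        proof
          assume "e = c"
          have "fdet (Suc n) (\<lambda>i j. toep (?F (Suc n)) (e + i) (c + j)) =
             (\<Prod>i<Suc n. toep (?F (Suc n)) (e + i) (c + i))"
            by (rule fdet_lower_triangular) (auto simp: toep_def \<open>e = c\<close>)
          also have "\<dots> = 1"
            using one[of "Suc n"] by (simp add: toep_def \<open>e = c\<close> del: prod.lessThan_Suc)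
          finally show ?thesis by simp
        next
          assume "n = 0"
          have "fps_nth (fps_of_poly [:1, - a:] * geom (b 0)) k > 0" for k
            using Suc.prems(2)[of 0] assms(1)
            by (cases k) (auto simp: fps_of_poly_pCons geom_def ring_distribs mult.assoc)
          then show ?thesis using \<open>c \<le> e\<close> by (simp add: toep_def \<open>n = 0\<close>)
        qed
      next
        case False
        define d where "d = e - c"
        have d: "e = c + d" "1 \<le> d" using \<open>c \<le> e\<close> False by (auto simp: d_def)
        have "degree [:1, - a:] \<le> 1" by simp
        then have "fdet (Suc n) (\<lambda>i j. toep (?F (Suc n)) (e + i) (c + j)) =
          (\<Prod>l<Suc n. poly [:1, - a:] (1 / b l) * b l ^ d)"
          unfolding d(1) using False d
          by (intro toep_minor_pf Suc.prems(1) nz) auto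
        also have "\<dots> > 0"
        proof (intro prod_pos mult_pos_pos zero_less_power)
          fix l assume "l \<in> {..<Suc n}"
          then have "a < b l" using Suc.prems(2) by auto
          then show "0 < poly [:1, - a:] (1 / b l)" "0 < b l" using assms(1) by (auto simp: field_simps)
        qed
        finally show ?thesis .
      qed
    qed (use low in \<open>auto simp: toep_def\<close>)
    then show ?thesis using True by simp
  qed
qed

section \<open>From lattices to exponential sums\<close>

text \<open>The left side is an entry of the Toeplitz matrix times its transpose, moved down the
  diagonal by \<open>t\<close> so that the truncated sum fills up. In the limit it is a double
  geometric series over pairs of poles; the sum over one of the two poles is the partial fraction
  expansion evaluated at \<open>b l\<close>, so a single sum remains.\<close>

lemma autocorrelation_limit:
  fixes b :: "nat \<Rightarrow> real"
  assumes inj: "inj_on b {..<n}" and b: "\<And>l. l < n \<Longrightarrow> 0 < b l \<and> b l < 1"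
    and deg: "degree p < n" and xy: "x \<le> S" "y \<le> S"
  defines "F \<equiv> fps_of_poly p * (\<Prod>l<n. geom (b l))"
  shows "(\<lambda>t. \<Sum>z\<le>S + t. toep F (x + t) z * toep F (y + t) z) \<longlonglongrightarrow>
     (\<Sum>l<n. pf_coeff p b n l * (poly p (b l) / (\<Prod>i<n. 1 - b i * b l)) * b l ^ nat \<bar>int x - int y\<bar>)"
proof -
  have nz: "b l \<noteq> 0" if "l < n" for l using b[OF that] by simp
  let ?P = "pf_coeff p b n"
  have F: "fps_nth F k = (\<Sum>l<n. ?P l * b l ^ k)" for k
    unfolding F_def by (subst pf_fps[OF inj nz deg]) auto
  have *: "(\<lambda>t. \<Sum>z\<le>S + t. toep F (x + t) z * toep F (y + t) z) \<longlonglongrightarrow>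
     (\<Sum>l<n. ?P l * (poly p (b l) / (\<Prod>i<n. 1 - b i * b l)) * b l ^ (x - y))"
    if "y \<le> x" "x \<le> S" for x y
  proof -
    define d where "d = x - y"
    \<comment> \<open>The substitution \<open>k = t + y - z\<close> turns the truncated sums into
      partial sums of one fixed series.\<close>
    have "(\<Sum>z\<le>S + t. toep F (x + t) z * toep F (y + t) z) = (\<Sum>k\<le>t + y. fps_nth F (k + d) * fps_nth F k)" for t
    proof -
      have "(\<Sum>z\<le>S + t. toep F (x + t) z * toep F (y + t) z) =
        (\<Sum>z\<le>t + y. fps_nth F (x + t - z) * fps_nth F (y + t - z))"
        by (rule sum.mono_neutral_cong_right) (use that in \<open>auto simp: toep_def\<close>)
      also have "\<dots> = (\<Sum>k\<le>t + y. fps_nth F (k + d) * fps_nth F k)"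
        by (rule sum.reindex_bij_witness[of _ "\<lambda>k. t + y - k" "\<lambda>z. t + y - z"])
           (use that in \<open>auto simp: d_def add.commute\<close>)
      finally show ?thesis .
    qed
    moreover have "(\<lambda>k. fps_nth F (k + d) * fps_nth F k) sums
       (\<Sum>l<n. \<Sum>i<n. ?P l * b l ^ d * ?P i * (1 / (1 - b i * b l)))"
    proof -
      have "(\<lambda>k. \<Sum>l<n. \<Sum>i<n. ?P l * b l ^ d * ?P i * (b i * b l) ^ k) sums
        (\<Sum>l<n. \<Sum>i<n. ?P l * b l ^ d * ?P i * (1 / (1 - b i * b l)))"
      proof (intro sums_sum sums_mult geometric_sums)
        fix l i assume "l \<in> {..<n}" "i \<in> {..<n}"
        then have "b i * b l < 1 * 1" using b[of l] b[of i] by (intro mult_strict_mono) auto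
        then show "norm (b i * b l) < 1" using b[of l] b[of i] \<open>l \<in> _\<close> \<open>i \<in> _\<close> by (simp add: abs_mult)
      qed
      moreover have "(\<Sum>l<n. \<Sum>i<n. ?P l * b l ^ d * ?P i * (b i * b l) ^ k) = fps_nth F (k + d) * fps_nth F k" for k
        unfolding F sum_product by (simp add: power_add power_mult_distrib mult_ac)
      ultimately show ?thesis by simp
    qed
    then have "(\<lambda>t. \<Sum>k\<le>t + y. fps_nth F (k + d) * fps_nth F k) \<longlonglongrightarrow>
       (\<Sum>l<n. \<Sum>i<n. ?P l * b l ^ d * ?P i * (1 / (1 - b i * b l)))"
      unfolding sums_def_le by (rule LIMSEQ_ignore_initial_segment)
    moreover have "(\<Sum>l<n. \<Sum>i<n. ?P l * b l ^ d * ?P i * (1 / (1 - b i * b l))) =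
      (\<Sum>l<n. ?P l * (poly p (b l) / (\<Prod>i<n. 1 - b i * b l)) * b l ^ (x - y))"
    proof (rule sum.cong[OF refl])
      fix l assume l: "l \<in> {..<n}"
      have "(\<Sum>i<n. ?P i / (1 - b i * b l)) = poly p (b l) / (\<Prod>i<n. 1 - b i * b l)"
      proof (rule pf_eval[OF inj nz deg])
        fix i assume "i < n"
        then have "b i * b l < 1 * 1" using b[of l] b[of i] l by (intro mult_strict_mono) auto
        then show "1 - b i * b l \<noteq> 0" by simp
      qed
      moreover have "(\<Sum>i<n. ?P l * b l ^ d * ?P i * (1 / (1 - b i * b l))) =
          ?P l * b l ^ d * (\<Sum>i<n. ?P i / (1 - b i * b l))"
        by (simp add: sum_distrib_left)
      ultimately show "(\<Sum>i<n. ?P l * b l ^ d * ?P i * (1 / (1 - b i * b l))) =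
          ?P l * (poly p (b l) / (\<Prod>i<n. 1 - b i * b l)) * b l ^ (x - y)"
        by (simp add: d_def)
    qed
    ultimately show ?thesis by simp
  qed
  show ?thesis
  proof (cases "y \<le> x")
    case True
    then have "nat \<bar>int x - int y\<bar> = x - y" by simp
    then show ?thesis using *[of y x] True xy by simp
  next
    case False
    then have "nat \<bar>int x - int y\<bar> = y - x" by simp
    then show ?thesis using *[of x y] False xy by (simp add: mult.commute[of "toep F (y + _) _"])
  qed
qed

text \<open>Before the limit in \<open>t\<close> the matrix is a product of a Toeplitz block and a
  transposed one, so Cauchy-Binet applies. Here the one-sided kernel turns into a symmetric one that
  depends only on the distance of the points.\<close>

lemma bilateral_minor_nonneg:
  fixes b :: "nat \<Rightarrow> real"
  assumes inj: "inj_on b {..<n}" and b: "\<And>l. l < n \<Longrightarrow> 0 < b l \<and> b l < 1"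
    and deg: "degree p < n"
    and tp: "tp m (fps_of_poly p * (\<Prod>l<n. geom (b l)))"
    and x: "incr m x" and y: "incr m y"
  shows "0 \<le> fdet m (\<lambda>i j. \<Sum>l<n. pf_coeff p b n l * (poly p (b l) / (\<Prod>i<n. 1 - b i * b l)) *
            b l ^ nat \<bar>int (x i) - int (y j)\<bar>)"
proof (rule tendsto_lowerbound)
  let ?F = "fps_of_poly p * (\<Prod>l<n. geom (b l))"
  define S where "S = (\<Sum>i<m. x i + y i)"
  have S: "x i \<le> S" "y i \<le> S" if "i < m" for i
  proof -
    have "x i + y i \<le> S" unfolding S_def by (rule member_le_sum) (use that in auto)
    then show "x i \<le> S" "y i \<le> S" by auto
  qed
  show "(\<lambda>t. fdet m (\<lambda>i j. \<Sum>z\<le>S + t. toep ?F (x i + t) z * toep ?F (y j + t) z)) \<longlonglongrightarrow>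
    fdet m (\<lambda>i j. \<Sum>l<n. pf_coeff p b n l * (poly p (b l) / (\<Prod>i<n. 1 - b i * b l)) *
            b l ^ nat \<bar>int (x i) - int (y j)\<bar>)"
    by (intro tendsto_fdet autocorrelation_limit inj b deg S)
  show "\<forall>\<^sub>F t in sequentially. 0 \<le> fdet m (\<lambda>i j. \<Sum>z\<le>S + t. toep ?F (x i + t) z * toep ?F (y j + t) z)"
  proof (intro always_eventually allI fdet_sum_product_nonneg)
    fix t and w :: "nat \<Rightarrow> nat"
    assume w: "\<And>i j. i < j \<Longrightarrow> j < m \<Longrightarrow> w i < w j"
    then have w': "incr m w" by (auto simp: incr_def)
    have xt: "incr m (\<lambda>i. x i + t)" "incr m (\<lambda>i. y i + t)" using x y by (auto simp: incr_def)
    show "0 \<le> fdet m (\<lambda>i k. toep ?F (x i + t) (w k))"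
      using tp w' xt(1) unfolding tp_def by blast
    have "0 \<le> fdet m (\<lambda>i k. toep ?F (y i + t) (w k))"
      using tp w' xt(2) unfolding tp_def by blast
    then show "0 \<le> fdet m (\<lambda>k j. toep ?F (y j + t) (w k))"
      by (subst fdet_transpose)
  qed auto
qed auto

section \<open>Refinement of the mesh\<close>

lemma tendsto_mesh_floor:
  fixes u :: real
  assumes "0 \<le> u"
  shows "((\<lambda>s. s * real (nat \<lfloor>u / s\<rfloor>)) \<longlongrightarrow> u) (at_right 0)"
proof (rule tendsto_sandwich)
  show "\<forall>\<^sub>F s in at_right 0. u - s \<le> s * real (nat \<lfloor>u / s\<rfloor>)"
    using eventually_at_right_less[of "0::real"]
  proof eventually_elim
    case (elim s)
    have "u / s - 1 \<le> real_of_int \<lfloor>u / s\<rfloor>" by linarith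
    moreover have "0 \<le> \<lfloor>u / s\<rfloor>" using elim assms by simp
    ultimately have "u / s - 1 \<le> real (nat \<lfloor>u / s\<rfloor>)" by simp
    then have "s * (u / s - 1) \<le> s * real (nat \<lfloor>u / s\<rfloor>)" using elim by simp
    then show ?case using elim by (simp add: algebra_simps)
  qed
  show "\<forall>\<^sub>F s in at_right 0. s * real (nat \<lfloor>u / s\<rfloor>) \<le> u"
    using eventually_at_right_less[of "0::real"]
  proof eventually_elim
    case (elim s)
    have "0 \<le> \<lfloor>u / s\<rfloor>" using elim assms by simp
    then have "real (nat \<lfloor>u / s\<rfloor>) \<le> u / s" by simp
    then have "s * real (nat \<lfloor>u / s\<rfloor>) \<le> s * (u / s)" using elim by (intro mult_left_mono) auto
    then show ?case using elim by simp
  qed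
  show "((\<lambda>s. u - s) \<longlongrightarrow> u) (at_right 0)"
    by (auto intro!: tendsto_eq_intros)
qed simp

lemma tendsto_one_minus_exp_over:
  fixes x :: real
  shows "((\<lambda>s. (1 - exp (- (x * s))) / s) \<longlongrightarrow> x) (at_right 0)"
proof -
  have "((\<lambda>s. 1 - exp (- (x * s))) has_real_derivative x) (at 0)"
    by (auto intro!: derivative_eq_intros)
  then have "((\<lambda>s. (1 - exp (- (x * s))) / s) \<longlongrightarrow> x) (at 0)"
    by (simp add: has_field_derivative_iff)
  then show ?thesis
    by (rule filterlim_mono) (auto intro: at_le)
qed

text \<open>With \<open>j = l + 1\<close>, this is up to a common constant the coefficient of
  \<open>exp (- j * \<bar>d\<bar>)\<close> in the inverse Fourier transform of
  \<open>\<Prod>\<^sub>k (z\<^sub>k\<^sup>2 + s\<^sup>2) / \<Prod>\<^sub>i (i\<^sup>2 +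
  s\<^sup>2)\<close>, that is the residue at the pole \<open>j\<close>; its factor
  \<open>2 * j\<close> sits in the last product.\<close>

definition rho :: "nat \<Rightarrow> (nat \<Rightarrow> real) \<Rightarrow> nat \<Rightarrow> nat \<Rightarrow> real" where
  "rho M z n l = (\<Prod>k<M. (z k - real (Suc l)) * (z k + real (Suc l))) /
     ((\<Prod>i\<in>{..<n} - {l}. real (Suc i) - real (Suc l)) * (\<Prod>i<n. real (Suc i) + real (Suc l)))"

text \<open>Every factor has the form \<open>1 - exp (- (x * s)) = s * E x\<close>, where
  \<open>E x\<close> tends to \<open>x\<close>. Counting factors gives \<open>2 * M\<close> powers
  of \<open>s\<close> above and \<open>2 * n - 1\<close> below, the same for all \<open>l\<close>,
  and leaves a quotient that tends to \<open>rho\<close>.\<close>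

lemma lattice_coeff:
  fixes z :: "nat \<Rightarrow> real" and M :: nat
  assumes s: "0 < s" and l: "l < n"
  defines "b \<equiv> \<lambda>l. exp (- (real (Suc l) * s))"
  defines "p \<equiv> \<Prod>k<M. [:1, - exp (- (z k * s)):]"
  defines "E \<equiv> \<lambda>x. (1 - exp (- (x * s))) / s"
  shows "pf_coeff p b n l * (poly p (b l) / (\<Prod>i<n. 1 - b i * b l)) =
    s ^ (2 * M) / s ^ (2 * n - 1) * ((\<Prod>k<M. E (z k - real (Suc l)) * E (z k + real (Suc l))) /
     ((\<Prod>i\<in>{..<n} - {l}. E (real (Suc i) - real (Suc l))) * (\<Prod>i<n. E (real (Suc i) + real (Suc l)))))"
proof -
  have e: "1 - exp (- (x * s)) = s * E x" for x
    using s by (simp add: E_def)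
  have e1: "1 - exp (- (x * s)) / b l = s * E (x - real (Suc l))" for x
    unfolding e[symmetric] b_def by (simp add: left_diff_distrib flip: exp_diff)
  have e2: "1 - exp (- (x * s)) * b l = s * E (x + real (Suc l))" for x
    unfolding e[symmetric] b_def by (simp add: distrib_right flip: exp_add)
  have p1: "poly p (1 / b l) = (\<Prod>k<M. s * E (z k - real (Suc l)))"
    unfolding p_def poly_prod using e1 by simp
  have p2: "poly p (b l) = (\<Prod>k<M. s * E (z k + real (Suc l)))"
    unfolding p_def poly_prod e2[symmetric] by (simp add: mult.commute)
  have d1: "(\<Prod>i\<in>{..<n} - {l}. 1 - b i / b l) = (\<Prod>i\<in>{..<n} - {l}. s * E (real (Suc i) - real (Suc l)))"
    unfolding e1[symmetric] by (simp add: b_def)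
  have d2: "(\<Prod>i<n. 1 - b i * b l) = (\<Prod>i<n. s * E (real (Suc i) + real (Suc l)))"
    unfolding e2[symmetric] by (simp add: b_def)
  have "(2::nat) * n - 1 = (n - 1) + n" using l by simp
  then have pw: "s ^ (2 * n - 1) = s ^ (n - 1) * s ^ n" "s ^ (2 * M) = s ^ M * s ^ M"
    by (simp_all only: power_add mult_2)
  have card: "card ({..<n} - {l}) = n - 1" using l by simp
  show ?thesis
    unfolding pf_coeff_def p1 p2 d1 d2 prod.distrib pw prod_constant card card_lessThan
    by (simp only: times_divide_times_eq mult_ac)
qed

text \<open>The points are rounded down to a lattice of mesh \<open>s\<close>, on which the exponent
  \<open>j\<close> becomes the ratio \<open>exp (- (j * s))\<close>; nonnegative points make
  rounding with \<open>nat\<close> faithful. The diverging power of \<open>s\<close> is positive and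
  common to all coefficients, so it leaves the determinant before \<open>s\<close> tends to
  0.\<close>

lemma expsum_minor_nonneg:
  fixes z :: "nat \<Rightarrow> real"
  assumes tp: "\<And>s. 0 < s \<Longrightarrow> tp m (fps_of_poly (\<Prod>k<M. [:1, - exp (- (z k * s)):]) *
       (\<Prod>l<n. geom (exp (- (real (Suc l) * s)))))"
    and "M < n" and u: "incr m u" and v: "incr m v" and nonneg: "\<And>i. i < m \<Longrightarrow> 0 \<le> u i \<and> 0 \<le> v i"
  shows "0 \<le> fdet m (\<lambda>i j. \<Sum>l<n. rho M z n l * exp (- (real (Suc l) * \<bar>u i - v j\<bar>)))"
proof (rule tendsto_lowerbound)
  define E where "E s x = (1 - exp (- (x * s))) / s" for s x :: real
  define R where "R s l = (\<Prod>k<M. E s (z k - real (Suc l)) * E s (z k + real (Suc l))) /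
     ((\<Prod>i\<in>{..<n} - {l}. E s (real (Suc i) - real (Suc l))) * (\<Prod>i<n. E s (real (Suc i) + real (Suc l))))"
    for s l
  define X where "X s i = nat \<lfloor>u i / s\<rfloor>" for s i
  define Y where "Y s i = nat \<lfloor>v i / s\<rfloor>" for s i
  let ?f = "\<lambda>s i j. \<Sum>l<n. R s l * exp (- (real (Suc l) * \<bar>s * real (X s i) - s * real (Y s j)\<bar>))"
  show "((\<lambda>s. fdet m (?f s)) \<longlongrightarrow>
     fdet m (\<lambda>i j. \<Sum>l<n. rho M z n l * exp (- (real (Suc l) * \<bar>u i - v j\<bar>)))) (at_right 0)"
  proof (intro tendsto_fdet tendsto_sum tendsto_mult)
    fix i j l assume ij: "i < m" "j < m" and l: "l \<in> {..<n}"
    show "((\<lambda>s. R s l) \<longlongrightarrow> rho M z n l) (at_right 0)"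
      unfolding R_def rho_def E_def
      by (intro tendsto_divide tendsto_mult tendsto_prod tendsto_one_minus_exp_over) auto
    show "((\<lambda>s. exp (- (real (Suc l) * \<bar>s * real (X s i) - s * real (Y s j)\<bar>))) \<longlongrightarrow>
           exp (- (real (Suc l) * \<bar>u i - v j\<bar>))) (at_right 0)"
      unfolding X_def Y_def
      by (intro tendsto_exp tendsto_minus tendsto_mult tendsto_const tendsto_rabs tendsto_diff
          tendsto_mesh_floor) (use nonneg ij in auto)
  qed
  \<comment> \<open>Rounding must keep the points distinct, which holds as soon as the mesh is
    smaller than every gap.\<close>
  have mesh: "\<forall>\<^sub>F s in at_right 0. incr m (\<lambda>i. nat \<lfloor>w i / s\<rfloor>)" if w: "incr m w" "\<And>i. i < m \<Longrightarrow> 0 \<le> w i" for w :: "nat \<Rightarrow> real"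
  proof -
    have "\<forall>\<^sub>F s in at_right 0. \<forall>i\<in>{..<m}. \<forall>j\<in>{..<m}. i < j \<longrightarrow> nat \<lfloor>w i / s\<rfloor> < nat \<lfloor>w j / s\<rfloor>"
    proof (intro eventually_ball_finite finite_lessThan ballI)
      fix i j assume ij: "i \<in> {..<m}" "j \<in> {..<m}"
      show "\<forall>\<^sub>F s in at_right 0. i < j \<longrightarrow> nat \<lfloor>w i / s\<rfloor> < nat \<lfloor>w j / s\<rfloor>"
      proof (cases "i < j")
        case True
        then have "w i < w j" using w(1) ij by (auto simp: incr_def)
        then have "\<forall>\<^sub>F s in at_right 0. s < w j - w i"
          by (intro eventually_at_rightI[of 0 "w j - w i"]) auto
        then show ?thesis using eventually_at_right_less[of "0::real"]
        proof eventually_elim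
          case (elim s)
          then have "1 \<le> (w j - w i) / s" by (simp add: le_divide_eq)
          then have "w i / s + 1 \<le> w j / s" by (simp add: diff_divide_distrib)
          then have "\<lfloor>w i / s\<rfloor> < \<lfloor>w j / s\<rfloor>" by linarith
          moreover have "0 \<le> \<lfloor>w i / s\<rfloor>" using elim w(2) ij by simp
          ultimately show ?case by (simp only: nat_less_eq_zless simp_thms)
        qed
      qed simp
    qed
    then show ?thesis
      by eventually_elim (auto simp: incr_def)
  qed
  have incX: "\<forall>\<^sub>F s in at_right 0. incr m (X s)" "\<forall>\<^sub>F s in at_right 0. incr m (Y s)"
    unfolding X_def Y_def using mesh u v nonneg by auto
  show "\<forall>\<^sub>F s in at_right 0. 0 \<le> fdet m (?f s)"
    using incX eventually_at_right_less[of "0::real"]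
  proof eventually_elim
    case (elim s)
    define b where "b l = exp (- (real (Suc l) * s))" for l
    let ?p = "\<Prod>k<M. [:1, - exp (- (z k * s)):]"
    have "degree ?p \<le> (\<Sum>k<M. degree [:1, - exp (- (z k * s)):])"
      using degree_prod_sum_le[of "{..<M}" "\<lambda>k. [:1, - exp (- (z k * s)):]"] unfolding comp_def by blast
    also have "\<dots> \<le> (\<Sum>k<M. 1)" by (intro sum_mono) auto
    finally have deg: "degree ?p < n" using \<open>M < n\<close> by simp
    have "0 \<le> fdet m (\<lambda>i j. \<Sum>l<n. pf_coeff ?p b n l * (poly ?p (b l) / (\<Prod>i<n. 1 - b i * b l)) *
            b l ^ nat \<bar>int (X s i) - int (Y s j)\<bar>)"
    proof (rule bilateral_minor_nonneg)
      show "inj_on b {..<n}" using elim by (auto simp: inj_on_def b_def)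
      show "tp m (fps_of_poly ?p * (\<Prod>l<n. geom (b l)))"
        unfolding b_def using tp elim by simp
    qed (use elim deg in \<open>auto simp: b_def\<close>)
    also have "\<dots> = fdet m (\<lambda>i j. (s ^ (2 * M) / s ^ (2 * n - 1)) * 1 * ?f s i j)"
    proof (rule fdet_cong)
      fix i j
      have "b l ^ nat \<bar>int (X s i) - int (Y s j)\<bar> = exp (- (real (Suc l) * \<bar>s * real (X s i) - s * real (Y s j)\<bar>))" for l
      proof -
        have "real (nat \<bar>int (X s i) - int (Y s j)\<bar>) * s = \<bar>s * real (X s i) - s * real (Y s j)\<bar>"
          using elim by (simp add: abs_mult mult.commute flip: right_diff_distrib)
        then show ?thesis
          unfolding b_def by (simp add: mult_ac flip: exp_of_nat_mult)
      qed
      moreover have "pf_coeff ?p b n l * (poly ?p (b l) / (\<Prod>i<n. 1 - b i * b l)) =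
        s ^ (2 * M) / s ^ (2 * n - 1) * R s l" if "l < n" for l
        using lattice_coeff[where s = s and l = l and n = n and M = M and z = z] elim that unfolding b_def R_def E_def by simp
      ultimately show "(\<Sum>l<n. pf_coeff ?p b n l * (poly ?p (b l) / (\<Prod>i<n. 1 - b i * b l)) *
            b l ^ nat \<bar>int (X s i) - int (Y s j)\<bar>) = (s ^ (2 * M) / s ^ (2 * n - 1)) * 1 * ?f s i j"
        by (simp add: sum_distrib_left mult.assoc)
    qed
    also have "\<dots> = (s ^ (2 * M) / s ^ (2 * n - 1)) ^ m * fdet m (?f s)"
      using fdet_scale[of m "\<lambda>_. s ^ (2 * M) / s ^ (2 * n - 1)" "\<lambda>_. 1" "?f s"] by simp
    finally have "0 \<le> (s ^ (2 * M) / s ^ (2 * n - 1)) ^ m * fdet m (?f s)" .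
    moreover have "0 < (s ^ (2 * M) / s ^ (2 * n - 1)) ^ m" using elim by simp
    ultimately show ?case
      using mult_pos_neg[of "(s ^ (2 * M) / s ^ (2 * n - 1)) ^ m" "fdet m (?f s)"] by linarith
  qed
qed simp

section \<open>Convergence of the coefficients\<close>

lemma tp_approximant:
  assumes al: "0 < \<alpha>" and N: "1 \<le> N" "real N * \<alpha> \<le> 1" and m: "real N * \<alpha> = 1 \<or> m \<le> N" and s: "0 < s"
  shows "tp m (fps_of_poly (\<Prod>k<M. [:1, - exp (- (real (Suc k) / \<alpha> * s)):]) *
       (\<Prod>l<M * N. geom (exp (- (real (Suc l) * s)))))"
proof -
  define a where "a k = exp (- (real (Suc k) / \<alpha> * s))" for k
  define b where "b l = exp (- (real (Suc l) * s))" for l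
  have inj_b: "inj b" using s by (auto simp: inj_def b_def)
  have "(\<Prod>l<M * N. geom (b l)) = (\<Prod>k<M. \<Prod>l\<in>{k * N..<k * N + N}. geom (b l))"
    by (rule prod.nat_group[symmetric])
  also have "\<dots> = (\<Prod>k<M. \<Prod>l<N. geom (b (k * N + l)))"
  proof (rule prod.cong[OF refl])
    fix k
    show "(\<Prod>l\<in>{k * N..<k * N + N}. geom (b l)) = (\<Prod>l<N. geom (b (k * N + l)))"
      by (rule prod.reindex_bij_witness[of _ "\<lambda>l. k * N + l" "\<lambda>l. l - k * N"]) auto
  qed
  finally have eq: "fps_of_poly (\<Prod>k<M. [:1, - a k:]) * (\<Prod>l<M * N. geom (b l)) =
     (\<Prod>k<M. fps_of_poly [:1, - a k:] * (\<Prod>l<N. geom (b (k * N + l))))"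
    by (simp add: fps_of_poly_prod prod.distrib)
  have "tp m (fps_of_poly [:1, - a k:] * (\<Prod>l<N. geom (b (k * N + l))))" for k
  proof (cases "real N * \<alpha> = 1")
    case True
    obtain N' where N': "N = Suc N'" using N by (cases N) auto
    have "real (Suc k) / \<alpha> = real (Suc k) * real N"
      using True al by (simp add: field_simps)
    also have "\<dots> = real (Suc (k * N + N'))"
      by (simp add: N' algebra_simps)
    \<comment> \<open>The zero falls on the last pole of its own block. The index is
      \<open>k * N + N'\<close> because \<open>b l\<close> belongs to the pole
      \<open>Suc l\<close>.\<close>
    finally have "a k = b (k * N + N')" by (simp add: a_def b_def)
    then have "fps_of_poly [:1, - a k:] * (\<Prod>l<N. geom (b (k * N + l))) =
       (fps_of_poly [:1, - b (k * N + N'):] * geom (b (k * N + N'))) * (\<Prod>l<N'. geom (b (k * N + l)))"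
      by (simp add: N' mult_ac)
    also have "\<dots> = (\<Prod>l<N'. geom (b (k * N + l)))"
      by (simp only: fps_of_poly_linear_geom mult_1)
    also have "tp m \<dots>"
      by (intro tp_prod tp_geom) (simp add: b_def)
    finally show ?thesis .
  next
    case False
    then have mN: "m \<le> N" using m by blast
    have N1: "real N * \<alpha> < 1" using N False by simp
    \<comment> \<open>The largest pole of the block is \<open>Suc k * N\<close>, and
      \<open>N * \<alpha> < 1\<close> puts the zero \<open>Suc k / \<alpha>\<close> beyond it; the
      decreasing passage to exponentials reverses the order.\<close>
    have "a k < b (k * N + l)" if "l < N" for l
    proof -
      have "real (Suc (k * N + l)) \<le> real (Suc k * N)"
        using that by (simp only: of_nat_le_iff) simp
      also have "real (Suc k * N) < real (Suc k) / \<alpha>"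
      proof -
        have "real (Suc k) * (real N * \<alpha>) < real (Suc k) * 1"
          using N1 by (intro mult_strict_left_mono) auto
        then have "real (Suc k) * real N * \<alpha> < real (Suc k)" by (simp only: mult.assoc mult_1_right)
        then show ?thesis using al by (simp only: of_nat_mult pos_less_divide_eq)
      qed
      finally have "real (Suc (k * N + l)) * s < real (Suc k) / \<alpha> * s"
        using s by (rule mult_strict_right_mono)
      then show ?thesis
        by (simp only: a_def b_def exp_less_cancel_iff neg_less_iff_less)
    qed
    moreover have "inj_on (\<lambda>l. b (k * N + l)) {..<N}"
      by (auto intro!: inj_onI dest!: injD[OF inj_b])
    ultimately show ?thesis
      using mN by (intro tp_of_strict_stair strict_stair_group) (auto simp: a_def)
  qed
  then have "tp m (\<Prod>k<M. fps_of_poly [:1, - a k:] * (\<Prod>l<N. geom (b (k * N + l))))"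
    by (intro tp_prod)
  then show ?thesis
    unfolding eq[symmetric] by (simp add: a_def b_def)
qed

text \<open>The residue normalised to Euler's product: a truncated sine product at \<open>t\<close>
  over a truncated sine product at the integer \<open>l + 1\<close> with its vanishing factor
  removed. The two truncations are separate parameters because there are \<open>N\<close> poles for
  every zero.\<close>

definition sine_ratio :: "real \<Rightarrow> nat \<Rightarrow> nat \<Rightarrow> nat \<Rightarrow> real" where
  "sine_ratio t n M l = (\<Prod>k<M. 1 - t\<^sup>2 / (real (Suc k))\<^sup>2) /
     (\<Prod>i\<in>{..<n} - {l}. 1 - (real (Suc l))\<^sup>2 / (real (Suc i))\<^sup>2)"

lemma one_minus_square_ratio: "(i::real) \<noteq> 0 \<Longrightarrow> 1 - j\<^sup>2 / i\<^sup>2 = (i - j) * (i + j) / i\<^sup>2"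
  by (simp add: field_simps power2_eq_square)

text \<open>Splitting each factor as \<open>(i - j) * (i + j) / i\<^sup>2\<close> with
  \<open>j = l + 1\<close> turns everything into factorials. The induction effectively starts at the
  shortest range containing \<open>l\<close>, where all factors are negative and give the sign; each
  later one is positive. The \<open>1 / 2\<close> comes from the removed index \<open>i = j\<close>,
  whose sum \<open>i + j = 2 * j\<close> is missing from the factorial of
  \<open>2 * j\<close>.\<close>

lemma prod_punctured_closed_form:
  assumes "l < n"
  shows "(\<Prod>i\<in>{..<n} - {l}. 1 - (real (Suc l))\<^sup>2 / (real (Suc i))\<^sup>2) =
     (-1) ^ l / 2 * (fact (n + Suc l) * fact (n - Suc l) / (fact n)\<^sup>2)"
  using assms
proof (induction n)
  case (Suc n)
  show ?case
  proof (cases "l = n")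
    case True
    have 1: "(\<Prod>i<l. real (Suc i) - real (Suc l)) = (-1) ^ l * fact l"
    proof -
      have "(\<Prod>i<l. real (Suc i) - real (Suc l)) = (\<Prod>i<l. (-1) * real (Suc i))"
        by (rule prod.reindex_bij_witness[of _ "\<lambda>i. l - Suc i" "\<lambda>i. l - Suc i"]) (auto simp: of_nat_diff)
      also have "\<dots> = (-1) ^ l * fact l"
        by (simp add: prod_uminus fact_prod_Suc atLeast0LessThan del: of_nat_Suc)
      finally show ?thesis .
    qed
    have 2: "(\<Prod>i<k. real (Suc i) + real (Suc l)) = fact (Suc l + k) / fact (Suc l)" for k
    proof (induction k)
      case (Suc k)
      have "fact (Suc l + Suc k) = (real (Suc k) + real (Suc l)) * fact (Suc l + k)" by simp
      then show ?case using Suc by (simp del: fact_Suc of_nat_Suc)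
    qed simp
    have 3: "(\<Prod>i<l. (real (Suc i))\<^sup>2) = (fact l)\<^sup>2"
      by (simp add: fact_prod_Suc atLeast0LessThan prod_power_distrib del: of_nat_Suc)
    have "(\<Prod>i\<in>{..<Suc n} - {l}. 1 - (real (Suc l))\<^sup>2 / (real (Suc i))\<^sup>2) =
        (\<Prod>i<l. (real (Suc i) - real (Suc l)) * (real (Suc i) + real (Suc l)) / (real (Suc i))\<^sup>2)"
    proof (rule prod.cong)
      show "{..<Suc n} - {l} = {..<l}" using True by auto
      fix i
      show "1 - (real (Suc l))\<^sup>2 / (real (Suc i))\<^sup>2 =
        (real (Suc i) - real (Suc l)) * (real (Suc i) + real (Suc l)) / (real (Suc i))\<^sup>2"
        by (rule one_minus_square_ratio) simp
    qed
    also have "\<dots> = (-1) ^ l * fact l * (fact (Suc l + l) / fact (Suc l)) / (fact l)\<^sup>2"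
      by (simp only: prod.distrib prod_dividef 1 2 3)
    also have "\<dots> = (-1) ^ l / 2 * (fact (Suc l + Suc l) * fact 0 / (fact (Suc l))\<^sup>2)"
    proof -
      have a: "fact (Suc l + Suc l) = 2 * real (Suc l) * fact (Suc l + l)"
        by (simp add: algebra_simps)
      have b: "fact (Suc l) = real (Suc l) * fact l" by simp
      have "\<sigma> * f * (F / (r * f)) / f\<^sup>2 = \<sigma> / 2 * (2 * r * F * 1 / (r * f)\<^sup>2)"
        if "r \<noteq> 0" "f \<noteq> 0" for r f F \<sigma> :: real
        using that by (simp add: field_simps power2_eq_square)
      then show ?thesis
        unfolding a b fact_0 using fact_nonzero of_nat_neq_0 by blast
    qed
    finally show ?thesis using True by simp
  next
    case False
    then have l: "l < n" using Suc.prems by simp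
    then obtain d where d: "n = Suc l + d" using less_imp_Suc_add by blast
    have "{..<Suc n} - {l} = insert n ({..<n} - {l})" using l by auto
    then have "(\<Prod>i\<in>{..<Suc n} - {l}. 1 - (real (Suc l))\<^sup>2 / (real (Suc i))\<^sup>2) =
        (1 - (real (Suc l))\<^sup>2 / (real (Suc n))\<^sup>2) * ((-1) ^ l / 2 * (fact (n + Suc l) * fact (n - Suc l) / (fact n)\<^sup>2))"
      using Suc.IH[OF l] by simp
    also have "\<dots> = (-1) ^ l / 2 * (fact (Suc n + Suc l) * fact (Suc n - Suc l) / (fact (Suc n))\<^sup>2)"
    proof -
      have a: "fact (Suc n + Suc l) = (real (Suc n) + real (Suc l)) * fact (n + Suc l)" by simp
      have "Suc n - Suc l = Suc (n - Suc l)" using l by simp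
      then have b: "fact (Suc n - Suc l) = (real (Suc n) - real (Suc l)) * fact (n - Suc l)"
        using l by (simp add: of_nat_diff)
      have c: "fact (Suc n) = real (Suc n) * fact n" by simp
      have e: "1 - (real (Suc l))\<^sup>2 / (real (Suc n))\<^sup>2 =
          (real (Suc n) - real (Suc l)) * (real (Suc n) + real (Suc l)) / (real (Suc n))\<^sup>2"
        by (rule one_minus_square_ratio) simp
      show ?thesis
        unfolding a b c e by (simp add: power_mult_distrib mult_ac del: of_nat_Suc fact_Suc)
    qed
    finally show ?thesis .
  qed
qed simp

lemma tendsto_fact_ratio:
  "(\<lambda>n. fact (n + j) * fact (n - j) / (fact n)\<^sup>2 :: real) \<longlonglongrightarrow> 1"
proof (induction j)
  case 0
  then show ?case by (simp add: power2_eq_square)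
next
  case (Suc j)
  have "(\<lambda>n. (real n + (real j + 1)) / (real n - real j)) \<longlonglongrightarrow> 1"
    by real_asymp
  then have "(\<lambda>n. fact (n + j) * fact (n - j) / (fact n)\<^sup>2 * ((real n + (real j + 1)) / (real n - real j))) \<longlonglongrightarrow> 1 * 1"
    by (intro tendsto_mult Suc)
  then have lim: "(\<lambda>n. fact (n + j) * fact (n - j) / (fact n)\<^sup>2 * ((real n + (real j + 1)) / (real n - real j))) \<longlonglongrightarrow> 1"
    by simp
  have "fact (n + j) * fact (n - j) / (fact n)\<^sup>2 * ((real n + (real j + 1)) / (real n - real j)) =
      fact (n + Suc j) * fact (n - Suc j) / (fact n)\<^sup>2" if n: "j < n" for n
  proof -
    have "n - j = Suc (n - Suc j)" using n by simp
    then have a: "fact (n - j) = (real n - real j) * fact (n - Suc j)"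
      using n by (simp add: of_nat_diff)
    have b: "fact (n + Suc j) = (real n + (real j + 1)) * fact (n + j)" by (simp add: algebra_simps)
    show ?thesis
      unfolding a b using n by (simp add: field_simps)
  qed
  then show ?case
    by (intro Lim_transform_eventually[OF lim] eventually_mono[OF eventually_gt_at_top[of j]])
qed

lemma tendsto_sine_ratio:
  assumes "0 < t" "1 \<le> N"
  shows "(\<lambda>M. sine_ratio t (M * N) M l) \<longlonglongrightarrow> 2 * (-1) ^ l * (sin (pi * t) / (pi * t))"
proof -
  have num: "(\<lambda>M. \<Prod>k<M. 1 - t\<^sup>2 / (real (Suc k))\<^sup>2) \<longlonglongrightarrow> sin (pi * t) / (pi * t)"
  proof -
    have "(\<Prod>k=1..M. 1 - t\<^sup>2 / (real k)\<^sup>2) = (\<Prod>k<M. 1 - t\<^sup>2 / (real (Suc k))\<^sup>2)" for M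
      by (rule prod.reindex_bij_witness[of _ Suc "\<lambda>k. k - 1"]) auto
    then show ?thesis using sin_product_formula_real'[of t] assms by simp
  qed
  have MN: "filterlim (\<lambda>M. M * N) at_top sequentially"
    using assms by (intro filterlim_at_top_mono[OF filterlim_ident] always_eventually) simp
  have den: "(\<lambda>M. \<Prod>i\<in>{..<M * N} - {l}. 1 - (real (Suc l))\<^sup>2 / (real (Suc i))\<^sup>2) \<longlonglongrightarrow> (-1) ^ l / 2 * 1"
  proof (rule Lim_transform_eventually)
    show "(\<lambda>M. (-1) ^ l / 2 * (fact (M * N + Suc l) * fact (M * N - Suc l) / (fact (M * N))\<^sup>2)) \<longlonglongrightarrow> (-1) ^ l / 2 * (1::real)"
      by (intro tendsto_mult tendsto_const filterlim_compose[OF tendsto_fact_ratio MN])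
    have "\<forall>\<^sub>F M in sequentially. l < M * N"
      using MN eventually_gt_at_top[of l] by (metis filterlim_iff)
    then show "\<forall>\<^sub>F M in sequentially. (-1) ^ l / 2 * (fact (M * N + Suc l) * fact (M * N - Suc l) / (fact (M * N))\<^sup>2) =
      (\<Prod>i\<in>{..<M * N} - {l}. 1 - (real (Suc l))\<^sup>2 / (real (Suc i))\<^sup>2)"
      by eventually_elim (rule prod_punctured_closed_form[symmetric])
  qed
  have "(\<lambda>M. sine_ratio t (M * N) M l) \<longlonglongrightarrow> (sin (pi * t) / (pi * t)) / ((-1) ^ l / 2 * 1)"
    unfolding sine_ratio_def by (intro tendsto_divide num den) auto
  also have "(sin (pi * t) / (pi * t)) / ((-1) ^ l / 2 * 1) = 2 * (-1) ^ l * (sin (pi * t) / (pi * t))"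
    by (cases "even l") auto
  finally show ?thesis .
qed

text \<open>As \<open>M\<close> grows the modulus only increases: each new zero factor dominates the factor of the
  last of the \<open>N\<close> new poles.\<close>

lemma abs_sine_ratio_le:
  assumes al: "0 < \<alpha>" "1 \<le> N" "real N * \<alpha> \<le> 1" and l: "l < M * N"
  shows "\<bar>sine_ratio (\<alpha> * real (Suc l)) (M * N) M l\<bar> \<le> 2"
proof -
  define t where "t = \<alpha> * real (Suc l)"
  have t: "0 < t" using al by (simp add: t_def)
  have step: "\<bar>sine_ratio t (M * N) M l\<bar> \<le> \<bar>sine_ratio t (Suc M * N) (Suc M) l\<bar>" if l: "l < M * N" for M
  proof -
    let ?x = "1 - t\<^sup>2 / (real (Suc M))\<^sup>2"
    let ?g = "\<lambda>i. 1 - (real (Suc l))\<^sup>2 / (real (Suc i))\<^sup>2"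
    let ?y = "\<Prod>i\<in>{M * N..<Suc M * N}. ?g i"
    have g: "0 < ?g i" "?g i \<le> 1" if "i \<in> {M * N..<Suc M * N}" for i
    proof -
      have "real (Suc l) < real (Suc i)" using that l by auto
      then have "(real (Suc l))\<^sup>2 < (real (Suc i))\<^sup>2" by (intro power_strict_mono) auto
      then have "(real (Suc l))\<^sup>2 / (real (Suc i))\<^sup>2 < 1" by (simp only: divide_less_eq_1_pos zero_less_power of_nat_0_less_iff zero_less_Suc)
      then show "0 < ?g i" by linarith
      show "?g i \<le> 1" by simp
    qed
    have y0: "0 < ?y" by (rule prod_pos) (use g in auto)
    have tM: "t < real (Suc M)"
    proof -
      have "real (Suc l) \<le> real (M * N)" using l by (simp only: of_nat_le_iff Suc_le_eq)
      then have "t \<le> \<alpha> * real (M * N)" unfolding t_def using al by (intro mult_left_mono) auto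
      also have "\<dots> = real M * (real N * \<alpha>)" by simp
      also have "\<dots> \<le> real M * 1" using al by (intro mult_left_mono) auto
      finally show ?thesis by simp
    qed
    have x0: "0 < ?x"
    proof -
      have "t\<^sup>2 < (real (Suc M))\<^sup>2" using tM t by (intro power_strict_mono) auto
      then have "t\<^sup>2 / (real (Suc M))\<^sup>2 < 1" by (simp only: divide_less_eq_1_pos zero_less_power of_nat_0_less_iff zero_less_Suc)
      then show ?thesis by linarith
    qed
    have yx: "?y \<le> ?x"
    proof -
      \<comment> \<open>The last new pole is \<open>Suc M * N\<close>, the partner of the new zero
        \<open>Suc M / \<alpha>\<close>; since \<open>\<alpha> \<le> 1 / N\<close>, its factor is at
        most that of the zero. The other new factors lie between 0 and 1 and only help.\<close>
      define i where "i = Suc M * N - 1"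
      have i: "i \<in> {M * N..<Suc M * N}" "Suc i = Suc M * N" using al by (auto simp: i_def)
      have "?y = ?g i * (\<Prod>i\<in>{M * N..<Suc M * N} - {i}. ?g i)"
        by (rule prod.remove) (use i in auto)
      also have "\<dots> \<le> ?g i * 1"
      proof (intro mult_left_mono prod_le_1)
        show "0 \<le> ?g i" using g(1)[OF i(1)] by (rule less_imp_le)
        show "0 \<le> ?g j \<and> ?g j \<le> 1" if "j \<in> {M * N..<Suc M * N} - {i}" for j
          using g[of j] that by (meson DiffD1 less_imp_le)
      qed
      also have "?g i * 1 = 1 - (real (Suc l) / real N)\<^sup>2 / (real (Suc M))\<^sup>2"
      proof -
        have "r\<^sup>2 / (p * q)\<^sup>2 = (r / q)\<^sup>2 / p\<^sup>2" for p q r :: real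
          by (simp add: power_mult_distrib power_divide)
        then show ?thesis unfolding i(2) of_nat_mult mult_1_right by (rule arg_cong)
      qed
      also have "\<dots> \<le> ?x"
      proof -
        have "\<alpha> \<le> 1 / real N" using al by (simp add: field_simps)
        then have "t \<le> real (Suc l) / real N" unfolding t_def
          using mult_right_mono[of \<alpha> "1 / real N" "real (Suc l)"] by simp
        then have "t\<^sup>2 \<le> (real (Suc l) / real N)\<^sup>2" using t by (intro power_mono) auto
        then show ?thesis by (simp add: divide_right_mono del: of_nat_Suc)
      qed
      finally show ?thesis .
    qed
    have "{..<Suc M * N} - {l} = ({..<M * N} - {l}) \<union> {M * N..<Suc M * N}"
      using l by auto
    then have "prod ?g ({..<Suc M * N} - {l}) = prod ?g (({..<M * N} - {l}) \<union> {M * N..<Suc M * N})"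
      by (rule arg_cong)
    also have "\<dots> = prod ?g ({..<M * N} - {l}) * ?y"
      by (rule prod.union_disjoint) auto
    finally have den: "prod ?g ({..<Suc M * N} - {l}) = prod ?g ({..<M * N} - {l}) * ?y" .
    have "sine_ratio t (Suc M * N) (Suc M) l = sine_ratio t (M * N) M l * (?x / ?y)"
      unfolding sine_ratio_def den prod.lessThan_Suc by (simp only: times_divide_times_eq)
    then have "\<bar>sine_ratio t (Suc M * N) (Suc M) l\<bar> = \<bar>sine_ratio t (M * N) M l\<bar> * (?x / ?y)"
      using x0 y0 by (simp only: abs_mult) (simp add: abs_of_pos)
    moreover have "1 \<le> ?x / ?y" using yx y0 by (simp add: le_divide_eq)
    then have "\<bar>sine_ratio t (M * N) M l\<bar> * 1 \<le> \<bar>sine_ratio t (M * N) M l\<bar> * (?x / ?y)"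
      by (intro mult_left_mono) auto
    ultimately show ?thesis by simp
  qed
  have mono: "\<bar>sine_ratio t (M * N) M l\<bar> \<le> \<bar>sine_ratio t ((M + k) * N) (M + k) l\<bar>" for k
  proof (induction k)
    case (Suc k)
    have "l < (M + k) * N" using l by (simp add: add_mult_distrib)
    from order_trans[OF Suc step[OF this]] show ?case by simp
  qed simp
  \<comment> \<open>A modulus increasing to its limit is bounded by the limit, and this one is at
    most 2 because \<open>\<bar>sin x\<bar> \<le> x\<close> for positive \<open>x\<close>.\<close>
  have "(\<lambda>M. \<bar>sine_ratio t (M * N) M l\<bar>) \<longlonglongrightarrow> \<bar>2 * (-1) ^ l * (sin (pi * t) / (pi * t))\<bar>"
    by (intro tendsto_rabs tendsto_sine_ratio t al)
  then have "(\<lambda>k. \<bar>sine_ratio t ((k + M) * N) (k + M) l\<bar>) \<longlonglongrightarrow> \<bar>2 * (-1) ^ l * (sin (pi * t) / (pi * t))\<bar>"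
    by (rule LIMSEQ_ignore_initial_segment)
  then have "\<bar>sine_ratio t (M * N) M l\<bar> \<le> \<bar>2 * (-1) ^ l * (sin (pi * t) / (pi * t))\<bar>"
    by (rule LIMSEQ_le_const) (use mono in \<open>auto simp: add.commute\<close>)
  also have "\<dots> = 2 * (\<bar>sin (pi * t)\<bar> / (pi * t))"
    using t by (simp add: abs_mult power_abs)
  also have "\<bar>sin (pi * t)\<bar> \<le> pi * t"
    using abs_sin_x_le_abs_x[of "pi * t"] t by simp
  then have "2 * (\<bar>sin (pi * t)\<bar> / (pi * t)) \<le> 2 * 1"
    using t by (intro mult_left_mono) auto
  finally show ?thesis by (simp add: t_def)
qed

text \<open>The normalising constant does not depend on \<open>l\<close>, so it merely rescales the
  kernel. Separating the index \<open>i = l\<close> leaves \<open>j\<^sup>2\<close> from the product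
  of squares over \<open>2 * j\<close> from the product of sums, hence the factor
  \<open>j / 2\<close>.\<close>

lemma rho_eq_sine_ratio:
  assumes "0 < \<alpha>" "l < n"
  shows "rho M (\<lambda>k. real (Suc k) / \<alpha>) n l * ((\<Prod>i<n. (real (Suc i))\<^sup>2) / (\<Prod>k<M. (real (Suc k) / \<alpha>)\<^sup>2)) =
     real (Suc l) / 2 * sine_ratio (\<alpha> * real (Suc l)) n M l"
proof -
  let ?j = "real (Suc l)"
  let ?P = "\<Prod>i\<in>{..<n} - {l}. real (Suc i) - ?j" and ?Q = "\<Prod>i\<in>{..<n} - {l}. real (Suc i) + ?j"
  let ?S = "\<Prod>i\<in>{..<n} - {l}. (real (Suc i))\<^sup>2" and ?Z = "\<Prod>k<M. (real (Suc k) / \<alpha>)\<^sup>2"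
  let ?A = "\<Prod>k<M. (real (Suc k) / \<alpha> - ?j) * (real (Suc k) / \<alpha> + ?j)"
  have q: "(\<Prod>i<n. real (Suc i) + ?j) = (2 * ?j) * ?Q"
    using prod.remove[of "{..<n}" l "\<lambda>i. real (Suc i) + ?j"] assms by simp
  have sq: "(\<Prod>i<n. (real (Suc i))\<^sup>2) = ?j\<^sup>2 * ?S"
    using prod.remove[of "{..<n}" l "\<lambda>i. (real (Suc i))\<^sup>2"] assms by simp
  have den: "(\<Prod>i\<in>{..<n} - {l}. 1 - ?j\<^sup>2 / (real (Suc i))\<^sup>2) = ?P * ?Q / ?S"
    unfolding prod.distrib[symmetric] prod_dividef[symmetric]
    by (rule prod.cong) (simp_all only: one_minus_square_ratio of_nat_eq_0_iff nat.simps not_False_eq_True refl)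
  have num: "(\<Prod>k<M. 1 - (\<alpha> * ?j)\<^sup>2 / (real (Suc k))\<^sup>2) = ?A / ?Z"
    unfolding prod_dividef[symmetric]
  proof (rule prod.cong[OF refl])
    fix k
    have "(real (Suc k) / \<alpha> - ?j) * (real (Suc k) / \<alpha> + ?j) / (real (Suc k) / \<alpha>)\<^sup>2 =
          1 - ?j\<^sup>2 / (real (Suc k) / \<alpha>)\<^sup>2"
      by (rule one_minus_square_ratio[symmetric]) (use assms in auto)
    then show "1 - (\<alpha> * ?j)\<^sup>2 / (real (Suc k))\<^sup>2 =
      (real (Suc k) / \<alpha> - ?j) * (real (Suc k) / \<alpha> + ?j) / (real (Suc k) / \<alpha>)\<^sup>2"
      by (simp add: power_divide power_mult_distrib mult.commute)
  qed
  have "?S \<noteq> 0" "?Z \<noteq> 0" "?j \<noteq> 0" using assms by (auto simp: prod_zero_iff)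
  then show ?thesis
    unfolding rho_def sine_ratio_def num den q sq
    by (simp add: power2_eq_square divide_simps del: of_nat_Suc)
qed

text \<open>Imaginary part of the geometric series for \<open>w / (1 + w)\<close> at
  \<open>w = rcis q \<theta>\<close>.\<close>

lemma alternating_sine_series:
  assumes q: "0 \<le> q" "q < (1::real)"
  shows "(\<lambda>l. (-1) ^ l * q ^ Suc l * sin (real (Suc l) * \<theta>)) sums (q * sin \<theta> / (1 + 2 * q * cos \<theta> + q\<^sup>2))"
proof -
  define w where "w = rcis q \<theta>"
  have nw: "norm w < 1" using q by (simp add: w_def)
  then have "(\<lambda>l. w * (- w) ^ l) sums (w * (1 / (1 - (- w))))"
    by (intro sums_mult geometric_sums) simp
  then have "(\<lambda>l. Im (w * (- w) ^ l)) sums Im (w * (1 / (1 - (- w))))"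
    by (rule sums_Im)
  moreover have "Im (w * (- w) ^ l) = (-1) ^ l * q ^ Suc l * sin (real (Suc l) * \<theta>)" for l
  proof -
    have "w * (- w) ^ l = ((-1) ^ l :: real) *\<^sub>R w ^ Suc l"
      by (simp add: power_minus[of w] scaleR_conv_of_real)
    also have "w ^ Suc l = rcis (q ^ Suc l) (real (Suc l) * \<theta>)"
      unfolding w_def by (rule DeMoivre2)
    finally show ?thesis by (simp add: mult.assoc del: power_Suc of_nat_Suc)
  qed
  moreover have "Im (w * (1 / (1 - (- w)))) = q * sin \<theta> / (1 + 2 * q * cos \<theta> + q\<^sup>2)"
  proof -
    have re: "Re w = q * cos \<theta>" "Im w = q * sin \<theta>" by (simp_all add: w_def)
    have square: "(1 + q * C)\<^sup>2 + (q * S)\<^sup>2 = 1 + 2 * q * C + q\<^sup>2 * (S\<^sup>2 + C\<^sup>2)" for S C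
      by (simp add: power2_eq_square algebra_simps)
    have "Im (w * (1 / (1 - (- w)))) = Im (w / (1 + w))" by simp
    also have "\<dots> = (Im w * (1 + Re w) - Re w * Im w) / ((1 + Re w)\<^sup>2 + (Im w)\<^sup>2)"
      by (simp add: Im_divide)
    also have "(1 + Re w)\<^sup>2 + (Im w)\<^sup>2 = 1 + 2 * q * cos \<theta> + q\<^sup>2 * ((sin \<theta>)\<^sup>2 + (cos \<theta>)\<^sup>2)"
      unfolding re by (rule square)
    also have "Im w * (1 + Re w) - Re w * Im w = q * sin \<theta>"
      unfolding re by (simp add: algebra_simps)
    finally show ?thesis by simp
  qed
  ultimately show ?thesis by simp
qed

text \<open>Tannery's theorem: the uniform bound on \<open>sine_ratio\<close> dominates the terms by
  \<open>real (Suc l) * exp (- d) ^ Suc l\<close>. That series converges only for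
  \<open>d > 0\<close>, so coinciding points have to be reached by a further limit.\<close>

lemma tendsto_expsum:
  assumes al: "0 < \<alpha>" "1 \<le> N" "real N * \<alpha> \<le> 1" and d: "0 < d"
  shows "(\<lambda>M. \<Sum>l<M * N. real (Suc l) / 2 * sine_ratio (\<alpha> * real (Suc l)) (M * N) M l * exp (- (real (Suc l) * d)))
     \<longlonglongrightarrow> (exp (- d) * sin (pi * \<alpha>) / (1 + 2 * exp (- d) * cos (pi * \<alpha>) + (exp (- d))\<^sup>2)) / (pi * \<alpha>)"
proof -
  \<comment> \<open>Extension by 0 gives all the finite sums one index set, as dominated convergence
    requires.\<close>
  define a where "a l M = (if l < M * N then real (Suc l) / 2 * sine_ratio (\<alpha> * real (Suc l)) (M * N) M l *
     exp (- (real (Suc l) * d)) else 0)" for l M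
  define c where "c l = (-1) ^ l * exp (- d) ^ Suc l * sin (real (Suc l) * (pi * \<alpha>)) / (pi * \<alpha>)" for l
  have e: "exp (- (real (Suc l) * d)) = exp (- d) ^ Suc l" for l
    by (simp only: exp_of_nat_mult[symmetric]) simp
  have lim: "(\<lambda>M. a l M) \<longlonglongrightarrow> c l" for l
  proof (rule Lim_transform_eventually)
    let ?t = "\<alpha> * real (Suc l)"
    have "(\<lambda>M. real (Suc l) / 2 * sine_ratio ?t (M * N) M l * exp (- (real (Suc l) * d))) \<longlonglongrightarrow>
       real (Suc l) / 2 * (2 * (-1) ^ l * (sin (pi * ?t) / (pi * ?t))) * exp (- (real (Suc l) * d))"
      using al by (intro tendsto_intros tendsto_sine_ratio) auto
    also have "real (Suc l) / 2 * (2 * (-1) ^ l * (sin (pi * ?t) / (pi * ?t))) * exp (- (real (Suc l) * d)) = c l"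
      unfolding e c_def using al by (simp add: mult_ac del: of_nat_Suc)
    finally show "(\<lambda>M. real (Suc l) / 2 * sine_ratio ?t (M * N) M l * exp (- (real (Suc l) * d))) \<longlonglongrightarrow> c l" .
    have "\<forall>\<^sub>F M in sequentially. l < M * N"
      using eventually_gt_at_top[of l]
    proof eventually_elim
      case (elim M)
      have "M \<le> M * N" using al by (cases N) auto
      then show ?case using elim by linarith
    qed
    then show "\<forall>\<^sub>F M in sequentially. real (Suc l) / 2 * sine_ratio ?t (M * N) M l * exp (- (real (Suc l) * d)) = a l M"
      by eventually_elim (simp add: a_def)
  qed
  have bound: "norm (a l M) \<le> real (Suc l) * exp (- d) ^ Suc l" for l M
  proof (cases "l < M * N")
    case True
    have "\<bar>sine_ratio (\<alpha> * real (Suc l)) (M * N) M l\<bar> \<le> 2"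
      using abs_sine_ratio_le al True by blast
    then have "real (Suc l) / 2 * exp (- d) ^ Suc l * \<bar>sine_ratio (\<alpha> * real (Suc l)) (M * N) M l\<bar> \<le>
       real (Suc l) / 2 * exp (- d) ^ Suc l * 2"
      by (intro mult_left_mono) auto
    then show ?thesis using True unfolding a_def e
      by (simp add: abs_mult mult_ac del: of_nat_Suc power_Suc)
  qed (simp add: a_def)
  have "summable (\<lambda>l. real (Suc l) * exp (- d) ^ l * exp (- d))"
    using geometric_deriv_sums[of "exp (- d)"] d by (intro summable_mult2) (auto simp: sums_iff)
  then have summ: "summable (\<lambda>l. real (Suc l) * exp (- d) ^ Suc l)"
    by (simp add: mult_ac)
  have "(\<lambda>M. suminf (\<lambda>l. a l M)) \<longlonglongrightarrow> suminf c"
    using tannerys_theorem[of a c sequentially "\<lambda>l. real (Suc l) * exp (- d) ^ Suc l"] lim summ bound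
    by (auto simp: always_eventually)
  moreover have "suminf (\<lambda>l. a l M) = (\<Sum>l<M * N. real (Suc l) / 2 * sine_ratio (\<alpha> * real (Suc l)) (M * N) M l *
     exp (- (real (Suc l) * d)))" for M
    by (subst suminf_finite[of "{..<M * N}"]) (auto simp: a_def)
  moreover have "c sums ((exp (- d) * sin (pi * \<alpha>) / (1 + 2 * exp (- d) * cos (pi * \<alpha>) + (exp (- d))\<^sup>2)) / (pi * \<alpha>))"
    unfolding c_def using d by (intro sums_divide alternating_sine_series) auto
  ultimately show ?thesis by (simp add: sums_iff)
qed

section \<open>Total positivity\<close>

lemma kminor_fdet: "kminor K m x y = fdet m (\<lambda>i j. K (x i) (y j))"
  by (simp add: kminor_def fdet_def)

lemma Kalpha_denominator_pos:
  assumes "0 \<le> \<alpha>" "\<alpha> < 1" "0 < x" "0 < y"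
  shows "0 < x\<^sup>2 + 2 * cos (pi * \<alpha>) * x * y + y\<^sup>2"
proof -
  have "cos pi < cos (pi * \<alpha>)"
    using assms by (intro cos_monotone_0_pi) auto
  then have "0 < 2 * (1 + cos (pi * \<alpha>)) * (x * y)"
    using assms by (intro mult_pos_pos) auto
  also have "\<dots> \<le> (x - y)\<^sup>2 + 2 * (1 + cos (pi * \<alpha>)) * (x * y)" by simp
  also have "\<dots> = x\<^sup>2 + 2 * cos (pi * \<alpha>) * x * y + y\<^sup>2"
    by (simp add: power2_eq_square algebra_simps)
  finally show ?thesis .
qed

text \<open>Dividing \<open>x * y\<close> and the denominator of the kernel by the square of the
  larger point leaves a function of the ratio of the smaller to the larger one, which is
  \<open>exp (- \<bar>ln x - ln y\<bar>)\<close>.\<close>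

lemma Kalpha_exp:
  assumes "0 < x" "0 < y"
  shows "exp (- \<bar>ln x - ln y\<bar>) / (1 + 2 * exp (- \<bar>ln x - ln y\<bar>) * cos (pi * \<alpha>) + (exp (- \<bar>ln x - ln y\<bar>))\<^sup>2) =
     x * y * Kalpha \<alpha> x y"
proof -
  have *: "exp (- \<bar>ln x - ln y\<bar>) / (1 + 2 * exp (- \<bar>ln x - ln y\<bar>) * cos (pi * \<alpha>) + (exp (- \<bar>ln x - ln y\<bar>))\<^sup>2) =
     x * y / (x\<^sup>2 + 2 * cos (pi * \<alpha>) * x * y + y\<^sup>2)" if "0 < x" "0 < y" "y \<le> x" for x y :: real
  proof -
    have "exp (- \<bar>ln x - ln y\<bar>) = y / x" using that by (simp add: exp_diff)
    then have "exp (- \<bar>ln x - ln y\<bar>) / (1 + 2 * exp (- \<bar>ln x - ln y\<bar>) * cos (pi * \<alpha>) + (exp (- \<bar>ln x - ln y\<bar>))\<^sup>2) =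
      (y / x) / ((x\<^sup>2 + 2 * cos (pi * \<alpha>) * x * y + y\<^sup>2) / x\<^sup>2)"
      using that by (simp add: power2_eq_square add_divide_distrib)
    also have "\<dots> = x * y / (x\<^sup>2 + 2 * cos (pi * \<alpha>) * x * y + y\<^sup>2)"
      using that by (simp add: power2_eq_square)
    finally show ?thesis .
  qed
  show ?thesis
  proof (cases "y \<le> x")
    case True
    then show ?thesis using *[of x y] assms by (simp add: Kalpha_def)
  next
    case False
    then show ?thesis using *[of y x] assms
      by (simp add: Kalpha_def abs_minus_commute[of "ln x"] mult.commute add.commute add.left_commute mult.left_commute)
  qed
qed

lemma Kalpha_minor_nonneg_distinct:
  assumes al: "0 < \<alpha>" "\<alpha> < 1" "2 \<le> N" "real N * \<alpha> \<le> 1" and m: "real N * \<alpha> = 1 \<or> m \<le> N"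
    and x: "incr m x" "\<And>i. i < m \<Longrightarrow> 0 < x i" and y: "incr m y" "\<And>i. i < m \<Longrightarrow> 0 < y i"
    and ne: "\<And>i j. i < m \<Longrightarrow> j < m \<Longrightarrow> x i \<noteq> y j"
  shows "0 \<le> fdet m (\<lambda>i j. Kalpha \<alpha> (x i) (y j))"
proof -
  \<comment> \<open>Only differences of logarithms matter, so adding \<open>c\<close> is free; it
    moves all points to the nonnegative half-line demanded by
    \<open>expsum_minor_nonneg\<close>.\<close>
  define c where "c = (\<Sum>i<m. \<bar>ln (x i)\<bar> + \<bar>ln (y i)\<bar>)"
  define u where "u i = ln (x i) + c" for i
  define v where "v i = ln (y i) + c" for i
  have c: "0 \<le> u i \<and> 0 \<le> v i" if "i < m" for i
  proof -
    have "\<bar>ln (x i)\<bar> + \<bar>ln (y i)\<bar> \<le> c"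
      unfolding c_def by (rule member_le_sum) (use that in auto)
    then show ?thesis unfolding u_def v_def by linarith
  qed
  have inc: "incr m u" "incr m v"
    using x y by (auto simp: incr_def u_def v_def)
  define z where "z k = real (Suc k) / \<alpha>" for k
  define C where "C M = (\<Prod>i<M * N. (real (Suc i))\<^sup>2) / (\<Prod>k<M. (z k)\<^sup>2)" for M
  let ?d = "\<lambda>i j. \<bar>u i - v j\<bar>"
  let ?f = "\<lambda>M i j. \<Sum>l<M * N. real (Suc l) / 2 * sine_ratio (\<alpha> * real (Suc l)) (M * N) M l * exp (- (real (Suc l) * ?d i j))"
  have C0: "0 \<le> C M" for M
    unfolding C_def by (intro divide_nonneg_nonneg prod_nonneg) auto
  have pos: "0 \<le> fdet m (?f M)" if M: "0 < M" for M
  proof -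
    \<comment> \<open>Here \<open>2 \<le> N\<close> enters: partial fractions without polynomial
      part require strictly fewer zeros than poles.\<close>
    have MN: "M < M * N" using al M by simp
    have "0 \<le> fdet m (\<lambda>i j. \<Sum>l<M * N. rho M z (M * N) l * exp (- (real (Suc l) * ?d i j)))"
    proof (rule expsum_minor_nonneg[OF _ MN inc c])
      fix s :: real assume "0 < s"
      then show "tp m (fps_of_poly (\<Prod>k<M. [:1, - exp (- (z k * s)):]) *
          (\<Prod>l<M * N. geom (exp (- (real (Suc l) * s)))))"
        unfolding z_def using al by (intro tp_approximant m) auto
    qed
    then have "0 \<le> C M ^ m * fdet m (\<lambda>i j. \<Sum>l<M * N. rho M z (M * N) l * exp (- (real (Suc l) * ?d i j)))"
      using C0 by (intro mult_nonneg_nonneg) auto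
    also have "\<dots> = fdet m (\<lambda>i j. C M * 1 * (\<Sum>l<M * N. rho M z (M * N) l * exp (- (real (Suc l) * ?d i j))))"
      using fdet_scale[of m "\<lambda>_. C M" "\<lambda>_. 1"] by simp
    also have "\<dots> = fdet m (?f M)"
    proof (rule fdet_cong)
      fix i j
      have "C M * rho M z (M * N) l = real (Suc l) / 2 * sine_ratio (\<alpha> * real (Suc l)) (M * N) M l"
        if "l < M * N" for l
        using rho_eq_sine_ratio[of \<alpha> l "M * N" M] that al unfolding C_def z_def by (simp only: mult.commute)
      then have "(\<Sum>l<M * N. C M * rho M z (M * N) l * exp (- (real (Suc l) * ?d i j))) = ?f M i j"
        by (intro sum.cong refl) (simp only: lessThan_iff)
      then show "C M * 1 * (\<Sum>l<M * N. rho M z (M * N) l * exp (- (real (Suc l) * ?d i j))) = ?f M i j"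
        by (simp only: sum_distrib_left mult.assoc mult_1_left)
    qed
    finally show ?thesis .
  qed
  let ?g = "\<lambda>i j. (exp (- ?d i j) * sin (pi * \<alpha>) /
     (1 + 2 * exp (- ?d i j) * cos (pi * \<alpha>) + (exp (- ?d i j))\<^sup>2)) / (pi * \<alpha>)"
  have "0 \<le> fdet m ?g"
  proof (rule tendsto_lowerbound)
    show "(\<lambda>M. fdet m (?f M)) \<longlonglongrightarrow> fdet m ?g"
    proof (intro tendsto_fdet tendsto_expsum)
      fix i j assume "i < m" "j < m"
      then have "ln (x i) \<noteq> ln (y j)" using ne x y by simp
      then show "0 < ?d i j" by (simp add: u_def v_def)
    qed (use al in auto)
    show "\<forall>\<^sub>F M in sequentially. 0 \<le> fdet m (?f M)"
      using eventually_gt_at_top[of 0] by eventually_elim (rule pos)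
  qed simp
  also have "fdet m ?g = fdet m (\<lambda>i j. (x i * (sin (pi * \<alpha>) / (pi * \<alpha>))) * y j * Kalpha \<alpha> (x i) (y j))"
  proof (rule fdet_cong)
    fix i j assume "i < m" "j < m"
    then have eq: "x i * y j * Kalpha \<alpha> (x i) (y j) =
       exp (- ?d i j) / (1 + 2 * exp (- ?d i j) * cos (pi * \<alpha>) + (exp (- ?d i j))\<^sup>2)"
      using Kalpha_exp[of "x i" "y j" \<alpha>] x y by (simp add: u_def v_def)
    have "?g i j = exp (- ?d i j) / (1 + 2 * exp (- ?d i j) * cos (pi * \<alpha>) + (exp (- ?d i j))\<^sup>2) *
       (sin (pi * \<alpha>) / (pi * \<alpha>))" by simp
    then show "?g i j = (x i * (sin (pi * \<alpha>) / (pi * \<alpha>))) * y j * Kalpha \<alpha> (x i) (y j)"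
      unfolding eq[symmetric] by (simp only: mult_ac)
  qed
  also have "\<dots> = (\<Prod>i<m. x i * (sin (pi * \<alpha>) / (pi * \<alpha>))) * (\<Prod>j<m. y j) * fdet m (\<lambda>i j. Kalpha \<alpha> (x i) (y j))"
    by (rule fdet_scale)
  finally have "0 \<le> (\<Prod>i<m. x i * (sin (pi * \<alpha>) / (pi * \<alpha>))) * (\<Prod>j<m. y j) * fdet m (\<lambda>i j. Kalpha \<alpha> (x i) (y j))" .
  moreover have "0 < sin (pi * \<alpha>)" using al by (intro sin_gt_zero) auto
  then have "0 < (\<Prod>i<m. x i * (sin (pi * \<alpha>) / (pi * \<alpha>))) * (\<Prod>j<m. y j)"
    using al x y by (intro mult_pos_pos prod_pos divide_pos_pos) auto
  ultimately show ?thesis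
    using mult_pos_neg[of "(\<Prod>i<m. x i * (sin (pi * \<alpha>) / (pi * \<alpha>))) * (\<Prod>j<m. y j)" "fdet m (\<lambda>i j. Kalpha \<alpha> (x i) (y j))"]
    by linarith
qed

lemma tendsto_Kalpha:
  assumes "(f \<longlongrightarrow> a) F" "(g \<longlongrightarrow> x) F" "(h \<longlongrightarrow> y) F" "0 \<le> a" "a < 1" "0 < x" "0 < y"
  shows "((\<lambda>s. Kalpha (f s) (g s) (h s)) \<longlongrightarrow> Kalpha a x y) F"
  unfolding Kalpha_def
proof (intro tendsto_divide tendsto_add tendsto_mult tendsto_power tendsto_const assms(1-3))
  show "((\<lambda>s. cos (pi * f s)) \<longlongrightarrow> cos (pi * a)) F"
    by (rule isCont_tendsto_compose[OF isCont_cos]) (intro tendsto_mult tendsto_const assms(1))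
qed (use Kalpha_denominator_pos[of a x y] assms in auto)

text \<open>A slight dilation separates the \<open>x i\<close> from the \<open>y j\<close>: a point
  at or above \<open>y j\<close> moves strictly above it, and a point below stays below once the
  dilation is small. Continuity of the kernel returns to the original points.\<close>

lemma Kalpha_minor_nonneg:
  assumes al: "0 < \<alpha>" "\<alpha> < 1" "2 \<le> N" "real N * \<alpha> \<le> 1" and m: "real N * \<alpha> = 1 \<or> m \<le> N"
    and x: "incr_pts {0<..} m x" and y: "incr_pts {0<..} m y"
  shows "0 \<le> kminor (Kalpha \<alpha>) m x y"
proof (rule tendsto_lowerbound)
  have x': "incr m x" "\<And>i. i < m \<Longrightarrow> 0 < x i" using x by (auto simp: incr_pts_def incr_def)
  have y': "incr m y" "\<And>i. i < m \<Longrightarrow> 0 < y i" using y by (auto simp: incr_pts_def incr_def)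
  let ?x = "\<lambda>k i. x i * (1 + 1 / real (Suc k))"
  have lim: "(\<lambda>k. ?x k i) \<longlonglongrightarrow> x i" for i
  proof -
    have "(\<lambda>k. ?x k i) \<longlonglongrightarrow> x i * (1 + 0)"
      by (intro tendsto_intros LIMSEQ_inverse_real_of_nat[unfolded inverse_eq_divide])
    then show ?thesis by simp
  qed
  show "(\<lambda>k. fdet m (\<lambda>i j. Kalpha \<alpha> (?x k i) (y j))) \<longlonglongrightarrow> kminor (Kalpha \<alpha>) m x y"
    unfolding kminor_fdet
    by (intro tendsto_fdet tendsto_Kalpha lim tendsto_const) (use al x' y' in auto)
  have ev: "\<forall>\<^sub>F k in sequentially. \<forall>i\<in>{..<m}. \<forall>j\<in>{..<m}. ?x k i \<noteq> y j"
  proof (intro eventually_ball_finite finite_lessThan ballI)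
    fix i j assume i: "i \<in> {..<m}"
    show "\<forall>\<^sub>F k in sequentially. ?x k i \<noteq> y j"
    proof (cases "y j \<le> x i")
      case True
      have "?x k i \<noteq> y j" for k
      proof -
        have "0 < x i * (1 / real (Suc k))" using x'(2) i by simp
        then show ?thesis using True by (simp add: distrib_left)
      qed
      then show ?thesis by simp
    next
      case False
      then have "\<forall>\<^sub>F k in sequentially. ?x k i < y j"
        by (intro order_tendstoD(2)[OF lim]) simp
      then show ?thesis by eventually_elim simp
    qed
  qed
  show "\<forall>\<^sub>F k in sequentially. 0 \<le> fdet m (\<lambda>i j. Kalpha \<alpha> (?x k i) (y j))"
    using ev
  proof eventually_elim
    case (elim k)
    have p: "0 < 1 + 1 / real (Suc k)" by (intro add_pos_pos) auto
    show ?case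
    proof (rule Kalpha_minor_nonneg_distinct[OF al m _ _ y'])
      show "incr m (?x k)" using x'(1) p by (auto simp: incr_def intro!: mult_strict_right_mono)
      show "0 < ?x k i" if "i < m" for i using x'(2)[OF that] p by (rule mult_pos_pos)
    qed (use elim in auto)
  qed
qed simp

text \<open>The zeros \<open>k / \<alpha>\<close> make no sense at \<open>\<alpha> = 0\<close>. The
  parameters \<open>1 / real (Suc k)\<close> tend to 0, and for all but the first of them minors of
  every order are known to be nonnegative.\<close>

lemma Kalpha_0_minor_nonneg:
  assumes x: "incr_pts {0<..} m x" and y: "incr_pts {0<..} m y"
  shows "0 \<le> kminor (Kalpha 0) m x y"
proof (rule tendsto_lowerbound)
  show "(\<lambda>k. kminor (Kalpha (1 / real (Suc k))) m x y) \<longlonglongrightarrow> kminor (Kalpha 0) m x y"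
    unfolding kminor_fdet
    by (intro tendsto_fdet tendsto_Kalpha tendsto_const LIMSEQ_inverse_real_of_nat[unfolded inverse_eq_divide])
       (use x y in \<open>auto simp: incr_pts_def\<close>)
  show "\<forall>\<^sub>F k in sequentially. 0 \<le> kminor (Kalpha (1 / real (Suc k))) m x y"
    using eventually_gt_at_top[of 0]
  proof eventually_elim
    case (elim k)
    show ?case
      by (rule Kalpha_minor_nonneg[where N = "Suc k", OF _ _ _ _ _ x y]) (use elim in auto)
  qed
qed simp

section \<open>Strict positivity\<close>

text \<open>Clearing denominators gives a polynomial with infinitely many zeros, hence the zero
  polynomial. At the complex root \<open>- cis (pi * \<alpha>) * y j\<close> of the
  \<open>j\<close>-th denominator only the \<open>j\<close>-th summand survives, because the roots
  of the \<open>k\<close>-th denominator have modulus \<open>y k\<close>.\<close>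

lemma Kalpha_combination_vanishes:
  fixes y :: "nat \<Rightarrow> real"
  assumes al: "0 \<le> \<alpha>" "\<alpha> < 1" and y: "incr m y" "\<And>i. i < m \<Longrightarrow> 0 < y i"
    and ab: "0 < a" "a < b" and zero: "\<And>x. a < x \<Longrightarrow> x < b \<Longrightarrow> (\<Sum>j<m. c j * Kalpha \<alpha> x (y j)) = 0"
    and j: "j < m"
  shows "c j = 0"
proof -
  define q where "q k = [:complex_of_real ((y k)\<^sup>2), complex_of_real (2 * cos (pi * \<alpha>) * y k), 1:]" for k
  define p where "p = (\<Sum>j<m. Polynomial.smult (complex_of_real (c j)) (\<Prod>k\<in>{..<m} - {j}. q k))"
  have q_real: "poly (q k) (complex_of_real x) = complex_of_real (x\<^sup>2 + 2 * cos (pi * \<alpha>) * x * y k + (y k)\<^sup>2)" for k x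
    by (simp add: q_def power2_eq_square algebra_simps)
  have "poly p (complex_of_real x) = 0" if x: "a < x" "x < b" for x
  proof -
    let ?d = "\<lambda>k. x\<^sup>2 + 2 * cos (pi * \<alpha>) * x * y k + (y k)\<^sup>2"
    have d: "?d k \<noteq> 0" if "k < m" for k
      using Kalpha_denominator_pos[OF al, of x "y k"] y(2)[OF that] x ab by simp
    have "(\<Sum>j<m. c j * (\<Prod>k\<in>{..<m} - {j}. ?d k)) = (\<Prod>k<m. ?d k) * (\<Sum>j<m. c j * Kalpha \<alpha> x (y j))"
      unfolding sum_distrib_left
    proof (rule sum.cong[OF refl])
      fix j assume j: "j \<in> {..<m}"
      then have "(\<Prod>k<m. ?d k) = ?d j * (\<Prod>k\<in>{..<m} - {j}. ?d k)"
        by (intro prod.remove) auto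
      then show "c j * (\<Prod>k\<in>{..<m} - {j}. ?d k) = (\<Prod>k<m. ?d k) * (c j * Kalpha \<alpha> x (y j))"
        using d[of j] j by (simp add: Kalpha_def)
    qed
    also have "\<dots> = 0" using zero[OF x] by simp
    finally have "(\<Sum>j<m. c j * (\<Prod>k\<in>{..<m} - {j}. ?d k)) = 0" .
    moreover have "poly p (complex_of_real x) = complex_of_real (\<Sum>j<m. c j * (\<Prod>k\<in>{..<m} - {j}. ?d k))"
      by (simp add: p_def poly_sum poly_prod q_real)
    ultimately show ?thesis by simp
  qed
  then have "complex_of_real ` {a<..<b} \<subseteq> {z. poly p z = 0}" by auto
  moreover have "infinite (complex_of_real ` {a<..<b})"
    using ab infinite_Ioo[of a b] by (simp add: finite_image_iff inj_on_def)
  ultimately have "infinite {z. poly p z = 0}" by (rule infinite_super)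
  then have p0: "p = 0" using poly_roots_finite by blast
  define w where "w = - (cis (pi * \<alpha>) * complex_of_real (y j))"
  have factor: "poly (q k) w = (w + cis (pi * \<alpha>) * y k) * (w + cis (- (pi * \<alpha>)) * y k)" for k
  proof -
    have 1: "cis (pi * \<alpha>) * cis (- (pi * \<alpha>)) = 1" by (simp add: cis_mult)
    have 2: "cis (pi * \<alpha>) + cis (- (pi * \<alpha>)) = complex_of_real (2 * cos (pi * \<alpha>))"
      by (simp add: complex_eq_iff)
    have "(w + cis (pi * \<alpha>) * y k) * (w + cis (- (pi * \<alpha>)) * y k) =
       w * w + (cis (pi * \<alpha>) + cis (- (pi * \<alpha>))) * y k * w + (cis (pi * \<alpha>) * cis (- (pi * \<alpha>))) * (y k * y k)"
      by (simp add: algebra_simps)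
    also have "\<dots> = poly (q k) w"
      unfolding 1 2 q_def by (simp add: power2_eq_square algebra_simps)
    finally show ?thesis by simp
  qed
  have root: "poly (q j) w = 0" unfolding factor by (simp add: w_def)
  have nz: "poly (q k) w \<noteq> 0" if k: "k < m" "k \<noteq> j" for k
  proof -
    have ne: "y k \<noteq> y j" using y(1) k j unfolding incr_def by (metis linorder_neqE_nat order_less_irrefl)
    have pos: "0 < y k" "0 < y j" using y(2) k j by auto
    have "w + cis b * y k \<noteq> 0" for b
    proof
      assume "w + cis b * y k = 0"
      then have "cis b * y k = cis (pi * \<alpha>) * y j" by (simp add: w_def)
      then have "cmod (cis b * y k) = cmod (cis (pi * \<alpha>) * y j)" by simp
      then show False using ne pos by (simp add: norm_mult)
    qed
    then show ?thesis unfolding factor by simp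
  qed
  have "0 = poly p w" using p0 by simp
  also have "\<dots> = (\<Sum>i<m. c i * (\<Prod>k\<in>{..<m} - {i}. poly (q k) w))"
    by (simp add: p_def poly_sum poly_prod)
  also have "\<dots> = (\<Sum>i\<in>{j}. c i * (\<Prod>k\<in>{..<m} - {i}. poly (q k) w))"
  proof (rule sum.mono_neutral_right)
    show "\<forall>i\<in>{..<m} - {j}. c i * (\<Prod>k\<in>{..<m} - {i}. poly (q k) w) = 0"
    proof
      fix i assume "i \<in> {..<m} - {j}"
      then have "(\<Prod>k\<in>{..<m} - {i}. poly (q k) w) = 0"
        using j root by (intro prod_zero) auto
      then show "c i * (\<Prod>k\<in>{..<m} - {i}. poly (q k) w) = 0" by simp
    qed
  qed (use j in auto)
  finally have "complex_of_real (c j) * (\<Prod>k\<in>{..<m} - {j}. poly (q k) w) = 0" by simp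
  moreover have "(\<Prod>k\<in>{..<m} - {j}. poly (q k) w) \<noteq> 0" using nz by auto
  ultimately show ?thesis by simp
qed

lemma three_term_zero:
  fixes a b c d p q :: real
  assumes "d * a = b * p + c * q" "d = 0" "0 \<le> b" "0 \<le> c" "0 < p" "0 < q"
  shows "c = 0"
proof -
  have "0 \<le> b * p" "0 \<le> c * q" using assms by auto
  moreover have "b * p + c * q = 0" using assms(1,2) by simp
  ultimately have "c * q = 0" by linarith
  then show ?thesis using assms(6) by simp
qed

text \<open>If a minor vanished, then by the three-term relation it would still vanish after inserting
  any point between \<open>x\<^sub>0\<close> and \<open>x\<^sub>1\<close> and dropping the last one, contradicting the linear
  independence of the functions \<open>K(\<cdot>, y\<^sub>j)\<close> on an interval.\<close>

lemma Kalpha_minor_pos: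
  assumes al: "0 \<le> \<alpha>" "\<alpha> < 1"
    and nonneg: "\<And>k x y. k \<le> m \<Longrightarrow> incr_pts {0<..} k x \<Longrightarrow> incr_pts {0<..} k y \<Longrightarrow> 0 \<le> kminor (Kalpha \<alpha>) k x y"
    and "incr_pts {0<..} m x" "incr_pts {0<..} m y"
  shows "0 < kminor (Kalpha \<alpha>) m x y"
  using assms(3-5)
proof (induction m arbitrary: x y)
  case 0
  then show ?case by (simp add: kminor_fdet)
next
  case (Suc m)
  let ?K = "Kalpha \<alpha>"
  have x: "0 < x i" if "i < Suc m" for i using Suc.prems(2) that by (auto simp: incr_pts_def)
  have y: "0 < y i" if "i < Suc m" for i using Suc.prems(3) that by (auto simp: incr_pts_def)
  have x_less: "x i < x j" if "i < j" "j < Suc m" for i j using Suc.prems(2) that by (auto simp: incr_pts_def)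
  have y_less: "y i < y j" if "i < j" "j < Suc m" for i j using Suc.prems(3) that by (auto simp: incr_pts_def)
  have low: "0 < fdet m (\<lambda>i k. ?K (v k) (w i))" if "incr_pts {0<..} m v" "incr_pts {0<..} m w" for v w
    using Suc.IH[OF Suc.prems(1) that] unfolding kminor_fdet by (subst fdet_transpose) auto
  show ?case
  proof (cases "m = 0")
    case True
    then show ?thesis
      using Kalpha_denominator_pos[OF al, of "x 0" "y 0"] x y by (simp add: kminor_fdet Kalpha_def)
  next
    case False
    have "kminor ?K (Suc m) x y \<noteq> 0"
    proof
      assume D0: "kminor ?K (Suc m) x y = 0"
      \<comment> \<open>Up to sign, the cofactor of \<open>?K x' (y i)\<close> after
        \<open>x'\<close> is inserted next to \<open>x 0\<close> and the last point is dropped;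
        positive by the induction hypothesis.\<close>
      define M where "M i = fdet m (\<lambda>i' k. ?K (x k) (y (insert_index i i')))" for i
      have incx: "incr_pts {0<..} m x" using x x_less by (auto simp: incr_pts_def)
      have M_pos: "0 < M i" if "i \<le> m" for i
        unfolding M_def
        by (rule low[OF incx]) (use that y y_less in \<open>auto simp: incr_pts_def insert_index_def\<close>)
      have "(\<Sum>i<Suc m. ((-1) ^ (i + 1) * M i) * ?K x' (y i)) = 0" if x': "x 0 < x'" "x' < x 1" for x'
      proof -
        define u where "u = ins 1 x' x"
        have u_skip: "u (insert_index 1 k) = x k" for k
          by (simp add: u_def)
        have "0 < x'" using x'(1) x[of 0] by simp
        then have u_pos: "0 < u k" if "k < Suc (Suc m)" for k
          using that x False by (auto simp: u_def ins_def)
        have "incr (Suc (Suc m)) u"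
          unfolding u_def using x' x_less False by (intro incr_ins) (auto simp: incr_def)
        then have u_less: "u i < u j" if "i < j" "j < Suc (Suc m)" for i j
          using that by (simp add: incr_def)
        have big: "0 \<le> fdet (Suc m) (\<lambda>i k. ?K (v k) (y i))" if "incr_pts {0<..} (Suc m) v" for v
          using Suc.prems(1)[OF _ that Suc.prems(3)] unfolding kminor_fdet by (subst fdet_transpose) auto
        have "fdet (Suc m) (\<lambda>i k. ?K (u (insert_index 1 k)) (y i)) * fdet m (\<lambda>i k. ?K (u (Suc k)) (y (insert_index m i))) =
           fdet (Suc m) (\<lambda>i k. ?K (u (Suc k)) (y i)) * fdet m (\<lambda>i k. ?K (u (insert_index 1 k)) (y (insert_index m i))) +
           fdet (Suc m) (\<lambda>i k. ?K (u k) (y i)) * fdet m (\<lambda>i k. ?K (u (insert_index 1 (Suc k))) (y (insert_index m i)))"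
          using fdet_three_term[of 1 "Suc m" m "\<lambda>i k. ?K (u k) (y i)"] False by simp
        moreover have "fdet (Suc m) (\<lambda>i k. ?K (u (insert_index 1 k)) (y i)) = 0"
          unfolding u_skip using D0 unfolding kminor_fdet by (subst fdet_transpose)
        moreover have "0 \<le> fdet (Suc m) (\<lambda>i k. ?K (u (Suc k)) (y i))"
          by (rule big) (use u_pos u_less in \<open>auto simp: incr_pts_def\<close>)
        moreover have "0 \<le> fdet (Suc m) (\<lambda>i k. ?K (u k) (y i))"
          by (rule big) (use u_pos u_less in \<open>auto simp: incr_pts_def\<close>)
        moreover have "0 < fdet m (\<lambda>i k. ?K (u (insert_index 1 k)) (y (insert_index m i)))"
          unfolding u_skip
          by (rule low[OF incx]) (use y y_less in \<open>auto simp: incr_pts_def insert_index_def\<close>)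
        moreover have "0 < fdet m (\<lambda>i k. ?K (u (insert_index 1 (Suc k))) (y (insert_index m i)))"
          unfolding u_skip
          by (rule low) (use x x_less y y_less in \<open>auto simp: incr_pts_def insert_index_def\<close>)
        ultimately have "fdet (Suc m) (\<lambda>i k. ?K (u k) (y i)) = 0"
          by (rule three_term_zero)
        moreover have "fdet (Suc m) (\<lambda>i k. ?K (u k) (y i)) =
          (\<Sum>i\<le>m. (-1) ^ (i + 1) * ?K (u 1) (y i) * fdet m (\<lambda>i' k. ?K (u (insert_index 1 k)) (y (insert_index i i'))))"
          using False by (intro fdet_laplace_col) auto
        moreover have "u 1 = x'" by (simp add: u_def ins_def)
        ultimately show ?thesis
          unfolding u_skip M_def by (simp add: lessThan_Suc_atMost mult_ac)
      qed
      note vanish = this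
      have "(-1) ^ (0 + 1) * M 0 = 0"
      proof (rule Kalpha_combination_vanishes[where m = "Suc m" and y = y and a = "x 0" and b = "x 1"
              and c = "\<lambda>i. (-1) ^ (i + 1) * M i" and j = 0, OF al])
        show "incr (Suc m) y" using y_less by (auto simp: incr_def)
        show "x 0 < x 1" using False by (intro x_less) auto
      qed (use x y vanish in auto)
      then show False using M_pos[of 0] by simp
    qed
    then show ?thesis using Suc.prems by (simp add: order_less_le)
  qed
qed

section \<open>Necessity\<close>

text \<open>For \<open>x i = exp (s * real i)\<close> the off-diagonal entries of the rescaled
  matrix decay as \<open>s\<close> grows, while the diagonal stays at
  \<open>1 / (2 + 2 * cos (pi * \<alpha>))\<close>.\<close>

lemma exists_positive_minor:
  assumes al: "0 \<le> \<alpha>" "\<alpha> < 1"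
  shows "\<exists>x. incr_pts {0<..} r x \<and> 0 < kminor (Kalpha \<alpha>) r x x"
proof -
  let ?E = "\<lambda>s i j. exp (- (s * \<bar>real i - real j\<bar>))"
  let ?f = "\<lambda>s i j. ?E s i j / (1 + 2 * ?E s i j * cos (pi * \<alpha>) + (?E s i j)\<^sup>2)"
  let ?g = "\<lambda>i j. if i = j then 1 / (2 + 2 * cos (pi * \<alpha>)) else 0 :: real"
  have "cos pi < cos (pi * \<alpha>)"
    using al by (intro cos_monotone_0_pi) auto
  then have c: "0 < 2 + 2 * cos (pi * \<alpha>)" by simp
  have "((\<lambda>s. fdet r (?f s)) \<longlongrightarrow> fdet r ?g) at_top"
  proof (rule tendsto_fdet)
    fix i j :: nat
    show "((\<lambda>s. ?f s i j) \<longlongrightarrow> ?g i j) at_top"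
    proof (cases "i = j")
      case False
      define d where "d = \<bar>real i - real j\<bar>"
      have "0 < d" using False by (simp add: d_def)
      then have E: "((\<lambda>s. exp (- (s * d))) \<longlongrightarrow> 0) at_top"
        by real_asymp
      have "((\<lambda>s. exp (- (s * d)) / (1 + 2 * exp (- (s * d)) * cos (pi * \<alpha>) + (exp (- (s * d)))\<^sup>2)) \<longlongrightarrow>
        0 / (1 + 2 * 0 * cos (pi * \<alpha>) + 0\<^sup>2)) at_top"
        by (intro tendsto_divide tendsto_add tendsto_mult tendsto_power tendsto_const E) auto
      then show ?thesis using False by (simp add: d_def)
    qed simp
  qed
  moreover have "0 < fdet r ?g"
  proof -
    have "fdet r ?g = (\<Prod>i<r. ?g i i)" by (rule fdet_lower_triangular) auto
    also have "\<dots> > 0" using c by (intro prod_pos) auto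
    finally show ?thesis .
  qed
  ultimately have "\<forall>\<^sub>F s in at_top. 0 < fdet r (?f s)" by (rule order_tendstoD(1))
  then have "\<forall>\<^sub>F s in at_top. 0 < fdet r (?f s) \<and> (0::real) < s"
    using eventually_gt_at_top[of 0] by (rule eventually_conj)
  then obtain s where s: "0 < fdet r (?f s)" "0 < s"
    using eventually_happens[of _ at_top] by force
  define x where "x i = exp (s * real i)" for i
  have "fdet r (?f s) = fdet r (\<lambda>i j. x i * x j * Kalpha \<alpha> (x i) (x j))"
  proof (rule fdet_cong)
    fix i j
    have "\<bar>ln (x i) - ln (x j)\<bar> = s * \<bar>real i - real j\<bar>"
      using s(2) by (simp add: x_def abs_mult flip: right_diff_distrib)
    then show "?f s i j = x i * x j * Kalpha \<alpha> (x i) (x j)"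
      using Kalpha_exp[of "x i" "x j" \<alpha>] by (simp add: x_def)
  qed
  also have "\<dots> = (\<Prod>i<r. x i) * (\<Prod>i<r. x i) * kminor (Kalpha \<alpha>) r x x"
    unfolding kminor_fdet by (rule fdet_scale)
  finally have "0 < (\<Prod>i<r. x i) * (\<Prod>i<r. x i) * kminor (Kalpha \<alpha>) r x x" using s(1) by simp
  moreover have "0 < (\<Prod>i<r. x i) * (\<Prod>i<r. x i)" by (intro mult_pos_pos prod_pos) (auto simp: x_def)
  ultimately have "0 < kminor (Kalpha \<alpha>) r x x" by (rule zero_less_mult_pos)
  moreover have "incr_pts {0<..} r x" using s(2) by (auto simp: incr_pts_def x_def)
  ultimately show ?thesis by blast
qed

text \<open>Truncated generating function of the Chebyshev polynomials of the second kind, at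
  \<open>- t\<close> and with exact remainder. The induction step is their three-term recurrence,
  here an addition formula for sines.\<close>

lemma sine_geometric_remainder:
  "(1 + 2 * cos \<theta> * t + t\<^sup>2) * (\<Sum>k<r. (-1) ^ k * sin (real (Suc k) * \<theta>) * t ^ k) =
     sin \<theta> - (-1) ^ r * t ^ r * (sin (real (Suc r) * \<theta>) + sin (real r * \<theta>) * t)"
proof (induction r)
  case (Suc r)
  have "sin (real (Suc (Suc r)) * \<theta>) + sin (real r * \<theta>) = 2 * sin (real (Suc r) * \<theta>) * cos \<theta>"
  proof -
    have "real (Suc (Suc r)) * \<theta> = real (Suc r) * \<theta> + \<theta>" "real r * \<theta> = real (Suc r) * \<theta> - \<theta>"
      by (simp_all add: algebra_simps)
    then show ?thesis by (simp only: sin_add sin_diff)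
  qed
  then have s: "sin (real (Suc (Suc r)) * \<theta>) = 2 * sin (real (Suc r) * \<theta>) * cos \<theta> - sin (real r * \<theta>)"
    by linarith
  have "(1 + 2 * cos \<theta> * t + t\<^sup>2) * (\<Sum>k<Suc r. (-1) ^ k * sin (real (Suc k) * \<theta>) * t ^ k) =
    (1 + 2 * cos \<theta> * t + t\<^sup>2) * (\<Sum>k<r. (-1) ^ k * sin (real (Suc k) * \<theta>) * t ^ k) +
    (1 + 2 * cos \<theta> * t + t\<^sup>2) * ((-1) ^ r * sin (real (Suc r) * \<theta>) * t ^ r)"
    by (simp add: distrib_left del: of_nat_Suc)
  then show ?case
    unfolding Suc.IH s by (simp add: power2_eq_square algebra_simps del: of_nat_Suc)
qed simp

lemma fdet_left_inverse:
  assumes "fdet n f \<noteq> 0"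
  obtains g where "\<And>k l. k < n \<Longrightarrow> l < n \<Longrightarrow> (\<Sum>i<n. g k i * f i l) = (if k = l then 1 else 0)"
proof -
  let ?A = "mat n n (\<lambda>(i,j). f i j)"
  have A: "?A \<in> carrier_mat n n" by simp
  from det_non_zero_imp_unit[OF A, of undefined] assms
  have "?A \<in> Units (ring_mat TYPE(real) n undefined)" by (simp add: fdet_def)
  then obtain B where B: "B \<in> carrier_mat n n" "B * ?A = 1\<^sub>m n"
    unfolding Units_def ring_mat_def by auto
  have "(\<Sum>i<n. B $$ (k, i) * f i l) = (if k = l then 1 else 0)" if "k < n" "l < n" for k l
  proof -
    have "(B * ?A) $$ (k, l) = (\<Sum>i<n. B $$ (k, i) * f i l)"
      using B(1) that by (simp add: scalar_prod_def lessThan_atLeast0)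
    then show ?thesis using B(2) that by simp
  qed
  then show thesis by (rule that)
qed

text \<open>For \<open>x\<close> close to \<open>0\<close> the minors are governed by the first \<open>r\<close> terms of the expansion
  \<open>K(x, y) = \<Sum>\<^sub>k (-1)\<^sup>k U\<^sub>k(cos \<theta>) x\<^sup>k y\<^sup>-\<^sup>k\<^sup>-\<^sup>2\<close>, where \<open>U\<^sub>k(cos \<theta>) = sin ((k + 1) \<theta>) / sin \<theta>\<close>.\<close>

lemma tendsto_minor_small_x:
  fixes a y :: "nat \<Rightarrow> real"
  assumes al: "0 \<le> \<alpha>" "\<alpha> < 1" and a: "\<And>i. i < r \<Longrightarrow> 0 < a i" and y: "\<And>j. j < r \<Longrightarrow> 0 < y j"
    and V: "fdet r (\<lambda>i k. a i ^ k) \<noteq> 0"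
  shows "((\<lambda>\<epsilon>. fdet r (\<lambda>i j. sin (pi * \<alpha>) * (y j)\<^sup>2 * Kalpha \<alpha> (\<epsilon> * a i) (y j)) / (\<Prod>k<r. \<epsilon> ^ k)) \<longlongrightarrow>
     fdet r (\<lambda>i k. a i ^ k) * ((\<Prod>k<r. (-1) ^ k * sin (real (Suc k) * (pi * \<alpha>))) * fdet r (\<lambda>k j. (1 / y j) ^ k)))
     (at_right 0)"
proof -
  let ?\<theta> = "pi * \<alpha>"
  let ?s = "\<lambda>k. sin (real k * ?\<theta>)"
  \<comment> \<open>\<open>W\<close> inverts the Vandermonde matrix of the \<open>a i\<close>.
    Applied from the left it separates the powers of \<open>\<epsilon>\<close>: row \<open>k\<close>
    becomes \<open>\<epsilon> ^ k\<close> times a row with a finite limit.\<close>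
  obtain W where W: "\<And>k l. k < r \<Longrightarrow> l < r \<Longrightarrow> (\<Sum>i<r. W k i * a i ^ l) = (if k = l then 1 else 0)"
    using fdet_left_inverse[OF V] by blast
  define f where "f \<epsilon> i j = sin ?\<theta> * (y j)\<^sup>2 * Kalpha \<alpha> (\<epsilon> * a i) (y j)" for \<epsilon> i j
  define t where "t \<epsilon> i j = \<epsilon> * a i / y j" for \<epsilon> i j
  define R where "R \<epsilon> i j = (-1) ^ r * (a i / y j) ^ r * ((?s (Suc r) + ?s r * t \<epsilon> i j) / (1 + 2 * cos ?\<theta> * t \<epsilon> i j + (t \<epsilon> i j)\<^sup>2))"
    for \<epsilon> i j
  \<comment> \<open>The remainder of order \<open>\<epsilon> ^ r\<close> keeps the factor
    \<open>\<epsilon> ^ (r - k)\<close> after \<open>\<epsilon> ^ k\<close> is taken out of row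
    \<open>k\<close>; as \<open>k < r\<close>, it disappears in the limit.\<close>
  define G where "G \<epsilon> k j = (-1) ^ k * ?s (Suc k) * (1 / y j) ^ k + \<epsilon> ^ (r - k) * (\<Sum>i<r. W k i * R \<epsilon> i j)" for \<epsilon> k j
  have f_eq: "f \<epsilon> i j = (\<Sum>k<r. (-1) ^ k * ?s (Suc k) * (1 / y j) ^ k * \<epsilon> ^ k * a i ^ k) + \<epsilon> ^ r * R \<epsilon> i j"
    if "0 < \<epsilon>" "i < r" "j < r" for \<epsilon> i j
  proof -
    have pos: "0 < \<epsilon> * a i" "0 < y j" using a y that by auto
    let ?D = "1 + 2 * cos ?\<theta> * t \<epsilon> i j + (t \<epsilon> i j)\<^sup>2"
    have D: "(\<epsilon> * a i)\<^sup>2 + 2 * cos ?\<theta> * (\<epsilon> * a i) * y j + (y j)\<^sup>2 = (y j)\<^sup>2 * ?D"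
      using pos by (simp add: t_def field_simps power2_eq_square)
    then have "0 < (y j)\<^sup>2 * ?D" using Kalpha_denominator_pos[OF al pos] by simp
    then have D0: "?D \<noteq> 0" by auto
    have "f \<epsilon> i j = sin ?\<theta> / ?D"
      unfolding f_def Kalpha_def D using pos by simp
    also have "\<dots> = (\<Sum>k<r. (-1) ^ k * ?s (Suc k) * t \<epsilon> i j ^ k) + (-1) ^ r * t \<epsilon> i j ^ r * ((?s (Suc r) + ?s r * t \<epsilon> i j) / ?D)"
    proof -
      have "sin ?\<theta> = ?D * (\<Sum>k<r. (-1) ^ k * ?s (Suc k) * t \<epsilon> i j ^ k) + (-1) ^ r * t \<epsilon> i j ^ r * (?s (Suc r) + ?s r * t \<epsilon> i j)"
        using sine_geometric_remainder[of ?\<theta> "t \<epsilon> i j" r] by linarith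
      then have "sin ?\<theta> / ?D = (?D * (\<Sum>k<r. (-1) ^ k * ?s (Suc k) * t \<epsilon> i j ^ k) +
          (-1) ^ r * t \<epsilon> i j ^ r * (?s (Suc r) + ?s r * t \<epsilon> i j)) / ?D" by (rule arg_cong)
      then show ?thesis
        using D0 by (simp only: add_divide_distrib[of "?D * _"] nonzero_mult_div_cancel_left times_divide_eq_right not_False_eq_True)
    qed
    also have "\<dots> = (\<Sum>k<r. (-1) ^ k * ?s (Suc k) * (1 / y j) ^ k * \<epsilon> ^ k * a i ^ k) + \<epsilon> ^ r * R \<epsilon> i j"
    proof -
      have "t \<epsilon> i j ^ k = (1 / y j) ^ k * \<epsilon> ^ k * a i ^ k" for k
        by (simp add: t_def power_mult_distrib power_divide)
      then have "(\<Sum>k<r. (-1) ^ k * ?s (Suc k) * t \<epsilon> i j ^ k) =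
          (\<Sum>k<r. (-1) ^ k * ?s (Suc k) * (1 / y j) ^ k * \<epsilon> ^ k * a i ^ k)"
        by (simp only: mult.assoc)
      moreover have "t \<epsilon> i j ^ r = \<epsilon> ^ r * (a i / y j) ^ r"
        by (simp add: t_def power_mult_distrib power_divide)
      then have "(-1) ^ r * t \<epsilon> i j ^ r * ((?s (Suc r) + ?s r * t \<epsilon> i j) / ?D) = \<epsilon> ^ r * R \<epsilon> i j"
        unfolding R_def by (simp only: mult_ac)
      ultimately show ?thesis by (simp only:)
    qed
    finally show ?thesis .
  qed
  have Wf: "(\<Sum>i<r. W k i * f \<epsilon> i j) = \<epsilon> ^ k * 1 * G \<epsilon> k j" if e: "0 < \<epsilon>" and k: "k < r" and j: "j < r" for \<epsilon> k j
  proof -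
    let ?c = "\<lambda>l. (-1) ^ l * ?s (Suc l) * (1 / y j) ^ l * \<epsilon> ^ l"
    have "(\<Sum>i<r. W k i * f \<epsilon> i j) = (\<Sum>i<r. W k i * ((\<Sum>l<r. ?c l * a i ^ l) + \<epsilon> ^ r * R \<epsilon> i j))"
      using f_eq e j by (intro sum.cong) auto
    also have "\<dots> = (\<Sum>l<r. ?c l * (\<Sum>i<r. W k i * a i ^ l)) + \<epsilon> ^ r * (\<Sum>i<r. W k i * R \<epsilon> i j)"
    proof -
      have "(\<Sum>i<r. W k i * (\<Sum>l<r. ?c l * a i ^ l)) = (\<Sum>l<r. ?c l * (\<Sum>i<r. W k i * a i ^ l))"
        unfolding sum_distrib_left by (subst sum.swap) (simp only: mult_ac)
      moreover have "(\<Sum>i<r. W k i * (\<epsilon> ^ r * R \<epsilon> i j)) = \<epsilon> ^ r * (\<Sum>i<r. W k i * R \<epsilon> i j)"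
        unfolding sum_distrib_left by (simp only: mult_ac)
      ultimately show ?thesis by (simp only: distrib_left sum.distrib)
    qed
    also have "(\<Sum>l<r. ?c l * (\<Sum>i<r. W k i * a i ^ l)) = (\<Sum>l<r. if k = l then ?c l else 0)"
      using W k by (intro sum.cong) auto
    also have "\<dots> = ?c k" using k by simp
    also have "\<epsilon> ^ r = \<epsilon> ^ k * \<epsilon> ^ (r - k)" using k by (simp flip: power_add)
    finally show ?thesis unfolding G_def by (simp only: distrib_left mult_ac mult_1_right mult_1_left)
  qed
  have WV: "fdet r W * fdet r (\<lambda>i k. a i ^ k) = 1"
  proof -
    have "fdet r W * fdet r (\<lambda>i k. a i ^ k) = fdet r (\<lambda>k l. if k = l then 1 else 0)"
      unfolding fdet_mult[symmetric] using W by (intro fdet_cong) auto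
    also have "\<dots> = (\<Prod>i<r. 1)" by (subst fdet_lower_triangular) auto
    finally show ?thesis by simp
  qed
  have "((\<lambda>\<epsilon>. fdet r (\<lambda>i k. a i ^ k) * fdet r (G \<epsilon>)) \<longlongrightarrow>
     fdet r (\<lambda>i k. a i ^ k) * fdet r (\<lambda>k j. ((-1) ^ k * ?s (Suc k)) * 1 * (1 / y j) ^ k)) (at_right 0)"
  proof (intro tendsto_mult tendsto_const tendsto_fdet)
    fix k j assume k: "k < r" and j: "j < r"
    have id: "((\<lambda>\<epsilon>. \<epsilon>) \<longlongrightarrow> (0::real)) (at_right 0)" by (rule tendsto_ident_at)
    have t0: "((\<lambda>\<epsilon>. t \<epsilon> i j) \<longlongrightarrow> 0) (at_right 0)" for i
    proof -
      have "((\<lambda>\<epsilon>. \<epsilon> * (a i / y j)) \<longlongrightarrow> 0 * (a i / y j)) (at_right 0)"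
        by (intro tendsto_mult tendsto_const id)
      then show ?thesis by (simp add: t_def)
    qed
    have Rlim: "((\<lambda>\<epsilon>. R \<epsilon> i j) \<longlongrightarrow> (-1) ^ r * (a i / y j) ^ r * ((?s (Suc r) + ?s r * 0) / (1 + 2 * cos ?\<theta> * 0 + 0\<^sup>2))) (at_right 0)" for i
      unfolding R_def by (intro tendsto_mult tendsto_const tendsto_divide tendsto_add tendsto_power t0) simp
    have "((\<lambda>\<epsilon>. G \<epsilon> k j) \<longlongrightarrow> (-1) ^ k * ?s (Suc k) * (1 / y j) ^ k +
      0 ^ (r - k) * (\<Sum>i<r. W k i * ((-1) ^ r * (a i / y j) ^ r * ((?s (Suc r) + ?s r * 0) / (1 + 2 * cos ?\<theta> * 0 + 0\<^sup>2))))) (at_right 0)"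
      unfolding G_def by (intro tendsto_add tendsto_mult tendsto_const tendsto_power tendsto_sum Rlim id)
    then show "((\<lambda>\<epsilon>. G \<epsilon> k j) \<longlongrightarrow> (-1) ^ k * ?s (Suc k) * 1 * (1 / y j) ^ k) (at_right 0)"
      using k by (simp add: zero_power)
  qed
  also have "fdet r (\<lambda>k j. ((-1) ^ k * ?s (Suc k)) * 1 * (1 / y j) ^ k) =
     (\<Prod>k<r. (-1) ^ k * ?s (Suc k)) * (\<Prod>j<r. 1) * fdet r (\<lambda>k j. (1 / y j) ^ k)"
    by (rule fdet_scale)
  finally have lim: "((\<lambda>\<epsilon>. fdet r (\<lambda>i k. a i ^ k) * fdet r (G \<epsilon>)) \<longlongrightarrow>
     fdet r (\<lambda>i k. a i ^ k) * ((\<Prod>k<r. (-1) ^ k * ?s (Suc k)) * fdet r (\<lambda>k j. (1 / y j) ^ k))) (at_right 0)"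
    by simp
  have "\<forall>\<^sub>F \<epsilon> in at_right 0. fdet r (\<lambda>i k. a i ^ k) * fdet r (G \<epsilon>) = fdet r (f \<epsilon>) / (\<Prod>k<r. \<epsilon> ^ k)"
    using eventually_at_right_less[of "0::real"]
  proof eventually_elim
    case (elim \<epsilon>)
    have "fdet r W * fdet r (f \<epsilon>) = fdet r (\<lambda>k j. \<epsilon> ^ k * 1 * G \<epsilon> k j)"
      unfolding fdet_mult[symmetric] using Wf elim by (intro fdet_cong) auto
    also have "\<dots> = (\<Prod>k<r. \<epsilon> ^ k) * (\<Prod>j<r. 1) * fdet r (G \<epsilon>)"
      by (rule fdet_scale)
    finally have eq: "fdet r W * fdet r (f \<epsilon>) = (\<Prod>k<r. \<epsilon> ^ k) * fdet r (G \<epsilon>)" by simp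
    have "(\<Prod>k<r. \<epsilon> ^ k) * (fdet r (\<lambda>i k. a i ^ k) * fdet r (G \<epsilon>)) =
      fdet r (\<lambda>i k. a i ^ k) * ((\<Prod>k<r. \<epsilon> ^ k) * fdet r (G \<epsilon>))" by (rule mult.left_commute)
    also have "\<dots> = (fdet r W * fdet r (\<lambda>i k. a i ^ k)) * fdet r (f \<epsilon>)"
      unfolding eq[symmetric] by (simp only: mult_ac)
    also have "\<dots> = fdet r (f \<epsilon>)" unfolding WV by simp
    finally have "(\<Prod>k<r. \<epsilon> ^ k) * (fdet r (\<lambda>i k. a i ^ k) * fdet r (G \<epsilon>)) = fdet r (f \<epsilon>)" .
    moreover have "0 < (\<Prod>k<r. \<epsilon> ^ k)" using elim by (intro prod_pos) auto
    ultimately show ?case by (metis nonzero_mult_div_cancel_left order_less_irrefl)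
  qed
  from Lim_transform_eventually[OF lim this] show ?thesis
    unfolding f_def .
qed

text \<open>The limit for small \<open>x\<close> is \<open>C * S \<alpha>\<close>, where
  \<open>C\<close> collects two Vandermonde determinants and does not depend on the parameter. The
  sign of \<open>C\<close> is read off at \<open>1 / real (Suc r)\<close>, where the minors are
  nonnegative and all sines positive.\<close>

lemma exists_negative_minor:
  assumes r: "2 \<le> r" and al: "\<alpha> < 1" "1 < real r * \<alpha>" "(real r - 1) * \<alpha> < 1"
  shows "\<exists>x y. incr_pts {0<..} r x \<and> incr_pts {0<..} r y \<and> kminor (Kalpha \<alpha>) r x y < 0"
proof (rule ccontr)
  assume no: "\<not> ?thesis"
  have al0: "0 < \<alpha>" using al(2) r zero_less_mult_pos[of "real r" \<alpha>] by linarith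
  define a where "a i = real (Suc i)" for i
  define V where "V = fdet r (\<lambda>i k. a i ^ k)"
  define V' where "V' = fdet r (\<lambda>k j. (1 / a j) ^ k)"
  define S where "S \<beta> = (\<Prod>k<r. sin (real (Suc k) * (pi * \<beta>)))" for \<beta>
  define C where "C = V * ((\<Prod>k<r. (-1) ^ k) * V')"
  have a: "0 < a i" for i by (simp add: a_def)
  have "fdet r (\<lambda>i l. a l ^ i) \<noteq> 0" "fdet r (\<lambda>i l. (1 / a l) ^ i) \<noteq> 0"
    by (rule vandermonde_nonzero; auto simp: inj_on_def a_def)+
  moreover have "V = fdet r (\<lambda>i l. a l ^ i)" unfolding V_def by (rule fdet_transpose)
  ultimately have V: "V \<noteq> 0" "V' \<noteq> 0" by (auto simp: V'_def)
  then have C: "C \<noteq> 0" by (simp add: C_def)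
  have limit: "0 \<le> C * S \<beta>"
    if \<beta>: "0 \<le> \<beta>" "\<beta> < 1"
      and nonneg: "\<And>x y. incr_pts {0<..} r x \<Longrightarrow> incr_pts {0<..} r y \<Longrightarrow> 0 \<le> kminor (Kalpha \<beta>) r x y" for \<beta>
  proof -
    have "0 \<le> V * ((\<Prod>k<r. (-1) ^ k * sin (real (Suc k) * (pi * \<beta>))) * V')"
    proof (rule tendsto_lowerbound)
      show "((\<lambda>\<epsilon>. fdet r (\<lambda>i j. sin (pi * \<beta>) * (a j)\<^sup>2 * Kalpha \<beta> (\<epsilon> * a i) (a j)) / (\<Prod>k<r. \<epsilon> ^ k)) \<longlongrightarrow>
         V * ((\<Prod>k<r. (-1) ^ k * sin (real (Suc k) * (pi * \<beta>))) * V')) (at_right 0)"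
        unfolding V_def V'_def
        by (rule tendsto_minor_small_x[OF \<beta>]) (use a V in \<open>auto simp: V_def\<close>)
      show "\<forall>\<^sub>F \<epsilon> in at_right 0. 0 \<le> fdet r (\<lambda>i j. sin (pi * \<beta>) * (a j)\<^sup>2 * Kalpha \<beta> (\<epsilon> * a i) (a j)) / (\<Prod>k<r. \<epsilon> ^ k)"
        using eventually_at_right_less[of "0::real"]
      proof eventually_elim
        case (elim \<epsilon>)
        have "0 \<le> kminor (Kalpha \<beta>) r (\<lambda>i. \<epsilon> * a i) a"
          by (rule nonneg) (use elim in \<open>auto simp: incr_pts_def a_def\<close>)
        moreover have "0 \<le> sin (pi * \<beta>)" using \<beta> by (intro sin_ge_zero) auto
        moreover have "fdet r (\<lambda>i j. sin (pi * \<beta>) * (a j)\<^sup>2 * Kalpha \<beta> (\<epsilon> * a i) (a j)) =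
          (\<Prod>i<r. sin (pi * \<beta>)) * (\<Prod>j<r. (a j)\<^sup>2) * kminor (Kalpha \<beta>) r (\<lambda>i. \<epsilon> * a i) a"
          unfolding kminor_fdet by (rule fdet_scale)
        ultimately show ?case
          using elim by (auto intro!: divide_nonneg_nonneg mult_nonneg_nonneg prod_nonneg)
      qed
    qed simp
    also have "\<dots> = C * S \<beta>" by (simp only: C_def S_def prod.distrib mult_ac)
    finally show ?thesis .
  qed
  have "0 \<le> C * S (1 / real (Suc r))"
    using r by (intro limit Kalpha_minor_nonneg[where N = "Suc r"]) auto
  moreover have "0 < S (1 / real (Suc r))"
    unfolding S_def
  proof (intro prod_pos sin_gt_zero)
    fix k assume k: "k \<in> {..<r}"
    have "real (Suc k) / real (Suc r) < 1" using k by simp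
    then have "pi * (real (Suc k) / real (Suc r)) < pi * 1" by (intro mult_strict_left_mono) auto
    then show "real (Suc k) * (pi * (1 / real (Suc r))) < pi" by (simp add: mult_ac)
  qed simp
  ultimately have "0 < C" using C by (simp add: zero_le_mult_iff)
  \<comment> \<open>Only the last sine is negative: \<open>(real r - 1) * \<alpha> < 1\<close> keeps
    the others within the first half period, and adding \<open>\<alpha> < 1\<close> keeps
    \<open>real r * \<alpha>\<close> below 2.\<close>
  moreover have "S \<alpha> < 0"
  proof -
    obtain q where q: "r = Suc q" using r by (cases r) auto
    have "0 < (\<Prod>k<q. sin (real (Suc k) * (pi * \<alpha>)))"
    proof (intro prod_pos sin_gt_zero)
      fix k assume k: "k \<in> {..<q}"
      then have "real (Suc k) \<le> real r - 1" using q by auto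
      then have "real (Suc k) * \<alpha> \<le> (real r - 1) * \<alpha>" using al0 by (intro mult_right_mono) auto
      then have "pi * (real (Suc k) * \<alpha>) < pi * 1" using al(3) by (intro mult_strict_left_mono) auto
      then show "real (Suc k) * (pi * \<alpha>) < pi" by (simp add: mult_ac)
    qed (use al0 in auto)
    moreover have "sin (real r * (pi * \<alpha>)) < 0"
    proof (rule sin_lt_zero)
      have "pi * 1 < pi * (real r * \<alpha>)" using al(2) by (intro mult_strict_left_mono) auto
      then show "pi < real r * (pi * \<alpha>)" by (simp add: mult_ac)
      have "real r * \<alpha> < 2" using al(1,3) by (simp add: left_diff_distrib)
      then have "pi * (real r * \<alpha>) < pi * 2" by (intro mult_strict_left_mono) auto
      then show "real r * (pi * \<alpha>) < 2 * pi" by (simp add: mult_ac)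
    qed
    ultimately show ?thesis unfolding S_def q by (simp add: mult_pos_neg del: of_nat_Suc)
  qed
  ultimately have "C * S \<alpha> < 0" by (rule mult_pos_neg)
  moreover have "0 \<le> C * S \<alpha>"
    using no al0 al(1) by (intro limit) (auto simp: not_less)
  ultimately show False by simp
qed

lemma not_SR_between_unit_fractions:
  assumes r: "2 \<le> r" "r \<le> n" and al: "\<alpha> < 1" "1 < real r * \<alpha>" "(real r - 1) * \<alpha> < 1"
  shows "\<not> SR {0<..} (enat n) (Kalpha \<alpha>)"
proof
  assume "SR {0<..} (enat n) (Kalpha \<alpha>)"
  then obtain e :: "nat \<Rightarrow> real" where e: "e r \<in> {-1, 1}"
    "\<And>x y. incr_pts {0<..} r x \<Longrightarrow> incr_pts {0<..} r y \<Longrightarrow> 0 \<le> e r * kminor (Kalpha \<alpha>) r x y"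
    unfolding SR_def using r by (metis enat_ord_simps(1) one_le_numeral order_trans)
  have "0 < \<alpha>" using al(2) r zero_less_mult_pos[of "real r" \<alpha>] by linarith
  then obtain x where x: "incr_pts {0<..} r x" "0 < kminor (Kalpha \<alpha>) r x x"
    using exists_positive_minor[of \<alpha> r] al(1) by auto
  obtain u v where uv: "incr_pts {0<..} r u" "incr_pts {0<..} r v" "kminor (Kalpha \<alpha>) r u v < 0"
    using exists_negative_minor[OF r(1) al] by auto
  show False
    using e(1) e(2)[OF x(1) x(1)] e(2)[OF uv(1,2)] x(2) uv(3) by auto
qed

lemma SR_imp_unit_fraction_or_small:
  assumes n: "2 \<le> n" and al: "0 \<le> \<alpha>" "\<alpha> < 1" and SR: "SR {0<..} (enat n) (Kalpha \<alpha>)"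
  shows "(\<exists>k::nat. 2 \<le> k \<and> k \<le> n \<and> \<alpha> = 1 / real k) \<or> \<alpha> < 1 / real n"
proof (rule ccontr)
  assume no: "\<not> ?thesis"
  then have "1 / real n \<le> \<alpha>" by auto
  moreover have "0 < 1 / real n" using n by simp
  ultimately have al0: "0 < \<alpha>" by linarith
  have inv: "1 / \<alpha> \<le> real n" using \<open>1 / real n \<le> \<alpha>\<close> al0 n by (simp add: field_simps)
  \<comment> \<open>With this \<open>k\<close>, the parameter lies above \<open>1 / (k + 1)\<close>
    and at most at \<open>1 / k\<close>. Unless it equals \<open>1 / k\<close>, the obstruction
    appears at order \<open>k + 1\<close>, which does not exceed \<open>n\<close>.\<close>
  define k where "k = nat \<lfloor>1 / \<alpha>\<rfloor>"
  have one: "1 < 1 / \<alpha>" using al al0 by simp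
  then have fl: "1 \<le> \<lfloor>1 / \<alpha>\<rfloor>" by linarith
  then have "int k = \<lfloor>1 / \<alpha>\<rfloor>" unfolding k_def by linarith
  then have "real k = real_of_int \<lfloor>1 / \<alpha>\<rfloor>" by (metis of_int_of_nat_eq)
  then have k: "real k \<le> 1 / \<alpha>" "1 / \<alpha> < real k + 1" "1 \<le> k"
    using fl \<open>int k = \<lfloor>1 / \<alpha>\<rfloor>\<close> by linarith+
  have "real k \<noteq> 1 / \<alpha>"
  proof
    assume k_eq: "real k = 1 / \<alpha>"
    have "1 < real k" "real k \<le> real n" using k_eq one inv by linarith+
    then have "2 \<le> k" "k \<le> n" by simp_all
    moreover have "\<alpha> = 1 / real k" using k_eq by simp
    ultimately have "\<alpha> = 1 / real k" "2 \<le> k" "k \<le> n" by simp_all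
    then show False using no by blast
  qed
  then have k1: "real k < 1 / \<alpha>" using k(1) by simp
  have "real k < real n" using k1 inv by linarith
  then have "Suc k \<le> n" by simp
  moreover have "(real (Suc k) - 1) * \<alpha> < 1" using k1 al0 by (simp add: field_simps)
  moreover have "1 < real (Suc k) * \<alpha>" using k(2) al0 by (simp add: field_simps)
  ultimately have "\<not> SR {0<..} (enat n) (Kalpha \<alpha>)"
    using not_SR_between_unit_fractions[of "Suc k" n \<alpha>] k(3) al(2) by simp
  then show False using SR by simp
qed

section \<open>Assembly of the equivalences\<close>

lemma STP_I:
  assumes "0 \<le> \<alpha>" "\<alpha> < 1"
    and "\<And>m x y. enat m \<le> n \<Longrightarrow> incr_pts {0<..} m x \<Longrightarrow> incr_pts {0<..} m y \<Longrightarrow> 0 \<le> kminor (Kalpha \<alpha>) m x y"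
  shows "STP {0<..} n (Kalpha \<alpha>)"
  unfolding STP_def
proof (intro allI impI, elim conjE)
  fix m x y assume m: "enat m \<le> n" and "incr_pts {0<..} m x" "incr_pts {0<..} m y"
  moreover have "enat k \<le> n" if "k \<le> m" for k
    using that m by (meson enat_ord_simps(1) order_trans)
  ultimately show "0 < kminor (Kalpha \<alpha>) m x y"
    using assms by (intro Kalpha_minor_pos) auto
qed

lemma STP_unit_fraction:
  assumes "\<alpha> = 0 \<or> (\<exists>k::nat. k \<ge> 2 \<and> \<alpha> = 1 / real k)"
  shows "STP {0<..} \<infinity> (Kalpha \<alpha>)"
  using assms
proof
  assume "\<alpha> = 0"
  then show ?thesis using Kalpha_0_minor_nonneg by (intro STP_I) auto
next
  assume "\<exists>k::nat. k \<ge> 2 \<and> \<alpha> = 1 / real k"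
  then obtain k where "2 \<le> k" "\<alpha> = 1 / real k" by auto
  then show ?thesis using Kalpha_minor_nonneg[where N = k] by (intro STP_I) auto
qed

lemma STP_mono: "n' \<le> n \<Longrightarrow> STP I n K \<Longrightarrow> STP I n' K"
  unfolding STP_def by (meson order_trans)

lemma STP_of_le:
  assumes n: "2 \<le> n" and al: "0 \<le> \<alpha>" "\<alpha> \<le> 1 / real n"
  shows "STP {0<..} (enat n) (Kalpha \<alpha>)"
proof (cases "\<alpha> = 0")
  case True
  then show ?thesis using STP_mono[OF _ STP_unit_fraction] by simp
next
  case False
  have "1 / real n < 1" using n by simp
  then have al1: "\<alpha> < 1" using al by linarith
  show ?thesis
  proof (rule STP_I[OF al(1) al1])
    fix m x y assume "enat m \<le> enat n" "incr_pts {0<..} m x" "incr_pts {0<..} m y"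
    moreover have "real n * \<alpha> \<le> 1" using al n by (simp add: field_simps)
    ultimately show "0 \<le> kminor (Kalpha \<alpha>) m x y"
      using False al al1 n by (intro Kalpha_minor_nonneg[where N = n]) auto
  qed
qed

lemma STP_imp_TP: "STP I n K \<Longrightarrow> TP I n K"
  unfolding STP_def TP_def by (meson less_imp_le)

lemma TP_imp_SR: "TP I n K \<Longrightarrow> SR I n K"
  unfolding TP_def SR_def by (intro exI[of _ "\<lambda>_. 1"]) auto

lemma SR_mono: "n' \<le> n \<Longrightarrow> SR I n K \<Longrightarrow> SR I n' K"
  unfolding SR_def by (meson order_trans)

theorem mainTheorem1:
  fixes \<alpha> :: real
  assumes "0 \<le> \<alpha>" and "\<alpha> < 1"
  shows "(STP {0<..} \<infinity> (Kalpha \<alpha>) \<longleftrightarrow> SR {0<..} \<infinity> (Kalpha \<alpha>))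
       \<and> (SR {0<..} \<infinity> (Kalpha \<alpha>) \<longleftrightarrow> (\<alpha> = 0 \<or> (\<exists>k::nat. k \<ge> 2 \<and> \<alpha> = 1 / real k)))
       \<and> (\<forall>n::nat. n \<ge> 2 \<longrightarrow>
            (TP {0<..} (enat n) (Kalpha \<alpha>) \<longleftrightarrow> SR {0<..} (enat n) (Kalpha \<alpha>))
          \<and> (SR {0<..} (enat n) (Kalpha \<alpha>) \<longrightarrow>
               (\<exists>k::nat. 2 \<le> k \<and> k \<le> n \<and> \<alpha> = 1 / real k) \<or> \<alpha> < 1 / real n))
       \<and> (\<forall>n::nat. n \<ge> 2 \<longrightarrow>
            \<alpha> \<le> 1 / real n \<longrightarrow>
            (max 0 (real n ^ 2 - real n - 6) = 0 \<or> \<alpha> \<le> 1 / max 0 (real n ^ 2 - real n - 6)) \<longrightarrow>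
            STP {0<..} (enat n) (Kalpha \<alpha>))"
proof -
  let ?K = "Kalpha \<alpha>"
  have frac: "\<alpha> = 0 \<or> (\<exists>k::nat. k \<ge> 2 \<and> \<alpha> = 1 / real k)" if SR: "SR {0<..} \<infinity> ?K"
  proof (cases "\<alpha> = 0")
    case False
    \<comment> \<open>An order \<open>n\<close> beyond \<open>1 / \<alpha>\<close> rules out the
      alternative \<open>\<alpha> < 1 / n\<close>, so only unit fractions remain.\<close>
    obtain n :: nat where n: "max 2 (1 / \<alpha>) < real n" using reals_Archimedean2 by blast
    then have "2 \<le> n" by simp
    have "1 < real n * \<alpha>" using n False assms by (simp add: field_simps)
    then have "\<not> \<alpha> < 1 / real n" using \<open>2 \<le> n\<close> by (simp add: field_simps)
    moreover have "SR {0<..} (enat n) ?K" using SR by (rule SR_mono[rotated]) simp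
    ultimately show ?thesis
      using SR_imp_unit_fraction_or_small[OF \<open>2 \<le> n\<close> assms] by blast
  qed simp
  \<comment> \<open>The sign pattern is never inspected: each alternative of the necessary condition
    already yields strict total positivity of order \<open>n\<close>.\<close>
  have SR_TP: "TP {0<..} (enat n) ?K" if n: "2 \<le> n" and SR: "SR {0<..} (enat n) ?K" for n
  proof -
    have "STP {0<..} (enat n) ?K"
      using SR_imp_unit_fraction_or_small[OF n assms SR]
    proof
      assume "\<exists>k::nat. 2 \<le> k \<and> k \<le> n \<and> \<alpha> = 1 / real k"
      then show ?thesis using STP_mono[OF _ STP_unit_fraction] by auto
    next
      assume "\<alpha> < 1 / real n"
      then show ?thesis using STP_of_le[OF n assms(1)] by simp
    qed
    then show ?thesis by (rule STP_imp_TP)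
  qed
  show ?thesis
  proof (intro conjI allI impI iffI)
    show "SR {0<..} \<infinity> ?K" if "STP {0<..} \<infinity> ?K"
      by (rule TP_imp_SR[OF STP_imp_TP[OF that]])
    show "STP {0<..} \<infinity> ?K" if "SR {0<..} \<infinity> ?K"
      by (rule STP_unit_fraction[OF frac[OF that]])
    show "\<alpha> = 0 \<or> (\<exists>k::nat. k \<ge> 2 \<and> \<alpha> = 1 / real k)" if "SR {0<..} \<infinity> ?K"
      by (rule frac[OF that])
    show "SR {0<..} \<infinity> ?K" if "\<alpha> = 0 \<or> (\<exists>k::nat. k \<ge> 2 \<and> \<alpha> = 1 / real k)"
      by (rule TP_imp_SR[OF STP_imp_TP[OF STP_unit_fraction[OF that]]])
  next
    fix n :: nat assume n: "2 \<le> n"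
    show "SR {0<..} (enat n) ?K" if "TP {0<..} (enat n) ?K"
      by (rule TP_imp_SR[OF that])
    show "TP {0<..} (enat n) ?K" if "SR {0<..} (enat n) ?K"
      by (rule SR_TP[OF n that])
    show "(\<exists>k::nat. 2 \<le> k \<and> k \<le> n \<and> \<alpha> = 1 / real k) \<or> \<alpha> < 1 / real n" if "SR {0<..} (enat n) ?K"
      by (rule SR_imp_unit_fraction_or_small[OF n assms that])
    show "STP {0<..} (enat n) ?K" if "\<alpha> \<le> 1 / real n"
      by (rule STP_of_le[OF n assms(1) that])
  qed
qed

end
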